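(* Let $\alpha\in[0,1)$ and $p\in[0,1]$. Put $c:=\frac{(1-\alpha)^2}{\alpha}$ if $\alpha\in(0,1)$ (equivalently, $\alpha=1+\frac c2-\frac{\sqrt{4c+c^2}}{2}$) and $c:=\infty$ if $\alpha=0$. Let $X=(X_m)_{m\in\mathbb{Z}}$, $X_m=\mathbf{1}_{\{z_m\in T\}}$, where $T$ is the weighted random spanning tree of the zigzag ladder graph $G^{H_2}$ under $\mathbf{P}^c$ (with $X\equiv1$ if $c=\infty$), let $(Y_m)_{m\in\mathbb{Z}}$ be i.i.d. Bernoulli random variables with parameter $p$, independent of $X$, and let $\tilde X_m:=X_mY_m$. (i) The process $X$ is determinantal with matrix $A_{k,l}=\widehat f(l-k)$, $k,l\in\mathbb{Z}$, where $$\widehat f(k)=\frac{1-\alpha}{1+\alpha}\,\alpha^{|k|}\quad\text{for all }k\in\mathbb{Z}\qquad\text{and}\qquad f(x)=\frac{c}{c+2-2\cos(2\pi x)}.$$ In particular, $X$ is a renewal process with renewal distribution $$\mathbf{P}\big[\inf\{k\ge1:X_k=1\}=m\,\big|\,X_0=1\big]=(1-\alpha)^2\,m\,\alpha^{m-1},\qquad m\in\{1,2,\dots\}.$$ (ii) The thinned process $\tilde X$ is determinantal with matrix $\tilde A=pA$ and Fourier transform $$\tilde f(x)=\frac{pc}{c+2-2\cos(2\pi x)}.$$ (iii) Every stationary (Hermitian) determinantal point process on $\mathbb{Z}$ that is also a renewal process has the distribution of $\tilde X$ for some $\alpha\in[0,1)$ and $p\in[0,1]$.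
   Context: Zigzag ladder graph (helix-2-graph) $G^{H_2}$: vertex set $\mathbb{Z}$, edges $z_m=\{m-1,m\}$ and $h_m=\{m-2,m\}$ for $m\in\mathbb{Z}$. For $m\le n$, $G^{H_2}_{m,n}$ is the subgraph induced by $\{m,\dots,n\}$. Edge weights for $c\in(0,\infty)$: each $z_m$ has weight $c$, each $h_m$ has weight $1$. The weight of a spanning tree is the product of the weights of its edges. $\mathbf{P}^c_n$ is the probability measure on spanning trees of $G^{H_2}_{-n,n}$ giving each tree probability proportional to its weight, and $\mathbf{P}^c=\lim_{n\to\infty}\mathbf{P}^c_n$ (the limit exists, in the sense of convergence of probabilities of events depending on finitely many edges, and is concentrated on spanning trees of $G^{H_2}$). $T$ denotes the random spanning tree under $\mathbf{P}^c$. For $c=\infty$ set $X\equiv1$. A $\{0,1\}^{\mathbb{Z}}$-valued process $X$ is a (Hermitian) determinantal point process with matrix $A$ (a Hermitian matrix indexed by $\mathbb{Z}$) if $\mathbf{P}[X_s=1\text{ for all }s\in S]=\det((A_{ij})_{i,j\in S})$ for all finite $S\subset\mathbb{Z}$. If $A_{k,l}=A_{0,l-k}$ for all $k,l$, its Fourier transform is the (a.e. unique) measurable $f:[0,1]\to[0,1]$ with $A_{0,k}=\widehat f(k):=\int_0^1 f(x)e^{-2\pi i kx}\,dx$ for all $k\in\mathbb{Z}$. A stationary process $X$ is a renewal process if it is regenerative of order 1: for all measurable $B\subset\{0,1\}^{\{-1,-2,\dots\}}$ and $C\subset\{0,1\}^{\{1,2,\dots\}}$, $\mathbf{P}[X|_{\{1,2,\dots\}}\in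 C\mid X|_{\{-1,-2,\dots\}}\in B,\ X_0=1]=\mathbf{P}[X|_{\{1,2,\dots\}}\in C\mid X_0=1]$ (whenever the conditioning events have positive probability). Conventions for $\alpha=0$, $c=\infty$: $0^0=1$, so $A=I$ is the identity matrix, $f\equiv1$ and $\tilde f\equiv p$. *)

theory Defs
  imports "HOL-Probability.Probability" "Jordan_Normal_Form.Determinant"
begin

section \<open>Spanning trees of the zigzag ladder graph\<close>

text \<open>An edge is the set of its two end points.\<close>

definition z_edge :: "int \<Rightarrow> int set" where
  "z_edge m = {m - 1, m}"

definition h_edge :: "int \<Rightarrow> int set" where
  "h_edge m = {m - 2, m}"

definition zigzag_edges :: "int set set" where
  "zigzag_edges = range z_edge \<union> range h_edge"

definition induced_edges :: "'v set set \<Rightarrow> 'v set \<Rightarrow> 'v set set" where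
  "induced_edges E V = {e \<in> E. e \<subseteq> V}"

definition is_cycle :: "'v set set \<Rightarrow> 'v list \<Rightarrow> bool" where
  "is_cycle t vs \<longleftrightarrow> 3 \<le> length vs \<and> distinct vs \<and>
     (\<forall>i < length vs. {vs ! i, vs ! (Suc i mod length vs)} \<in> t)"

text \<open>Spanning trees of the simple graph \<open>(V, E)\<close>, given by their edge sets.\<close>

definition spanning_trees :: "'v set \<Rightarrow> 'v set set \<Rightarrow> 'v set set set" where
  "spanning_trees V E = {t. t \<subseteq> E \<and>
     (\<forall>u\<in>V. \<forall>v\<in>V. (u, v) \<in> {(a, b). {a, b} \<in> t}\<^sup>*) \<and>
     \<not> (\<exists>vs. is_cycle t vs)}"

definition box_trees :: "nat \<Rightarrow> int set set set" where
  "box_trees n = spanning_trees {- int n..int n} (induced_edges zigzag_edges {- int n..int n})"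

definition tree_weight :: "real \<Rightarrow> int set set \<Rightarrow> real" where
  "tree_weight c t = (\<Prod>e\<in>t. if e \<in> range z_edge then c else 1)"

definition box_tree_measure :: "real \<Rightarrow> nat \<Rightarrow> int set set measure" where
  "box_tree_measure c n = point_measure (box_trees n)
     (\<lambda>t. ennreal (tree_weight c t / (\<Sum>t'\<in>box_trees n. tree_weight c t')))"

text \<open>The product space \<open>{0,1}\<^sup>E\<close>, written as the space of all subsets of the edge set.\<close>

definition edge_config_space :: "int set set measure" where
  "edge_config_space = sigma (Pow zigzag_edges)
     ((\<lambda>e. {t. t \<subseteq> zigzag_edges \<and> e \<in> t}) ` zigzag_edges)"

text \<open>The events depending only on the edges in \<open>F\<close> are those of the form
  \<open>{t. t \<inter> F \<in> D}\<close> with \<open>D \<subseteq> Pow F\<close>.\<close>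

definition is_tree_limit :: "real \<Rightarrow> int set set measure \<Rightarrow> bool" where
  "is_tree_limit c \<mu> \<longleftrightarrow> prob_space \<mu> \<and> space \<mu> = space edge_config_space \<and>
     sets \<mu> = sets edge_config_space \<and>
     (\<forall>F D. finite F \<and> F \<subseteq> zigzag_edges \<and> D \<subseteq> Pow F \<longrightarrow>
       (\<lambda>n. measure (box_tree_measure c n) {t \<in> space (box_tree_measure c n). t \<inter> F \<in> D})
         \<longlonglongrightarrow> measure \<mu> {t \<in> space \<mu>. t \<inter> F \<in> D})"

definition tree_measure :: "real \<Rightarrow> int set set measure" where
  "tree_measure c = (THE \<mu>. is_tree_limit c \<mu>)"

section \<open>Binary processes indexed by the integers\<close>

definition bit_process :: "'a measure \<Rightarrow> (int \<Rightarrow> 'a \<Rightarrow> bool) \<Rightarrow> bool" where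
  "bit_process M X \<longleftrightarrow> prob_space M \<and> (\<forall>m. X m \<in> M \<rightarrow>\<^sub>M count_space UNIV)"

definition bit_space :: "int set \<Rightarrow> (int \<Rightarrow> bool) measure" where
  "bit_space J = Pi\<^sub>M J (\<lambda>_. count_space UNIV)"

definition process_law :: "'a measure \<Rightarrow> (int \<Rightarrow> 'a \<Rightarrow> bool) \<Rightarrow> (int \<Rightarrow> bool) measure" where
  "process_law M X = distr M (bit_space UNIV) (\<lambda>\<omega> m. X m \<omega>)"

definition stationary :: "'a measure \<Rightarrow> (int \<Rightarrow> 'a \<Rightarrow> bool) \<Rightarrow> bool" where
  "stationary M X \<longleftrightarrow> bit_process M X \<and>
     (\<forall>k. process_law M (\<lambda>m. X (m + k)) = process_law M X)"

definition renewal_process :: "'a measure \<Rightarrow> (int \<Rightarrow> 'a \<Rightarrow> bool) \<Rightarrow> bool" where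
  "renewal_process M X \<longleftrightarrow> stationary M X \<and>
     (\<forall>B \<in> sets (bit_space {..<0}). \<forall>C \<in> sets (bit_space {0<..}).
        \<P>(\<omega> in M. (\<lambda>m\<in>{..<0}. X m \<omega>) \<in> B \<and> X 0 \<omega>) > 0 \<longrightarrow>
        \<P>(\<omega> in M. (\<lambda>m\<in>{0<..}. X m \<omega>) \<in> C \<bar> (\<lambda>m\<in>{..<0}. X m \<omega>) \<in> B \<and> X 0 \<omega>)
          = \<P>(\<omega> in M. (\<lambda>m\<in>{0<..}. X m \<omega>) \<in> C \<bar> X 0 \<omega>))"

definition principal_minor :: "(int \<Rightarrow> int \<Rightarrow> complex) \<Rightarrow> int set \<Rightarrow> complex" where
  "principal_minor A S = (let s = sorted_list_of_set S in
     Determinant.det (Matrix.mat (card S) (card S) (\<lambda>(i, j). A (s ! i) (s ! j))))"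

definition determinantal :: "'a measure \<Rightarrow> (int \<Rightarrow> 'a \<Rightarrow> bool) \<Rightarrow> (int \<Rightarrow> int \<Rightarrow> complex) \<Rightarrow> bool" where
  "determinantal M X A \<longleftrightarrow> bit_process M X \<and> (\<forall>k l. A l k = cnj (A k l)) \<and>
     (\<forall>S. finite S \<longrightarrow>
        complex_of_real \<P>(\<omega> in M. \<forall>s\<in>S. X s \<omega>) = principal_minor A S)"

definition fourier_coeff :: "(real \<Rightarrow> real) \<Rightarrow> int \<Rightarrow> complex" where
  "fourier_coeff f k =
     (LINT x:{0..1}|lebesgue. complex_of_real (f x) * exp (- 2 * pi * \<i> * of_int k * x))"

definition has_fourier_transform :: "(int \<Rightarrow> int \<Rightarrow> complex) \<Rightarrow> (real \<Rightarrow> real) \<Rightarrow> bool" where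
  "has_fourier_transform A f \<longleftrightarrow> (\<forall>k l. A k l = A 0 (l - k)) \<and>
     f \<in> borel_measurable (lebesgue_on {0..1}) \<and> f \<in> {0..1} \<rightarrow> {0..1} \<and>
     (\<forall>k. A 0 k = fourier_coeff f k)"

section \<open>The zigzag process and its thinnings\<close>

text \<open>The parameter \<open>c = \<infinity>\<close> corresponds to \<open>\<alpha> = 0\<close>. It is treated separately throughout, so that
  the value of \<open>conductance 0\<close> (a division by zero) is never used.\<close>

definition conductance :: "real \<Rightarrow> real" where
  "conductance \<alpha> = (1 - \<alpha>)\<^sup>2 / \<alpha>"

definition zigzag_process :: "real \<Rightarrow> ('a \<Rightarrow> int set set) \<Rightarrow> int \<Rightarrow> 'a \<Rightarrow> bool" where
  "zigzag_process \<alpha> T m \<omega> \<longleftrightarrow> (if \<alpha> = 0 then True else z_edge m \<in> T \<omega>)"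

definition thinned :: "(int \<Rightarrow> 'a \<Rightarrow> bool) \<Rightarrow> (int \<Rightarrow> 'a \<Rightarrow> bool) \<Rightarrow> int \<Rightarrow> 'a \<Rightarrow> bool" where
  "thinned X Y m \<omega> \<longleftrightarrow> X m \<omega> \<and> Y m \<omega>"

text \<open>On the probability space \<open>M\<close>, \<open>T\<close> is the random spanning tree (unconstrained if \<open>\<alpha> = 0\<close>), and
  \<open>Y\<close> is an i.i.d. Bernoulli sequence that is independent of the process \<open>X\<close> built from \<open>T\<close>.\<close>

definition zigzag_model ::
  "real \<Rightarrow> real \<Rightarrow> 'a measure \<Rightarrow> ('a \<Rightarrow> int set set) \<Rightarrow> (int \<Rightarrow> 'a \<Rightarrow> bool) \<Rightarrow> bool" where
  "zigzag_model \<alpha> p M T Y \<longleftrightarrow> prob_space M \<and>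
     (\<alpha> \<noteq> 0 \<longrightarrow> T \<in> M \<rightarrow>\<^sub>M edge_config_space \<and>
        distr M edge_config_space T = tree_measure (conductance \<alpha>)) \<and>
     prob_space.indep_vars M (\<lambda>_. count_space UNIV) Y UNIV \<and>
     (\<forall>m. \<P>(\<omega> in M. Y m \<omega>) = p) \<and>
     prob_space.indep_var M
       (bit_space UNIV) (\<lambda>\<omega> m. zigzag_process \<alpha> T m \<omega>) (bit_space UNIV) (\<lambda>\<omega> m. Y m \<omega>)"

end

theory Submission
  imports Defs "HOL-Real_Asymp.Real_Asymp"
begin

text \<open>Read a box of the ladder from left to right. The edges among the vertices up to \<open>k\<close> either form a
  spanning tree of them (state \<open>True\<close>) or a forest with exactly two components, one containing \<open>k - 1\<close>
  and the other \<open>k\<close> (state \<open>False\<close>); every other pattern can never be completed to a spanning tree.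
  Spanning trees of a box are therefore the accepted words of a two-state automaton whose letters
  say which of the two edges \<open>z_edge k\<close>, \<open>h_edge k\<close> are present (\<open>trees_on_step\<close>,
  \<open>transfer_config_tree\<close>), and box probabilities are quotients of products of 2x2 matrices.

  A letter that contains the z-edge leads to state \<open>True\<close>, and it does so with weight \<open>c\<close> from either
  state. A z-edge thus erases the memory of the automaton, which is why \<open>X\<close> is a renewal process. The
  transfer matrix has trace \<open>c + 2\<close> and determinant 1, so its eigenvalues are \<open>1 / \<alpha>\<close> and \<open>\<alpha>\<close> where
  \<open>\<alpha> + 1 / \<alpha> = c + 2\<close>: this is the relation between \<open>c\<close> and \<open>\<alpha>\<close>. Its spectral decomposition
  (\<open>transfer_free\<close>) shows that the probabilities of all finite-window events converge, so that the
  tree measure exists by Kolmogorov's extension theorem (\<open>is_tree_limit_tree_measure\<close>), and that the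
  probability of seeing ones at a finite set of positions is \<open>\<kappa>\<close> times the product of
  \<open>\<kappa> (1 - \<alpha>^(2 g))\<close> over the gaps \<open>g\<close> of the set, with \<open>\<kappa> = (1 - \<alpha>) / (1 + \<alpha>)\<close>
  (\<open>gap_product_tree_measure\<close>). Thinning replaces \<open>\<kappa>\<close> by \<open>p \<kappa>\<close>.

  Parts (i) and (ii) are consequences of this product formula. It is invariant under shifts and splits
  at every point, so the process is stationary and renewal (\<open>renewal_process_if_gap_product\<close>). The
  principal minors of the matrix \<open>\<kappa> \<alpha>^|k - l|\<close> obey the same recursion in the largest point, by a
  single column operation (\<open>principal_minor_geometric_insert\<close>). The Fourier coefficients of \<open>f\<close> form a
  bounded solution of a second order recurrence, hence a geometric sequence
  (\<open>fourier_coeff_poisson_kernel\<close>). Decomposing at the last visit gives the renewal equation, which for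
  these gap factors collapses to a three-term recurrence with double root \<open>\<alpha>\<close> (\<open>zigzag_survival\<close>).

  For (iii), let \<open>\<rho>\<close> be the density of a determinantal renewal process with kernel \<open>K\<close> and let
  \<open>a n\<close> be the modulus of \<open>K 0 n\<close>. Comparing the 3x3 minor at \<open>0, m, m + n\<close> with the renewal property gives
  \<open>2 Re (K 0 m * K m (m + n) * K (m + n) 0) = \<rho> a(m + n)^2 + a(m)^2 a(n)^2 / \<rho>\<close>. The left side is at most
  \<open>2 a(m) a(n) a(m + n)\<close>, the right side is at least that by the inequality between arithmetic and geometric mean.
  Equality must hold, so \<open>\<rho> a(m + n) = a(m) a(n)\<close> and \<open>a n = \<rho> \<beta>^n\<close>
  (\<open>determinantal_renewal_modulus\<close>). This is the product formula of the thinned zigzag process with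
  \<open>q = \<rho> (1 + \<beta>) / (1 - \<beta>)\<close>. That \<open>q\<close> is at most 1 follows from the three-term recurrence for the
  gap probabilities: for \<open>q > 1\<close> its characteristic roots are not real, and a solution
  would have to change sign (\<open>renewal_geometric_bound\<close>).\<close>

section \<open>Binary processes whose correlations factorise over the gaps\<close>

definition cylinders :: "'a set \<Rightarrow> ('i \<Rightarrow> 'a set) \<Rightarrow> 'i set \<Rightarrow> 'a set set" where
  "cylinders \<Omega> S I = (\<lambda>F. {\<omega> \<in> \<Omega>. \<forall>i\<in>F. \<omega> \<in> S i}) ` {F. finite F \<and> F \<subseteq> I}"

lemma Int_stable_cylinders: "Int_stable (cylinders \<Omega> S I)"
proof (rule Int_stableI)
  fix A B assume "A \<in> cylinders \<Omega> S I" "B \<in> cylinders \<Omega> S I"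
  then obtain F where F: "finite F" "F \<subseteq> I" "A = {\<omega> \<in> \<Omega>. \<forall>i\<in>F. \<omega> \<in> S i}"
    unfolding cylinders_def by blast
  obtain F' where F': "finite F'" "F' \<subseteq> I" "B = {\<omega> \<in> \<Omega>. \<forall>i\<in>F'. \<omega> \<in> S i}"
    using \<open>B \<in> _\<close> unfolding cylinders_def by blast
  have "A \<inter> B = {\<omega> \<in> \<Omega>. \<forall>i\<in>F \<union> F'. \<omega> \<in> S i}" unfolding F F' by auto
  with F F' show "A \<inter> B \<in> cylinders \<Omega> S I"
    unfolding cylinders_def by (intro image_eqI[of _ _ "F \<union> F'"]) auto
qed

lemma sigma_sets_cylinders:
  assumes "\<And>i. i \<in> I \<Longrightarrow> S i \<subseteq> \<Omega>"
  shows "sigma_sets \<Omega> (cylinders \<Omega> S I) = sigma_sets \<Omega> (S ` I)"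
proof (rule sigma_sets_eqI)
  fix A assume "A \<in> cylinders \<Omega> S I"
  then obtain F where F: "finite F" "F \<subseteq> I" "A = {\<omega> \<in> \<Omega>. \<forall>i\<in>F. \<omega> \<in> S i}"
    unfolding cylinders_def by blast
  have "{\<omega> \<in> \<Omega>. \<forall>i\<in>F. \<omega> \<in> S i} \<in> sigma_sets \<Omega> (S ` I)" using F(1,2)
  proof (induction F)
    case empty
    show ?case by (simp add: sigma_sets_top)
  next
    case (insert i F)
    interpret sigma_algebra \<Omega> "sigma_sets \<Omega> (S ` I)"
      by (rule sigma_algebra_sigma_sets) (use assms in auto)
    have "{\<omega> \<in> \<Omega>. \<forall>j\<in>insert i F. \<omega> \<in> S j} = S i \<inter> {\<omega> \<in> \<Omega>. \<forall>j\<in>F. \<omega> \<in> S j}"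
      using assms insert.prems by blast
    moreover have "S i \<in> sigma_sets \<Omega> (S ` I)" using insert.prems by blast
    ultimately show ?case using insert by auto
  qed
  with F show "A \<in> sigma_sets \<Omega> (S ` I)" by simp
next
  fix A assume "A \<in> S ` I"
  then obtain i where i: "i \<in> I" "A = S i" by blast
  then have "A = {\<omega> \<in> \<Omega>. \<forall>j\<in>{i}. \<omega> \<in> S j}" using assms by blast
  with i have "A \<in> cylinders \<Omega> S I" unfolding cylinders_def by blast
  then show "A \<in> sigma_sets \<Omega> (cylinders \<Omega> S I)" by blast
qed

text \<open>Uniqueness of measures on a \<pi>-system, for the \<pi>-system of finite intersections of a generating family.
  It serves both for random edge sets and for random bit sequences.\<close>

lemma measure_eqI_cylinders:
  assumes M: "prob_space M" and N: "prob_space N"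
    and S: "\<And>i. i \<in> I \<Longrightarrow> S i \<subseteq> \<Omega>"
    and sets: "sets M = sigma_sets \<Omega> (S ` I)" "sets N = sigma_sets \<Omega> (S ` I)"
    and eq: "\<And>F. finite F \<Longrightarrow> F \<subseteq> I \<Longrightarrow>
      measure M {\<omega> \<in> \<Omega>. \<forall>i\<in>F. \<omega> \<in> S i} = measure N {\<omega> \<in> \<Omega>. \<forall>i\<in>F. \<omega> \<in> S i}"
  shows "M = N"
proof -
  interpret M: prob_space M by fact
  interpret N: prob_space N by fact
  show ?thesis
  proof (rule measure_eqI_generator_eq[OF Int_stable_cylinders[of \<Omega> S I], where \<Omega> = \<Omega> and A = "\<lambda>_. \<Omega>"])
    show "cylinders \<Omega> S I \<subseteq> Pow \<Omega>" by (auto simp: cylinders_def)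
    show "emeasure M X = emeasure N X" if "X \<in> cylinders \<Omega> S I" for X
      using that eq by (auto simp: cylinders_def M.emeasure_eq_measure N.emeasure_eq_measure)
    show "range (\<lambda>_::nat. \<Omega>) \<subseteq> cylinders \<Omega> S I"
      unfolding cylinders_def by (auto intro!: image_eqI[where x = "{}"])
  qed (use sigma_sets_cylinders[of I S \<Omega>] S sets in auto)
qed

lemma space_bit_space [simp]: "space (bit_space J) = PiE J (\<lambda>_. UNIV)"
  by (simp add: bit_space_def space_PiM)

text \<open>Events that prescribe ones generate everything, because a single bit is determined by whether it is
  a one.\<close>

lemma sets_bit_space:
  "sets (bit_space J) = sigma_sets (PiE J (\<lambda>_. UNIV)) ((\<lambda>j. {f \<in> PiE J (\<lambda>_. UNIV). f j}) ` J)"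
proof -
  let ?\<Omega> = "PiE J (\<lambda>_. UNIV :: bool set)"
  let ?G = "(\<lambda>j. {f \<in> ?\<Omega>. f j}) ` J"
  have "sets (bit_space J) = sigma_sets ?\<Omega> {{f \<in> ?\<Omega>. f i \<in> A} |i A. i \<in> J \<and> A \<in> UNIV}"
    unfolding bit_space_def sets_PiM_single by simp
  also have "\<dots> = sigma_sets ?\<Omega> ?G"
  proof (rule sigma_sets_eqI)
    fix B assume "B \<in> {{f \<in> ?\<Omega>. f i \<in> A} |i A. i \<in> J \<and> A \<in> UNIV}"
    then obtain i A where B: "i \<in> J" "B = {f \<in> ?\<Omega>. f i \<in> A}" by blast
    let ?C = "{f \<in> ?\<Omega>. f i}"
    have C: "?C \<in> sigma_sets ?\<Omega> ?G" using B(1) by blast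
    have "B = (if True \<in> A then if False \<in> A then ?\<Omega> else ?C else if False \<in> A then ?\<Omega> - ?C else {})"
      unfolding B by (auto; metis (full_types))
    with C show "B \<in> sigma_sets ?\<Omega> ?G"
      by (auto simp: sigma_sets_top sigma_sets.Compl sigma_sets.Empty)
  next
    fix B assume "B \<in> ?G"
    then obtain j where "j \<in> J" "B = {f \<in> ?\<Omega>. f j \<in> {True}}" by auto
    then show "B \<in> sigma_sets ?\<Omega> {{f \<in> ?\<Omega>. f i \<in> A} |i A. i \<in> J \<and> A \<in> UNIV}" by blast
  qed
  finally show ?thesis .
qed

definition all_ones :: "'a measure \<Rightarrow> (int \<Rightarrow> 'a \<Rightarrow> bool) \<Rightarrow> int set \<Rightarrow> real" where
  "all_ones M X S = \<P>(\<omega> in M. \<forall>s\<in>S. X s \<omega>)"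

lemma bit_process_measurable:
  assumes "bit_process M X"
  shows "Measurable.pred M (X m)"
  using assms by (simp add: bit_process_def)

lemma bit_process_restrict_measurable:
  assumes "bit_process M X"
  shows "(\<lambda>\<omega>. \<lambda>m\<in>J. X m \<omega>) \<in> M \<rightarrow>\<^sub>M bit_space J"
  unfolding bit_space_def by (rule measurable_restrict) (use assms in \<open>simp add: bit_process_def\<close>)

lemma bit_process_path_measurable:
  assumes "bit_process M X"
  shows "(\<lambda>\<omega> m. X m \<omega>) \<in> M \<rightarrow>\<^sub>M bit_space UNIV"
  using bit_process_restrict_measurable[OF assms, of UNIV] by (simp add: restrict_UNIV)

lemma measure_process_law:
  assumes X: "bit_process M X" and E: "{f. \<Phi> f} \<in> sets (bit_space UNIV)"
  shows "measure (process_law M X) {f. \<Phi> f} = \<P>(\<omega> in M. \<Phi> (\<lambda>m. X m \<omega>))"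
  unfolding process_law_def
  by (subst measure_distr[OF bit_process_path_measurable[OF X] E]) (simp add: vimage_def Int_def conj_commute)

lemma component_pred [measurable]: "Measurable.pred (bit_space UNIV) (\<lambda>f. f i)"
  by (simp add: bit_space_def)

lemma bit_space_Collect: "Measurable.pred (bit_space UNIV) \<Phi> \<Longrightarrow> {f. \<Phi> f} \<in> sets (bit_space UNIV)"
  by (simp add: pred_def)

lemma prob_space_process_law: "bit_process M X \<Longrightarrow> prob_space (process_law M X)"
  unfolding process_law_def
  by (rule prob_space.prob_space_distr) (auto simp: bit_process_def intro: bit_process_path_measurable)

lemma process_law_eqI:
  assumes X: "bit_process M X" and Z: "bit_process N Z"
    and eq: "\<And>S. finite S \<Longrightarrow> all_ones M X S = all_ones N Z S"
  shows "process_law M X = process_law N Z"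
proof (rule measure_eqI_cylinders[where I = UNIV and S = "\<lambda>j. {f. f j}" and \<Omega> = UNIV])
  have sets: "sets (bit_space UNIV) = sigma_sets UNIV (range (\<lambda>j. {f. f j}))"
    using sets_bit_space[of UNIV] by simp
  then show "sets (process_law M X) = sigma_sets UNIV (range (\<lambda>j. {f. f j}))"
    and "sets (process_law N Z) = sigma_sets UNIV (range (\<lambda>j. {f. f j}))"
    by (simp_all add: process_law_def)
  fix F :: "int set" assume F: "finite F"
  then have "{f. \<forall>i\<in>F. f i} \<in> sets (bit_space UNIV)"
    by (intro bit_space_Collect pred_intros_finite) auto
  then show "measure (process_law M X) {\<omega> \<in> UNIV. \<forall>i\<in>F. \<omega> \<in> {f. f i}} =
      measure (process_law N Z) {\<omega> \<in> UNIV. \<forall>i\<in>F. \<omega> \<in> {f. f i}}"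
    using eq[OF F] measure_process_law[OF X, of "\<lambda>f. \<forall>i\<in>F. f i"] measure_process_law[OF Z, of "\<lambda>f. \<forall>i\<in>F. f i"]
    by (simp add: all_ones_def)
qed (use X Z in \<open>auto intro: prob_space_process_law\<close>)

text \<open>The value at a nonempty finite set is \<open>\<rho>\<close> times the product of \<open>u\<close> over its gaps. It is expressed by adjoining a
  new largest point, so that two such functions can be compared by \<open>finite_linorder_max_induct\<close>.\<close>

definition gap_product :: "(int set \<Rightarrow> real) \<Rightarrow> real \<Rightarrow> (nat \<Rightarrow> real) \<Rightarrow> bool" where
  "gap_product P \<rho> u \<longleftrightarrow> (\<forall>t. P {t} = \<rho>) \<and>
     (\<forall>S t. finite S \<longrightarrow> S \<noteq> {} \<longrightarrow> Max S < t \<longrightarrow> P (insert t S) = P S * u (nat (t - Max S)))"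

text \<open>The probability of a one in the zigzag process with parameter \<open>\<alpha>\<close>, and the gap factors that belong
  to the matrix \<open>\<kappa> \<alpha>^|k - l|\<close>.\<close>

abbreviation zigzag_density :: "real \<Rightarrow> real" where
  "zigzag_density \<alpha> \<equiv> (1 - \<alpha>) / (1 + \<alpha>)"

abbreviation geometric_gaps :: "real \<Rightarrow> real \<Rightarrow> nat \<Rightarrow> real" where
  "geometric_gaps \<kappa> \<alpha> \<equiv> \<lambda>n. \<kappa> * (1 - \<alpha> ^ (2 * n))"

lemma gap_product_insert:
  assumes "gap_product P \<rho> u" "finite S" "S \<noteq> {}" "\<And>s. s \<in> S \<Longrightarrow> s < t"
  shows "P (insert t S) = P S * u (nat (t - Max S))"
  using assms by (simp add: gap_product_def)

lemma gap_product_unique: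
  assumes P: "gap_product P \<rho> u" and Q: "gap_product Q \<rho> v" and uv: "\<And>n. 1 \<le> n \<Longrightarrow> u n = v n"
    and S: "finite S" "S \<noteq> {}"
  shows "P S = Q S"
  using S
proof (induction S rule: finite_linorder_max_induct)
  case (insert t S)
  show ?case
  proof (cases "S = {}")
    case True
    then show ?thesis using P Q by (simp add: gap_product_def)
  next
    case False
    have "Max S < t" using insert False by simp
    then have "u (nat (t - Max S)) = v (nat (t - Max S))" by (intro uv) linarith
    then show ?thesis
      using insert False gap_product_insert[OF P, of S t] gap_product_insert[OF Q, of S t] by simp
  qed
qed simp

lemma gap_product_shift:
  assumes P: "gap_product P \<rho> u" and S: "finite S" "S \<noteq> {}"
  shows "P ((\<lambda>s. s + k) ` S) = P S"
proof (rule gap_product_unique[OF _ P _ S])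
  show "gap_product (\<lambda>S. P ((\<lambda>s. s + k) ` S)) \<rho> u"
    unfolding gap_product_def
  proof (intro conjI allI impI)
    fix S :: "int set" and t
    assume S: "finite S" "S \<noteq> {}" "Max S < t"
    have "Max ((\<lambda>s. s + k) ` S) = Max S + k"
      using S by (intro mono_Max_commute[symmetric]) (auto simp: mono_def)
    moreover have "P (insert (t + k) ((\<lambda>s. s + k) ` S)) =
        P ((\<lambda>s. s + k) ` S) * u (nat (t + k - Max ((\<lambda>s. s + k) ` S)))"
      by (rule gap_product_insert[OF P]) (use S in auto)
    ultimately show "P ((\<lambda>s. s + k) ` insert t S) = P ((\<lambda>s. s + k) ` S) * u (nat (t - Max S))"
      by simp
  qed (use P in \<open>simp add: gap_product_def\<close>)
qed simp

text \<open>A point of \<open>C\<close> contributes a factor that depends only on its predecessor in \<open>insert 0 C\<close>, whether or not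
  the points of \<open>A\<close> are present.\<close>

lemma gap_product_split:
  assumes P: "gap_product P \<rho> u"
    and A: "finite A" "\<And>a. a \<in> A \<Longrightarrow> a < 0" and C: "finite C" "\<And>a. a \<in> C \<Longrightarrow> 0 < a"
  shows "P (insert 0 (A \<union> C)) * \<rho> = P (insert 0 A) * P (insert 0 C)"
  using C
proof (induction C rule: finite_linorder_max_induct)
  case empty
  then show ?case using P by (simp add: gap_product_def)
next
  case (insert t C)
  have M: "Max (insert 0 (A \<union> C)) = Max (insert 0 C)"
  proof (rule Max_eqI)
    fix y assume "y \<in> insert 0 (A \<union> C)"
    then show "y \<le> Max (insert 0 C)"
      using A(2)[of y] insert Max_ge[of "insert 0 C" 0] Max_ge[of "insert 0 C" y] by fastforce
  next
    have "Max (insert 0 C) \<in> insert 0 C" using insert by (intro Max_in) auto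
    then show "Max (insert 0 C) \<in> insert 0 (A \<union> C)" by auto
  qed (use A insert in auto)
  have t0: "0 < t" using insert by simp
  have "P (insert t (insert 0 (A \<union> C))) = P (insert 0 (A \<union> C)) * u (nat (t - Max (insert 0 C)))"
    unfolding M[symmetric] by (rule gap_product_insert[OF P]) (use A insert t0 in force)+
  moreover have "P (insert t (insert 0 C)) = P (insert 0 C) * u (nat (t - Max (insert 0 C)))"
    by (rule gap_product_insert[OF P]) (use insert t0 in force)+
  ultimately show ?case using insert by (simp add: insert_commute)
qed

lemma bit_process_shift: "bit_process M X \<Longrightarrow> bit_process M (\<lambda>m. X (m + k))"
  by (simp add: bit_process_def)

lemma stationary_if_gap_product:
  assumes X: "bit_process M X" and P: "gap_product (all_ones M X) \<rho> u"
  shows "stationary M X"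
  unfolding stationary_def
proof (intro conjI allI X process_law_eqI bit_process_shift)
  fix k and S :: "int set" assume "finite S"
  then show "all_ones M (\<lambda>m. X (m + k)) S = all_ones M X S"
    using gap_product_shift[OF P, of S k] by (cases "S = {}") (simp_all add: all_ones_def)
qed

text \<open>Given a one at 0, the cylinder events before and after 0 are independent by \<open>gap_product_split\<close>;
  independence extends from \<pi>-systems to the \<sigma>-algebras that they generate.\<close>

lemma renewal_process_if_gap_product:
  assumes X: "bit_process M X" and P: "gap_product (all_ones M X) \<rho> u"
  shows "renewal_process M X"
  unfolding renewal_process_def
proof (intro conjI ballI impI stationary_if_gap_product[OF X P])
  interpret M: prob_space M using X by (simp add: bit_process_def)
  note [measurable] = bit_process_measurable[OF X]
  fix B C assume B: "B \<in> sets (bit_space {..<0})" and C: "C \<in> sets (bit_space {0<..})"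
  assume pos: "0 < \<P>(\<omega> in M. (\<lambda>m\<in>{..<0}. X m \<omega>) \<in> B \<and> X 0 \<omega>)"
  define H where "H = {\<omega> \<in> space M. X 0 \<omega>}"
  \<comment> \<open>the cylinder events on the index set \<open>J\<close>, pulled back to \<open>M\<close>\<close>
  define cyl where "cyl J = cylinders (space M) (\<lambda>j. {\<omega> \<in> space M. X j \<omega>}) J" for J
  have H [measurable]: "H \<in> sets M" unfolding H_def by measurable
  have vim: "(\<lambda>\<omega>. \<lambda>m\<in>J. X m \<omega>) -` E \<inter> space M \<in> sigma_sets (space M) (cyl J)"
    if "E \<in> sets (bit_space J)" for J E
  proof -
    have sub: "cyl J \<subseteq> Pow (space M)" by (auto simp: cyl_def cylinders_def)
    have "(\<lambda>\<omega>. \<lambda>m\<in>J. X m \<omega>) \<in> sigma (space M) (cyl J) \<rightarrow>\<^sub>M bit_space J"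
      unfolding bit_space_def
    proof (rule measurable_restrict)
      fix j assume "j \<in> J"
      then have "{\<omega> \<in> space M. X j \<omega>} \<in> cyl J"
        unfolding cyl_def cylinders_def by (intro image_eqI[of _ _ "{j}"]) auto
      then show "X j \<in> sigma (space M) (cyl J) \<rightarrow>\<^sub>M count_space UNIV"
        unfolding pred_def by (simp add: sets_measure_of[OF sub] space_measure_of[OF sub] sigma_sets.Basic)
    qed
    from measurable_sets[OF this that] show ?thesis using sub by (simp add: sets_measure_of space_measure_of_conv)
  qed
  have "\<P>(\<omega> in M. (\<lambda>m\<in>{..<0}. X m \<omega>) \<in> B \<and> X 0 \<omega>) \<le> M.prob H"
    by (rule M.finite_measure_mono) (auto simp: H_def)
  with pos have Hpos: "0 < M.prob H" by simp
  have \<rho>: "M.prob H = \<rho>" using P by (simp add: gap_product_def all_ones_def H_def)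
  \<comment> \<open>the law conditioned on a one at 0\<close>
  define U where "U = uniform_measure M H"
  interpret U: prob_space U unfolding U_def
    by (rule prob_space_uniform_measure) (use Hpos in \<open>simp_all add: M.emeasure_eq_measure\<close>)
  have sU [simp]: "space U = space M" "sets U = sets M" by (simp_all add: U_def)
  have mU: "measure U E = M.prob (H \<inter> E) / \<rho>" if "E \<in> sets M" for E
    using that Hpos \<rho> unfolding U_def by (subst measure_uniform_measure) (auto simp: M.emeasure_eq_measure)
  have cyl_sets: "cyl J \<subseteq> sets M" for J
    unfolding cyl_def cylinders_def by (auto intro!: sets.sets_Collect_finite_All)
  have "U.indep_set (cyl {..<0}) (cyl {0<..})"
  proof (rule U.indep_setI)
    fix a b assume "a \<in> cyl {..<0}" "b \<in> cyl {0<..}"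
    then obtain F G where F: "finite F" "F \<subseteq> {..<0}" "a = {\<omega> \<in> space M. \<forall>s\<in>F. X s \<omega>}"
      and G: "finite G" "G \<subseteq> {0<..}" "b = {\<omega> \<in> space M. \<forall>s\<in>G. X s \<omega>}"
      unfolding cyl_def cylinders_def by auto
    have ab: "a \<in> sets M" "b \<in> sets M" using cyl_sets \<open>a \<in> _\<close> \<open>b \<in> _\<close> by blast+
    have "M.prob (H \<inter> (a \<inter> b)) = all_ones M X (insert 0 (F \<union> G))"
      unfolding all_ones_def F G H_def by (intro arg_cong[of _ _ M.prob]) auto
    moreover have "M.prob (H \<inter> a) = all_ones M X (insert 0 F)" "M.prob (H \<inter> b) = all_ones M X (insert 0 G)"
      unfolding all_ones_def F G H_def by (auto intro!: arg_cong[of _ _ M.prob])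
    moreover have "all_ones M X (insert 0 (F \<union> G)) * \<rho> = all_ones M X (insert 0 F) * all_ones M X (insert 0 G)"
      by (rule gap_product_split[OF P]) (use F G in auto)
    ultimately show "U.prob (a \<inter> b) = U.prob a * U.prob b"
      using Hpos \<rho> ab by (simp add: mU field_simps)
  qed (use cyl_sets in auto)
  then have indep: "U.indep_set (sigma_sets (space U) (cyl {..<0})) (sigma_sets (space U) (cyl {0<..}))"
    by (rule U.indep_set_sigma_sets) (auto simp: cyl_def Int_stable_cylinders)
  define past where "past = (\<lambda>\<omega>. \<lambda>m\<in>{..<0}. X m \<omega>) -` B \<inter> space M"
  define future where "future = (\<lambda>\<omega>. \<lambda>m\<in>{0<..}. X m \<omega>) -` C \<inter> space M"
  from U.indep_setD[OF indep, of "past" "future"]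
  have ind: "U.prob (past \<inter> future) =
    U.prob past * U.prob future"
    using vim[OF B] vim[OF C] by (simp add: past_def future_def)
  have BM: "past \<in> sets M" "future \<in> sets M"
    using B C bit_process_restrict_measurable[OF X] by (auto intro: measurable_sets simp: past_def future_def)
  have e1: "H \<inter> past = {\<omega> \<in> space M. (\<lambda>m\<in>{..<0}. X m \<omega>) \<in> B \<and> X 0 \<omega>}"
    and e2: "H \<inter> future = {\<omega> \<in> space M. (\<lambda>m\<in>{0<..}. X m \<omega>) \<in> C \<and> X 0 \<omega>}"
    and e3: "H \<inter> (past \<inter> future) =
      {\<omega> \<in> space M. (\<lambda>m\<in>{0<..}. X m \<omega>) \<in> C \<and> (\<lambda>m\<in>{..<0}. X m \<omega>) \<in> B \<and> X 0 \<omega>}"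
    by (auto simp: H_def past_def future_def)
  note ind' = ind[unfolded mU[OF BM(1)] mU[OF BM(2)] mU[OF sets.Int[OF BM]] e1 e2 e3]
  show "\<P>(\<omega> in M. (\<lambda>m\<in>{0<..}. X m \<omega>) \<in> C \<bar> (\<lambda>m\<in>{..<0}. X m \<omega>) \<in> B \<and> X 0 \<omega>) =
      \<P>(\<omega> in M. (\<lambda>m\<in>{0<..}. X m \<omega>) \<in> C \<bar> X 0 \<omega>)"
    using ind' pos Hpos \<rho> unfolding cond_prob_def H_def by (simp add: field_simps)
qed

lemma stationary_shift_prob:
  assumes X: "stationary M X" and \<Phi>: "Measurable.pred (bit_space UNIV) \<Phi>"
  shows "\<P>(\<omega> in M. \<Phi> (\<lambda>m. X (m + k) \<omega>)) = \<P>(\<omega> in M. \<Phi> (\<lambda>m. X m \<omega>))"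
proof -
  from X have b: "bit_process M X" and law: "process_law M (\<lambda>m. X (m + k)) = process_law M X"
    by (auto simp: stationary_def)
  show ?thesis
    using measure_process_law[OF b bit_space_Collect[OF \<Phi>]]
      measure_process_law[OF bit_process_shift[OF b, of k] bit_space_Collect[OF \<Phi>]] law by simp
qed

text \<open>Multiplied out, the renewal property also covers conditioning events of probability zero.\<close>

lemma renewal_process_split:
  assumes X: "renewal_process M X"
    and B: "B \<in> sets (bit_space {..<0})" and C: "C \<in> sets (bit_space {0<..})"
  shows "\<P>(\<omega> in M. (\<lambda>m\<in>{..<0}. X m \<omega>) \<in> B \<and> X 0 \<omega> \<and> (\<lambda>m\<in>{0<..}. X m \<omega>) \<in> C) * \<P>(\<omega> in M. X 0 \<omega>) =
    \<P>(\<omega> in M. (\<lambda>m\<in>{..<0}. X m \<omega>) \<in> B \<and> X 0 \<omega>) * \<P>(\<omega> in M. X 0 \<omega> \<and> (\<lambda>m\<in>{0<..}. X m \<omega>) \<in> C)"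
proof -
  from X have b: "bit_process M X" by (simp add: renewal_process_def stationary_def)
  interpret prob_space M using b by (simp add: bit_process_def)
  note [measurable] = bit_process_measurable[OF b] bit_process_restrict_measurable[OF b]
  note [measurable] = B C
  let ?B = "\<lambda>\<omega>. (\<lambda>m\<in>{..<0}. X m \<omega>) \<in> B" and ?C = "\<lambda>\<omega>. (\<lambda>m\<in>{0<..}. X m \<omega>) \<in> C"
  have mono: "\<P>(\<omega> in M. ?B \<omega> \<and> X 0 \<omega> \<and> ?C \<omega>) \<le> \<P>(\<omega> in M. ?B \<omega> \<and> X 0 \<omega>)"
    "\<P>(\<omega> in M. ?B \<omega> \<and> X 0 \<omega>) \<le> \<P>(\<omega> in M. X 0 \<omega>)"
    by (intro finite_measure_mono; auto)+
  show ?thesis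
  proof (cases "\<P>(\<omega> in M. ?B \<omega> \<and> X 0 \<omega>) = 0")
    case True
    then show ?thesis using mono(1) measure_nonneg[of M] by (simp add: order.antisym)
  next
    case False
    then have pos: "0 < \<P>(\<omega> in M. ?B \<omega> \<and> X 0 \<omega>)" by (simp add: zero_less_measure_iff)
    then have "\<P>(\<omega> in M. ?C \<omega> \<bar> ?B \<omega> \<and> X 0 \<omega>) = \<P>(\<omega> in M. ?C \<omega> \<bar> X 0 \<omega>)"
      using X B C unfolding renewal_process_def by blast
    then have "\<P>(\<omega> in M. ?C \<omega> \<and> ?B \<omega> \<and> X 0 \<omega>) / \<P>(\<omega> in M. ?B \<omega> \<and> X 0 \<omega>) =
      \<P>(\<omega> in M. ?C \<omega> \<and> X 0 \<omega>) / \<P>(\<omega> in M. X 0 \<omega>)" by (simp add: cond_prob_def)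
    moreover have "{\<omega> \<in> space M. ?C \<omega> \<and> ?B \<omega> \<and> X 0 \<omega>} = {\<omega> \<in> space M. ?B \<omega> \<and> X 0 \<omega> \<and> ?C \<omega>}"
      "{\<omega> \<in> space M. ?C \<omega> \<and> X 0 \<omega>} = {\<omega> \<in> space M. X 0 \<omega> \<and> ?C \<omega>}" by auto
    ultimately show ?thesis using pos mono(2) by (simp add: field_simps)
  qed
qed

text \<open>For a renewal process, \<open>joint_prob M X n\<close> divided by the density is the renewal sequence.\<close>

abbreviation joint_prob :: "'a measure \<Rightarrow> (int \<Rightarrow> 'a \<Rightarrow> bool) \<Rightarrow> nat \<Rightarrow> real" where
  "joint_prob M X n \<equiv> \<P>(\<omega> in M. X 0 \<omega> \<and> X (int n) \<omega>)"

text \<open>The probability that a one at 0 is followed by no further one up to \<open>n\<close>. Division by the density gives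
  the tail of the first return time.\<close>

definition survival :: "'a measure \<Rightarrow> (int \<Rightarrow> 'a \<Rightarrow> bool) \<Rightarrow> nat \<Rightarrow> real" where
  "survival M X n = \<P>(\<omega> in M. X 0 \<omega> \<and> (\<forall>j\<in>{0<..int n}. \<not> X j \<omega>))"

text \<open>The events on the right are disjoint, since \<open>i\<close> is the position of the last one in \<open>{0..n}\<close>.\<close>

lemma last_visit_decomposition:
  assumes X: "bit_process M X" and E: "Measurable.pred M E"
  shows "\<P>(\<omega> in M. E \<omega> \<and> (\<exists>i\<in>{0..int n}. X i \<omega>)) =
    (\<Sum>i\<le>n. \<P>(\<omega> in M. E \<omega> \<and> X (int i) \<omega> \<and> (\<forall>j\<in>{int i<..int n}. \<not> X j \<omega>)))"
proof -
  interpret prob_space M using X by (simp add: bit_process_def)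
  note [measurable] = bit_process_measurable[OF X] E
  let ?L = "\<lambda>i. {\<omega> \<in> space M. E \<omega> \<and> X (int i) \<omega> \<and> (\<forall>j\<in>{int i<..int n}. \<not> X j \<omega>)}"
  have "{\<omega> \<in> space M. E \<omega> \<and> (\<exists>i\<in>{0..int n}. X i \<omega>)} = (\<Union>i\<le>n. ?L i)"
  proof (intro equalityI subsetI)
    fix \<omega> assume "\<omega> \<in> {\<omega> \<in> space M. E \<omega> \<and> (\<exists>i\<in>{0..int n}. X i \<omega>)}"
    then obtain i where i: "\<omega> \<in> space M" "E \<omega>" "0 \<le> i" "i \<le> int n" "X i \<omega>" by auto
    define V where "V = {i \<in> {0..int n}. X i \<omega>}"
    have V: "finite V" "V \<noteq> {}"
      using i by (auto simp: V_def intro: finite_subset[of _ "{0..int n}"])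
    obtain k where k: "k \<in> V" "\<And>j. j \<in> V \<Longrightarrow> j \<le> k" using Max_in[OF V] Max_ge[OF V(1)] by blast
    have "\<not> X j \<omega>" if "j \<in> {k<..int n}" for j
    proof
      assume "X j \<omega>"
      with that k(1) have "j \<in> V" by (auto simp: V_def)
      from k(2)[OF this] that show False by simp
    qed
    with i k(1) have "\<omega> \<in> ?L (nat k)" "nat k \<le> n" by (auto simp: V_def)
    then show "\<omega> \<in> (\<Union>i\<le>n. ?L i)" by blast
  qed auto
  also have "prob \<dots> = (\<Sum>i\<le>n. prob (?L i))"
  proof (rule finite_measure_finite_Union)
    show "?L ` {..n} \<subseteq> events" by auto
    show "disjoint_family_on ?L {..n}"
    proof (unfold disjoint_family_on_def, intro ballI impI)
      fix i j assume "i \<in> {..n}" "j \<in> {..n}" "i \<noteq> j"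
      then show "?L i \<inter> ?L j = {}" by (cases "i < j") fastforce+
    qed
  qed simp
  finally show ?thesis .
qed

lemma greaterThanAtMost_shift:
  assumes "i \<le> n"
  shows "{int i<..int n} = (\<lambda>m. m + int i) ` {0<..int (n - i)}"
proof
  show "{int i<..int n} \<subseteq> (\<lambda>m. m + int i) ` {0<..int (n - i)}"
  proof
    fix x assume "x \<in> {int i<..int n}"
    then show "x \<in> (\<lambda>m. m + int i) ` {0<..int (n - i)}"
      using assms by (intro image_eqI[of _ _ "x - int i"]) auto
  qed
qed (use assms in auto)

lemma stationary_last_visit:
  assumes X: "stationary M X" and "i \<le> n"
  shows "\<P>(\<omega> in M. X (int i) \<omega> \<and> (\<forall>j\<in>{int i<..int n}. \<not> X j \<omega>)) = survival M X (n - i)"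
proof -
  let ?\<Phi> = "\<lambda>f. f 0 \<and> (\<forall>j\<in>{0<..int (n - i)}. \<not> f j)"
  have "?\<Phi> (\<lambda>m. X (m + int i) \<omega>) \<longleftrightarrow> X (int i) \<omega> \<and> (\<forall>j\<in>{int i<..int n}. \<not> X j \<omega>)" for \<omega>
  proof -
    have "{int i<..int n} = (\<lambda>m. m + int i) ` {0<..int (n - i)}"
      by (rule greaterThanAtMost_shift[OF assms(2)])
    then show ?thesis by auto
  qed
  then show ?thesis
    using stationary_shift_prob[OF X, of ?\<Phi> "int i"] unfolding survival_def by simp
qed

text \<open>Shifted by \<open>-i\<close>, the event becomes a one at \<open>-i\<close>, a one at 0 and no one in \<open>{1..n - i}\<close>, and the renewal
  property at 0 applies.\<close>

lemma renewal_last_visit: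
  assumes X: "renewal_process M X" and "i \<le> n"
  shows "\<P>(\<omega> in M. X 0 \<omega> \<and> X (int i) \<omega> \<and> (\<forall>j\<in>{int i<..int n}. \<not> X j \<omega>)) * \<P>(\<omega> in M. X 0 \<omega>) =
    joint_prob M X i * survival M X (n - i)"
proof (cases "i = 0")
  case True
  then show ?thesis by (simp add: survival_def mult.commute)
next
  case False
  from X have st: "stationary M X" by (simp add: renewal_process_def)
  let ?k = "int i"
  let ?B = "{f \<in> PiE {..<0} (\<lambda>_. UNIV). f (- ?k)}"
  let ?C = "{f \<in> PiE {0<..} (\<lambda>_. UNIV). \<forall>j\<in>{0<..int (n - i)}. \<not> f j}"
  have B: "?B \<in> sets (bit_space {..<0})" using False unfolding sets_bit_space by (intro sigma_sets.Basic) auto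
  have "{f \<in> space (bit_space {0<..}). \<forall>j\<in>{0<..int (n - i)}. \<not> f j} \<in> sets (bit_space {0<..})"
    unfolding bit_space_def by measurable
  then have C: "?C \<in> sets (bit_space {0<..})" by simp
  have "\<P>(\<omega> in M. X (- ?k) \<omega> \<and> X 0 \<omega> \<and> (\<forall>j\<in>{0<..int (n - i)}. \<not> X j \<omega>)) * \<P>(\<omega> in M. X 0 \<omega>) =
     \<P>(\<omega> in M. X (- ?k) \<omega> \<and> X 0 \<omega>) * survival M X (n - i)"
    using renewal_process_split[OF X B C] False unfolding survival_def by simp
  moreover have "\<P>(\<omega> in M. X (- ?k) \<omega> \<and> X 0 \<omega>) = \<P>(\<omega> in M. X 0 \<omega> \<and> X ?k \<omega>)"
    using stationary_shift_prob[OF st, of "\<lambda>f. f (- ?k) \<and> f 0" ?k] by simp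
  moreover have "\<P>(\<omega> in M. X (- ?k) \<omega> \<and> X 0 \<omega> \<and> (\<forall>j\<in>{0<..int (n - i)}. \<not> X j \<omega>)) =
     \<P>(\<omega> in M. X 0 \<omega> \<and> X ?k \<omega> \<and> (\<forall>j\<in>{?k<..int n}. \<not> X j \<omega>))"
  proof -
    have "{?k<..int n} = (\<lambda>m. m + ?k) ` {0<..int (n - i)}"
      by (rule greaterThanAtMost_shift[OF assms(2)])
    then have "(\<forall>j\<in>{?k<..int n}. \<not> X j \<omega>) \<longleftrightarrow> (\<forall>j\<in>{0<..int (n - i)}. \<not> X (j + ?k) \<omega>)" for \<omega> by simp
    then show ?thesis
      using stationary_shift_prob[OF st, of "\<lambda>f. f (- ?k) \<and> f 0 \<and> (\<forall>j\<in>{0<..int (n - i)}. \<not> f j)" ?k] by simp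
  qed
  ultimately show ?thesis by simp
qed

text \<open>The classical renewal equation: starting from a one at 0 there is always a last one up to time \<open>n\<close>.\<close>

lemma renewal_equation:
  assumes X: "renewal_process M X"
  shows "(\<Sum>i\<le>n. joint_prob M X i * survival M X (n - i)) = (\<P>(\<omega> in M. X 0 \<omega>))\<^sup>2"
proof -
  from X have b: "bit_process M X" by (simp add: renewal_process_def stationary_def)
  have "{\<omega> \<in> space M. X 0 \<omega> \<and> (\<exists>i\<in>{0..int n}. X i \<omega>)} = {\<omega> \<in> space M. X 0 \<omega>}" by auto
  then have "\<P>(\<omega> in M. X 0 \<omega>) =
    (\<Sum>i\<le>n. \<P>(\<omega> in M. X 0 \<omega> \<and> X (int i) \<omega> \<and> (\<forall>j\<in>{int i<..int n}. \<not> X j \<omega>)))"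
    using last_visit_decomposition[OF b bit_process_measurable[OF b, of 0], of n] by simp
  then have "(\<P>(\<omega> in M. X 0 \<omega>))\<^sup>2 =
    (\<Sum>i\<le>n. \<P>(\<omega> in M. X 0 \<omega> \<and> X (int i) \<omega> \<and> (\<forall>j\<in>{int i<..int n}. \<not> X j \<omega>)) * \<P>(\<omega> in M. X 0 \<omega>))"
    by (simp add: power2_eq_square sum_distrib_right)
  also have "\<dots> = (\<Sum>i\<le>n. joint_prob M X i * survival M X (n - i))"
    by (rule sum.cong) (simp_all add: renewal_last_visit[OF X])
  finally show ?thesis ..
qed

text \<open>The last-visit decomposition without the condition of a one at 0: shifted survival events are disjoint.\<close>

lemma stationary_survival_sum_le:
  assumes X: "stationary M X"
  shows "(\<Sum>i\<le>n. survival M X (n - i)) \<le> 1"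
proof -
  from X have b: "bit_process M X" by (simp add: stationary_def)
  interpret prob_space M using b by (simp add: bit_process_def)
  have "(\<Sum>i\<le>n. survival M X (n - i)) = \<P>(\<omega> in M. \<exists>i\<in>{0..int n}. X i \<omega>)"
    using last_visit_decomposition[OF b, of "\<lambda>_. True" n] by (simp add: stationary_last_visit[OF X])
  then show ?thesis by simp
qed

text \<open>Stationarity moves the largest point of \<open>S\<close> to 0, where the renewal property separates the new point \<open>t\<close>
  from the other points of \<open>S\<close>.\<close>

lemma renewal_process_gap_product:
  assumes X: "renewal_process M X"
  defines "\<rho> \<equiv> \<P>(\<omega> in M. X 0 \<omega>)"
  assumes pos: "0 < \<rho>"
  shows "gap_product (all_ones M X) \<rho> (\<lambda>n. joint_prob M X n / \<rho>)"
  unfolding gap_product_def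
proof (intro conjI allI impI)
  from X have st: "stationary M X" by (simp add: renewal_process_def)
  show "all_ones M X {t} = \<rho>" for t
    using stationary_shift_prob[OF st, of "\<lambda>f. f 0" t] by (simp add: all_ones_def \<rho>_def)
  fix S :: "int set" and t assume S: "finite S" "S \<noteq> {}" and t: "Max S < t"
  define r where "r = Max S"
  define A where "A = S - {r}"
  have r: "r \<in> S" unfolding r_def by (rule Max_in[OF S])
  have A: "S = insert r A" "finite A" "\<And>a. a \<in> A \<Longrightarrow> a < r"
    using S(1) r Max_ge[OF S(1), folded r_def] by (auto simp: A_def less_le)
  let ?A = "(\<lambda>s. s - r) ` A"
  let ?B = "{f \<in> PiE {..<0} (\<lambda>_. UNIV). \<forall>j\<in>?A. f j}"
  let ?C = "{f \<in> PiE {0<..} (\<lambda>_. UNIV). f (t - r)}"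
  have neg: "?A \<subseteq> {..<0}" using A by auto
  have "{f \<in> space (bit_space {..<0}). \<forall>j\<in>?A. f j} \<in> sets (bit_space {..<0})"
  proof (rule sets.sets_Collect_finite_All)
    fix j assume "j \<in> ?A"
    with neg show "{f \<in> space (bit_space {..<0}). f j} \<in> sets (bit_space {..<0})"
      unfolding sets_bit_space space_bit_space by (intro sigma_sets.Basic) blast
  qed (use A in auto)
  then have B: "?B \<in> sets (bit_space {..<0})" by simp
  have C: "?C \<in> sets (bit_space {0<..})" using t unfolding sets_bit_space r_def by (intro sigma_sets.Basic) auto
  have eqB: "(\<lambda>m\<in>{..<0}. X m \<omega>) \<in> ?B \<longleftrightarrow> (\<forall>j\<in>?A. X j \<omega>)" for \<omega> using neg by auto
  have eqC: "(\<lambda>m\<in>{0<..}. X m \<omega>) \<in> ?C \<longleftrightarrow> X (t - r) \<omega>" for \<omega> using t by (auto simp: r_def)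
  have split: "\<P>(\<omega> in M. (\<forall>j\<in>?A. X j \<omega>) \<and> X 0 \<omega> \<and> X (t - r) \<omega>) * \<rho> =
      \<P>(\<omega> in M. (\<forall>j\<in>?A. X j \<omega>) \<and> X 0 \<omega>) * \<P>(\<omega> in M. X 0 \<omega> \<and> X (t - r) \<omega>)"
    using renewal_process_split[OF X B C] unfolding eqB eqC \<rho>_def .
  have finA: "finite ?A" using A by simp
  have [measurable]: "Measurable.pred (bit_space UNIV) (\<lambda>f. \<forall>j\<in>?A. f j)"
    by (intro pred_intros_finite finA) auto
  have "all_ones M X (insert t S) = \<P>(\<omega> in M. (\<forall>j\<in>?A. X j \<omega>) \<and> X 0 \<omega> \<and> X (t - r) \<omega>)"
    using stationary_shift_prob[OF st, of "\<lambda>f. (\<forall>j\<in>?A. f j) \<and> f 0 \<and> f (t - r)" r]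
    unfolding all_ones_def A(1) by (simp add: conj_ac)
  moreover have "all_ones M X S = \<P>(\<omega> in M. (\<forall>j\<in>?A. X j \<omega>) \<and> X 0 \<omega>)"
    using stationary_shift_prob[OF st, of "\<lambda>f. (\<forall>j\<in>?A. f j) \<and> f 0" r]
    unfolding all_ones_def A(1) by (simp add: conj_ac)
  ultimately show "all_ones M X (insert t S) =
      all_ones M X S * (\<P>(\<omega> in M. X 0 \<omega> \<and> X (int (nat (t - Max S))) \<omega>) / \<rho>)"
    using split pos t unfolding r_def by (simp add: field_simps)
qed

section \<open>Spanning trees of ladder boxes, built one vertex at a time\<close>

definition adj :: "'v set set \<Rightarrow> ('v \<times> 'v) set" where
  "adj t = {(a, b). {a, b} \<in> t}"

definition connects :: "'v set \<Rightarrow> 'v set set \<Rightarrow> bool" where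
  "connects V t \<longleftrightarrow> (\<forall>u\<in>V. \<forall>v\<in>V. (u, v) \<in> (adj t)\<^sup>*)"

text \<open>Spanning trees as minimal connecting edge sets. Unlike the absence of cycles, this form is easy to follow
  when a vertex is attached: deleting an old edge commutes with attaching a leaf and with subdividing
  another edge.\<close>

definition minimally_connects :: "'v set \<Rightarrow> 'v set set \<Rightarrow> bool" where
  "minimally_connects V t \<longleftrightarrow> connects V t \<and> (\<forall>e\<in>t. \<not> connects V (t - {e}))"

lemma adj_iff [simp]: "(a, b) \<in> adj t \<longleftrightarrow> {a, b} \<in> t"
  by (simp add: adj_def)

lemma adj_rtrancl_sym: "(a, b) \<in> (adj t)\<^sup>* \<Longrightarrow> (b, a) \<in> (adj t)\<^sup>*"
proof -
  have "sym (adj t)" by (auto simp: sym_def insert_commute)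
  then show "(a, b) \<in> (adj t)\<^sup>* \<Longrightarrow> (b, a) \<in> (adj t)\<^sup>*"
    by (meson symD sym_rtrancl)
qed

lemma rtrancl_image:
  assumes "(x, y) \<in> R\<^sup>*" "\<And>a b. (a, b) \<in> R \<Longrightarrow> (f a, f b) \<in> Q\<^sup>*"
  shows "(f x, f y) \<in> Q\<^sup>*"
  using assms(1) by induction (auto intro: rtrancl_trans assms(2))

lemma connects_mono:
  assumes "connects V t" "\<And>a b. {a, b} \<in> t \<Longrightarrow> (a, b) \<in> (adj s)\<^sup>*"
  shows "connects V s"
  using assms rtrancl_image[where f = "\<lambda>x. x" and R = "adj t" and Q = "adj s"]
  unfolding connects_def by auto

text \<open>A path is extended step by step and cut back whenever its new end has been visited before.\<close>

lemma rtrancl_distinct_path: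
  assumes "(u, v) \<in> R\<^sup>*"
  shows "\<exists>vs. vs \<noteq> [] \<and> hd vs = u \<and> last vs = v \<and> distinct vs \<and>
    (\<forall>i. Suc i < length vs \<longrightarrow> (vs ! i, vs ! Suc i) \<in> R)"
  using assms
proof induction
  case base
  show ?case by (rule exI[of _ "[u]"]) auto
next
  case (step y z)
  then obtain vs where vs: "vs \<noteq> []" "hd vs = u" "last vs = y" "distinct vs"
    "\<And>i. Suc i < length vs \<Longrightarrow> (vs ! i, vs ! Suc i) \<in> R" by blast
  show ?case
  proof (cases "z \<in> set vs")
    case False
    have "(vs @ [z]) ! i = vs ! i" if "i < length vs" for i using that by (simp add: nth_append)
    moreover have "vs ! (length vs - 1) = y" using vs by (simp add: last_conv_nth)
    ultimately have "((vs @ [z]) ! i, (vs @ [z]) ! Suc i) \<in> R" if i: "Suc i < length (vs @ [z])" for i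
    proof (cases "Suc i < length vs")
      case True
      then show ?thesis using vs(5)[of i] by (simp add: nth_append)
    next
      case False
      with i have len: "length vs = Suc i" by simp
      with \<open>vs ! (length vs - 1) = y\<close> step(2) show ?thesis by (simp add: nth_append)
    qed
    then show ?thesis using vs False by (intro exI[of _ "vs @ [z]"]) auto
  next
    case True
    then obtain i where i: "i < length vs" "vs ! i = z" by (auto simp: in_set_conv_nth)
    then show ?thesis using vs
      by (intro exI[of _ "take (Suc i) vs"]) (auto simp: last_conv_nth)
  qed
qed

text \<open>The long way round joins the ends of the closing edge, and it avoids that edge because a cycle has at least
  three distinct vertices.\<close>

lemma is_cycle_edge_on_cycle:
  assumes "is_cycle t vs"
  obtains u v where "{u, v} \<in> t" "(u, v) \<in> (adj (t - {{u, v}}))\<^sup>*"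
proof -
  define k where "k = length vs"
  define e where "e = {vs ! 0, vs ! (k - 1)}"
  have k: "3 \<le> k" "distinct vs" and edge: "\<And>i. i < k \<Longrightarrow> {vs ! i, vs ! (Suc i mod k)} \<in> t"
    using assms by (auto simp: is_cycle_def k_def)
  have "Suc (k - 1) mod k = 0" using k by simp
  with edge[of "k - 1"] have e: "e \<in> t" using k by (simp add: e_def insert_commute)
  have "(vs ! 0, vs ! i) \<in> (adj (t - {e}))\<^sup>*" if "i < k" for i
    using that
  proof (induction i)
    case (Suc i)
    have "vs ! i \<noteq> vs ! (k - 1)"
      using Suc(2) k nth_eq_iff_index_eq[of vs i "k - 1"] unfolding k_def by simp
    moreover have "vs ! Suc i \<noteq> vs ! (k - 1)" if "vs ! i = vs ! 0"
    proof -
      have "i = 0" using that Suc(2) k nth_eq_iff_index_eq[of vs i 0] unfolding k_def by (cases vs) auto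
      then show ?thesis using k nth_eq_iff_index_eq[of vs 1 "k - 1"] unfolding k_def by simp
    qed
    ultimately have "vs ! i \<noteq> vs ! (k - 1) \<and> (vs ! i = vs ! 0 \<longrightarrow> vs ! Suc i \<noteq> vs ! (k - 1))" by blast
    then have "{vs ! i, vs ! Suc i} \<noteq> e" by (auto simp: e_def doubleton_eq_iff)
    with edge[of i] Suc have "(vs ! i, vs ! Suc i) \<in> adj (t - {e})" by simp
    with Suc show ?case by (meson Suc_lessD rtrancl.rtrancl_into_rtrancl)
  qed simp
  from this[of "k - 1"] k have "(vs ! 0, vs ! (k - 1)) \<in> (adj (t - {e}))\<^sup>*" by simp
  with e show ?thesis using that unfolding e_def by blast
qed

text \<open>A simple path from \<open>u\<close> to \<open>v\<close> that avoids the edge \<open>{u, v}\<close> has at least three vertices, and the edge closes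
  it to a cycle.\<close>

lemma is_cycle_of_detour:
  assumes "{u, v} \<in> t" "u \<noteq> v" "(u, v) \<in> (adj (t - {{u, v}}))\<^sup>*"
  shows "\<exists>vs. is_cycle t vs"
proof -
  obtain vs where vs: "vs \<noteq> []" "hd vs = u" "last vs = v" "distinct vs"
    "\<And>i. Suc i < length vs \<Longrightarrow> {vs ! i, vs ! Suc i} \<in> t - {{u, v}}"
    using rtrancl_distinct_path[OF assms(3)] by (auto simp: adj_iff)
  have ends: "vs ! 0 = u" "vs ! (length vs - 1) = v"
    using vs by (auto simp: hd_conv_nth last_conv_nth)
  have "length vs \<noteq> 1" using ends assms(2) by auto
  moreover have "length vs \<noteq> 2" using vs(5)[of 0] ends by auto
  ultimately have len: "3 \<le> length vs" using vs(1)
    by (metis One_nat_def Suc_1 Suc_leI le_neq_implies_less length_greater_0_conv numeral_3_eq_3)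
  have "{vs ! i, vs ! (Suc i mod length vs)} \<in> t" if "i < length vs" for i
  proof (cases "Suc i < length vs")
    case True
    then show ?thesis using vs(5)[of i] by simp
  next
    case False
    with that have "i = length vs - 1" "Suc i mod length vs = 0" by (auto simp: mod_Suc)
    then show ?thesis using ends assms(1) by (simp add: insert_commute)
  qed
  with vs(4) len show ?thesis unfolding is_cycle_def by blast
qed

lemma spanning_trees_eq_minimally_connects:
  assumes E: "\<And>e. e \<in> E \<Longrightarrow> \<exists>u\<in>V. \<exists>v\<in>V. u \<noteq> v \<and> e = {u, v}"
  shows "spanning_trees V E = {t. t \<subseteq> E \<and> minimally_connects V t}"
proof -
  have cycle: "(\<exists>vs. is_cycle t vs) \<longleftrightarrow> (\<exists>e\<in>t. connects V (t - {e}))" if t: "t \<subseteq> E" "connects V t" for t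
  proof
    assume "\<exists>vs. is_cycle t vs"
    then obtain u v where uv: "{u, v} \<in> t" "(u, v) \<in> (adj (t - {{u, v}}))\<^sup>*"
      using is_cycle_edge_on_cycle by metis
    have "(a, b) \<in> (adj (t - {{u, v}}))\<^sup>*" if "{a, b} \<in> t" for a b
    proof (cases "{a, b} = {u, v}")
      case True
      then show ?thesis using uv(2) adj_rtrancl_sym[OF uv(2)] by (auto simp: doubleton_eq_iff)
    next
      case False
      with that have "(a, b) \<in> adj (t - {{u, v}})" by (simp only: adj_iff) blast
      then show ?thesis ..
    qed
    with t have "connects V (t - {{u, v}})" by (rule_tac connects_mono)
    with uv(1) show "\<exists>e\<in>t. connects V (t - {e})" by blast
  next
    assume "\<exists>e\<in>t. connects V (t - {e})"
    then obtain e where e: "e \<in> t" "connects V (t - {e})" by blast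
    with E t obtain u v where "u \<in> V" "v \<in> V" "u \<noteq> v" "e = {u, v}" by blast
    with e show "\<exists>vs. is_cycle t vs"
      by (intro is_cycle_of_detour[of u v]) (auto simp: connects_def)
  qed
  have tree: "t \<in> spanning_trees V E \<longleftrightarrow> t \<subseteq> E \<and> connects V t \<and> \<not> (\<exists>vs. is_cycle t vs)" for t
    by (simp add: spanning_trees_def connects_def adj_def)
  have "t \<in> spanning_trees V E \<longleftrightarrow> t \<subseteq> E \<and> minimally_connects V t" for t
    unfolding tree minimally_connects_def using cycle[of t]
    by (cases "t \<subseteq> E"; cases "connects V t") simp_all
  then show ?thesis by blast
qed

lemma connects_isolated:
  assumes "t \<subseteq> Pow V" "v \<notin> V" "x \<in> V"
  shows "\<not> connects (insert v V) t"
proof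
  assume "connects (insert v V) t"
  with assms have "(v, x) \<in> (adj t)\<^sup>*" "v \<noteq> x" by (auto simp: connects_def)
  then obtain w where "{v, w} \<in> t" by (metis adj_iff converse_rtranclE)
  with assms show False by auto
qed

text \<open>Collapsing \<open>v\<close> onto \<open>x\<close> turns the edges at \<open>v\<close> into a loop and the edge \<open>{x, y}\<close>, so paths project;
  conversely a step along \<open>{x, y}\<close> lifts to the detour through \<open>v\<close>. The case \<open>x = y\<close> is the attachment of
  a leaf.\<close>

lemma connects_subdivision:
  assumes t: "t \<subseteq> Pow V" and v: "v \<notin> V" and x: "x \<in> V" and y: "y \<in> V"
  shows "connects (insert v V) (insert {v, x} (insert {v, y} t)) \<longleftrightarrow> connects V (insert {x, y} t)"
    (is "connects _ ?s \<longleftrightarrow> connects _ ?r")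
proof
  define \<pi> where "\<pi> = (\<lambda>w. if w = v then x else w)"
  assume L: "connects (insert v V) ?s"
  have "(\<pi> a, \<pi> b) \<in> (adj ?r)\<^sup>*" if "(a, b) \<in> adj ?s" for a b
  proof -
    have *: "(a, b) \<in> adj t \<and> a \<noteq> v \<and> b \<noteq> v \<or> a = v \<and> (b = x \<or> b = y) \<or> b = v \<and> (a = x \<or> a = y)"
      using that t v by (auto simp: doubleton_eq_iff)
    have "(x, y) \<in> adj ?r" "(y, x) \<in> adj ?r" by (auto simp: insert_commute)
    moreover have "(a, b) \<in> adj ?r" if "(a, b) \<in> adj t" using that by simp
    ultimately show ?thesis using * v x y by (auto simp: \<pi>_def simp del: adj_iff)
  qed
  then have "(\<pi> a, \<pi> b) \<in> (adj ?r)\<^sup>*" if "(a, b) \<in> (adj ?s)\<^sup>*" for a b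
    using rtrancl_image that by metis
  moreover have "\<pi> a = a" if "a \<in> V" for a using that v by (auto simp: \<pi>_def)
  ultimately show "connects V ?r" using L unfolding connects_def by (metis insertCI)
next
  assume R: "connects V ?r"
  have xv: "(x, v) \<in> adj ?s" and yv: "(y, v) \<in> adj ?s" and vx: "(v, x) \<in> adj ?s" and vy: "(v, y) \<in> adj ?s"
    by (auto simp: insert_commute)
  have "(a, b) \<in> (adj ?s)\<^sup>*" if "{a, b} \<in> ?r" for a b
  proof (cases "{a, b} = {x, y}")
    case True
    then have "a = x \<and> b = y \<or> a = y \<and> b = x" by (auto simp: doubleton_eq_iff)
    with xv yv vx vy show ?thesis by (meson r_into_rtrancl rtrancl.rtrancl_into_rtrancl)
  next
    case False
    with that have "(a, b) \<in> adj ?s" by simp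
    then show ?thesis by blast
  qed
  with R have *: "connects V ?s" by (rule connects_mono)
  have "(a, x) \<in> (adj ?s)\<^sup>*" if "a \<in> insert v V" for a
    using that * x vx unfolding connects_def by auto
  then show "connects (insert v V) ?s" unfolding connects_def by (meson adj_rtrancl_sym rtrancl_trans)
qed

lemma connects_leaf:
  assumes "t \<subseteq> Pow V" "v \<notin> V" "x \<in> V"
  shows "connects (insert v V) (insert {v, x} t) \<longleftrightarrow> connects V t"
proof -
  have "connects V (insert {x, x} t) \<longleftrightarrow> connects V t"
  proof
    assume "connects V (insert {x, x} t)"
    then show "connects V t"
    proof (rule connects_mono)
      fix a b assume "{a, b} \<in> insert {x, x} t"
      then show "(a, b) \<in> (adj t)\<^sup>*" by (cases "{a, b} \<in> t") (auto simp: doubleton_eq_iff)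
    qed
  next
    assume "connects V t"
    then show "connects V (insert {x, x} t)"
      by (rule connects_mono) auto
  qed
  with connects_subdivision[of t V v x x] assms show ?thesis by simp
qed

lemma minimally_connects_leaf:
  assumes t: "t \<subseteq> Pow V" "v \<notin> V" "x \<in> V"
  shows "minimally_connects (insert v V) (insert {v, x} t) \<longleftrightarrow> minimally_connects V t"
proof -
  have vx: "{v, x} \<notin> t" using t by auto
  have "\<not> connects (insert v V) (insert {v, x} t - {{v, x}})"
    using connects_isolated[OF t] vx by simp
  moreover have "connects (insert v V) (insert {v, x} t - {e}) \<longleftrightarrow> connects V (t - {e})" if "e \<in> t" for e
  proof -
    have "insert {v, x} t - {e} = insert {v, x} (t - {e})" using that vx by auto
    moreover have "t - {e} \<subseteq> Pow V" using t(1) by blast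
    ultimately show ?thesis using connects_leaf[OF _ t(2,3)] by simp
  qed
  ultimately show ?thesis
    unfolding minimally_connects_def using connects_leaf[OF t] by auto
qed

text \<open>If \<open>{x, y}\<close> is present already, one of the two edges at \<open>v\<close> can be deleted. Otherwise the deletions on
  both sides correspond, the deletion of either new edge to that of \<open>{x, y}\<close>.\<close>

lemma minimally_connects_subdivision:
  assumes t: "t \<subseteq> Pow V" "v \<notin> V" "x \<in> V" "y \<in> V" "x \<noteq> y"
  shows "minimally_connects (insert v V) (insert {v, x} (insert {v, y} t)) \<longleftrightarrow>
    {x, y} \<notin> t \<and> minimally_connects V (insert {x, y} t)"
proof -
  let ?s = "insert {v, x} (insert {v, y} t)" and ?r = "insert {x, y} t"
  have new: "{v, x} \<notin> t" "{v, y} \<notin> t" "{v, x} \<noteq> {v, y}" using t by (auto simp: doubleton_eq_iff)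
  have "?s - {{v, x}} = insert {v, y} t" using new by auto
  then have del_x: "connects (insert v V) (?s - {{v, x}}) \<longleftrightarrow> connects V t"
    using connects_leaf[of t V v y] t by simp
  have "?s - {{v, y}} = insert {v, x} t" using new by auto
  then have del_y: "connects (insert v V) (?s - {{v, y}}) \<longleftrightarrow> connects V t"
    using connects_leaf[of t V v x] t by simp
  have del: "connects (insert v V) (?s - {e}) \<longleftrightarrow> connects V (insert {x, y} (t - {e}))" if "e \<in> t" for e
  proof -
    have "?s - {e} = insert {v, x} (insert {v, y} (t - {e}))" using that new by auto
    moreover have "t - {e} \<subseteq> Pow V" using t(1) by blast
    ultimately show ?thesis using connects_subdivision[OF _ t(2-4)] by simp
  qed
  have whole: "connects (insert v V) ?s \<longleftrightarrow> connects V ?r"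
    by (rule connects_subdivision[OF t(1-4)])
  show ?thesis
  proof (cases "{x, y} \<in> t")
    case True
    then have "?r = t" by auto
    with whole del_x True show ?thesis unfolding minimally_connects_def by auto
  next
    case False
    then have "?r - {{x, y}} = t" "\<And>e. e \<in> t \<Longrightarrow> ?r - {e} = insert {x, y} (t - {e})" by auto
    with False whole del_x del_y del show ?thesis unfolding minimally_connects_def by auto
  qed
qed

definition box_edges :: "int \<Rightarrow> int \<Rightarrow> int set set" where
  "box_edges a b = induced_edges zigzag_edges {a..b}"

lemma z_edge_inject [simp]: "z_edge k = z_edge m \<longleftrightarrow> k = m"
  by (auto simp: z_edge_def doubleton_eq_iff)

lemma h_edge_inject [simp]: "h_edge k = h_edge m \<longleftrightarrow> k = m"
  by (auto simp: h_edge_def doubleton_eq_iff)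

lemma z_edge_neq_h_edge [simp]: "z_edge k \<noteq> h_edge m" "h_edge m \<noteq> z_edge k"
  by (auto simp: z_edge_def h_edge_def doubleton_eq_iff)

lemma box_edges_eq: "box_edges a b = z_edge ` {a<..b} \<union> h_edge ` {a + 1<..b}"
  by (auto simp: box_edges_def induced_edges_def zigzag_edges_def z_edge_def h_edge_def)

lemma box_edges_Pow: "t \<subseteq> box_edges a b \<Longrightarrow> t \<subseteq> Pow {a..b}"
  by (auto simp: box_edges_def induced_edges_def)

definition trees_on :: "int \<Rightarrow> int \<Rightarrow> int set set set" where
  "trees_on a b = spanning_trees {a..b} (box_edges a b)"

lemma trees_on_iff: "t \<in> trees_on a b \<longleftrightarrow> t \<subseteq> box_edges a b \<and> minimally_connects {a..b} t"
proof -
  have "\<exists>u\<in>{a..b}. \<exists>v\<in>{a..b}. u \<noteq> v \<and> e = {u, v}" if e: "e \<in> box_edges a b" for e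
  proof -
    have sub: "e \<subseteq> {a..b}" using e box_edges_Pow[of "{e}" a b] by simp
    from e consider k where "e = z_edge k" | k where "e = h_edge k" unfolding box_edges_eq by auto
    then show ?thesis
    proof cases
      case 1
      then show ?thesis using sub unfolding z_edge_def by (intro bexI[of _ "k - 1"] bexI[of _ k]) auto
    next
      case 2
      then show ?thesis using sub unfolding h_edge_def by (intro bexI[of _ "k - 2"] bexI[of _ k]) auto
    qed
  qed
  from spanning_trees_eq_minimally_connects[OF this] show ?thesis
    unfolding trees_on_def by simp
qed

text \<open>The new vertex \<open>b + 1\<close> is isolated, a leaf, or of degree two. In the last case its two edges subdivide
  \<open>z_edge b\<close>, whose ends \<open>b - 1\<close> and \<open>b\<close> are the neighbours of \<open>b + 1\<close>.\<close>

lemma trees_on_step: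
  assumes ab: "a < b" and t: "t \<subseteq> box_edges a b"
  shows "t \<notin> trees_on a (b + 1)"
    and "insert (z_edge (b + 1)) t \<in> trees_on a (b + 1) \<longleftrightarrow> t \<in> trees_on a b"
    and "insert (h_edge (b + 1)) t \<in> trees_on a (b + 1) \<longleftrightarrow> t \<in> trees_on a b"
    and "insert (z_edge (b + 1)) (insert (h_edge (b + 1)) t) \<in> trees_on a (b + 1) \<longleftrightarrow>
      z_edge b \<notin> t \<and> insert (z_edge b) t \<in> trees_on a b"
proof -
  have V: "{a..b + 1} = insert (b + 1) {a..b}" using ab by auto
  have z: "z_edge (b + 1) = {b + 1, b}" and h: "h_edge (b + 1) = {b + 1, b - 1}"
    and zb: "z_edge b = {b, b - 1}"
    by (auto simp: z_edge_def h_edge_def)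
  have E: "box_edges a b \<subseteq> box_edges a (b + 1)" "z_edge (b + 1) \<in> box_edges a (b + 1)"
    "h_edge (b + 1) \<in> box_edges a (b + 1)" "z_edge b \<in> box_edges a b"
    using ab by (auto simp: box_edges_eq)
  note tP = box_edges_Pow[OF t]
  show "t \<notin> trees_on a (b + 1)"
    using connects_isolated[OF tP, of "b + 1" b] ab unfolding trees_on_iff V minimally_connects_def by simp
  show "insert (z_edge (b + 1)) t \<in> trees_on a (b + 1) \<longleftrightarrow> t \<in> trees_on a b"
    using minimally_connects_leaf[OF tP, of "b + 1" b] ab E t unfolding trees_on_iff V z[symmetric] by auto
  show "insert (h_edge (b + 1)) t \<in> trees_on a (b + 1) \<longleftrightarrow> t \<in> trees_on a b"
    using minimally_connects_leaf[OF tP, of "b + 1" "b - 1"] ab E t unfolding trees_on_iff V h[symmetric] by auto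
  show "insert (z_edge (b + 1)) (insert (h_edge (b + 1)) t) \<in> trees_on a (b + 1) \<longleftrightarrow>
      z_edge b \<notin> t \<and> insert (z_edge b) t \<in> trees_on a b"
    using minimally_connects_subdivision[OF tP, of "b + 1" b "b - 1"] ab E t
    unfolding trees_on_iff V h[symmetric] z[symmetric] zb[symmetric] by auto
qed

section \<open>The two-state transfer matrix\<close>

text \<open>One step of the automaton, weighted. State \<open>True\<close> means that the edges read so far form a spanning tree,
  state \<open>False\<close> that they form two trees separating the last two vertices. From \<open>True\<close>, a new vertex
  attached by one edge keeps a spanning tree, and an isolated one gives two trees; both edges would close a
  cycle. From \<open>False\<close>, both edges join the two trees, and \<open>h_edge\<close> alone prolongs the tree that would otherwise be
  cut off.\<close>

definition step_weight :: "real \<Rightarrow> bool \<Rightarrow> bool \<Rightarrow> bool \<Rightarrow> bool \<Rightarrow> real" where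
  "step_weight c z h s s' =
    (if s then if s' then if z \<noteq> h then if z then c else 1 else 0 else if z \<or> h then 0 else 1
     else if h \<and> s' = z then if z then c else 1 else 0)"

text \<open>The product of the \<open>n\<close> step matrices at the positions after \<open>a\<close>, where \<open>G k\<close> is the set of letters allowed
  at \<open>k\<close>. Free sums, prescribed windows and prescribed z-edges are all of this form.\<close>

primrec transfer ::
  "real \<Rightarrow> (int \<Rightarrow> bool \<Rightarrow> bool \<Rightarrow> bool) \<Rightarrow> int \<Rightarrow> nat \<Rightarrow> bool \<Rightarrow> bool \<Rightarrow> real" where
  "transfer c G a 0 s s' = of_bool (s = s')"
| "transfer c G a (Suc n) s s' = (\<Sum>x\<in>UNIV. transfer c G a n s x *
     (\<Sum>z\<in>UNIV. \<Sum>h\<in>UNIV. of_bool (G (a + int n + 1) z h) * step_weight c z h x s'))"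

abbreviation free :: "int \<Rightarrow> bool \<Rightarrow> bool \<Rightarrow> bool" where
  "free \<equiv> \<lambda>_ _ _. True"

text \<open>As a constraint, \<open>config t\<close> allows only the letters read off from \<open>t\<close>.\<close>

definition config :: "int set set \<Rightarrow> int \<Rightarrow> bool \<Rightarrow> bool \<Rightarrow> bool" where
  "config t k z h \<longleftrightarrow> (z \<longleftrightarrow> z_edge k \<in> t) \<and> (h \<longleftrightarrow> h_edge k \<in> t)"

definition labels :: "int \<Rightarrow> nat \<Rightarrow> int set set" where
  "labels a n = z_edge ` {a<..a + int n} \<union> h_edge ` {a<..a + int n}"

lemma finite_labels [simp]: "finite (labels a n)"
  by (simp add: labels_def)

lemma labels_0 [simp]: "labels a 0 = {}"
  by (simp add: labels_def)

lemma labels_Suc: "labels a (Suc n) = insert (z_edge (a + int n + 1)) (insert (h_edge (a + int n + 1)) (labels a n))"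
proof -
  have "{a<..a + int (Suc n)} = insert (a + int n + 1) {a<..a + int n}" by auto
  then show ?thesis unfolding labels_def by auto
qed

lemma z_edge_in_labels [simp]: "z_edge k \<in> labels a n \<longleftrightarrow> a < k \<and> k \<le> a + int n"
  and h_edge_in_labels [simp]: "h_edge k \<in> labels a n \<longleftrightarrow> a < k \<and> k \<le> a + int n"
  by (auto simp: labels_def)

lemma transfer_cong:
  assumes "\<And>k z h. a < k \<Longrightarrow> k \<le> a + int n \<Longrightarrow> G k z h = G' k z h"
  shows "transfer c G a n s s' = transfer c G' a n s s'"
  using assms by (induction n arbitrary: s') simp_all

lemma transfer_add:
  "transfer c G a (m + n) s s' = (\<Sum>x\<in>UNIV. transfer c G a m s x * transfer c G (a + int m) n x s')"
  by (induction n arbitrary: s') (auto simp: UNIV_bool algebra_simps)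

lemma sum_Pow_insert:
  assumes "finite A" "x \<notin> A"
  shows "sum g (Pow (insert x A)) = (\<Sum>t\<in>Pow A. g t + g (insert x t))"
proof -
  have "inj_on (insert x) (Pow A)" using assms(2) by (auto simp: inj_on_def)
  moreover have "Pow A \<inter> insert x ` Pow A = {}" using assms(2) by auto
  ultimately show ?thesis
    using assms(1) by (simp add: Pow_insert sum.union_disjoint sum.reindex sum.distrib o_def)
qed

lemma sum_Pow_insert2:
  assumes "finite A" "x \<notin> A" "y \<notin> A" "x \<noteq> y"
  shows "sum g (Pow (insert x (insert y A))) =
    (\<Sum>t\<in>Pow A. g t + g (insert y t) + (g (insert x t) + g (insert x (insert y t))))"
  using assms by (simp add: sum_Pow_insert ac_simps del: Pow_insert)

text \<open>Distributivity: the product over positions of sums over letters is the sum over all words, and words are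
  edge sets.\<close>

lemma sum_transfer_config:
  "(\<Sum>t\<in>Pow (labels a n). of_bool (\<forall>k\<in>{a<..a + int n}. G k (z_edge k \<in> t) (h_edge k \<in> t)) *
      transfer c (config t) a n s s') = transfer c G a n s s'"
proof (induction n arbitrary: s')
  case (Suc n)
  let ?k = "a + int n + 1"
  let ?ok = "\<lambda>t n. of_bool (\<forall>k\<in>{a<..a + int n}. G k (z_edge k \<in> t) (h_edge k \<in> t)) :: real"
  let ?g = "\<lambda>t. ?ok t (Suc n) * transfer c (config t) a (Suc n) s s'"
  have I: "{a<..a + int (Suc n)} = insert ?k {a<..a + int n}" by auto
  have ext: "?g u = (\<Sum>x\<in>UNIV. ?ok t n * transfer c (config t) a n s x *
       (of_bool (G ?k z h) * step_weight c z h x s'))"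
    if u: "\<And>k. k \<in> {a<..a + int n} \<Longrightarrow> (z_edge k \<in> u \<longleftrightarrow> z_edge k \<in> t) \<and> (h_edge k \<in> u \<longleftrightarrow> h_edge k \<in> t)"
      "z_edge ?k \<in> u \<longleftrightarrow> z" "h_edge ?k \<in> u \<longleftrightarrow> h" for u t z h
  proof -
    have "transfer c (config u) a n s x = transfer c (config t) a n s x" for x
      by (rule transfer_cong) (use u in \<open>auto simp: config_def\<close>)
    moreover have "?ok u (Suc n) = of_bool (G ?k z h) * ?ok t n"
      unfolding I using u by (auto simp: of_bool_conj[symmetric])
    moreover have "(\<Sum>z'\<in>UNIV. \<Sum>h'\<in>UNIV. of_bool (config u ?k z' h') * step_weight c z' h' x s') = step_weight c z h x s'" for x
      using u(2,3) by (cases z; cases h) (auto simp: UNIV_bool config_def)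
    ultimately show ?thesis by (simp add: UNIV_bool algebra_simps)
  qed
  let ?ext = "\<lambda>t z h. \<Sum>x\<in>UNIV. ?ok t n * transfer c (config t) a n s x *
       (of_bool (G ?k z h) * step_weight c z h x s')"
  have "(\<Sum>t\<in>Pow (labels a (Suc n)). ?g t) = (\<Sum>t\<in>Pow (labels a n).
      ?g t + ?g (insert (h_edge ?k) t) + (?g (insert (z_edge ?k) t) + ?g (insert (z_edge ?k) (insert (h_edge ?k) t))))"
    unfolding labels_Suc by (rule sum_Pow_insert2) (auto simp: labels_def)
  also have "\<dots> = (\<Sum>t\<in>Pow (labels a n). \<Sum>x\<in>UNIV. ?ok t n * transfer c (config t) a n s x *
       (\<Sum>z\<in>UNIV. \<Sum>h\<in>UNIV. of_bool (G ?k z h) * step_weight c z h x s'))"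
  proof (rule sum.cong[OF refl])
    fix t assume "t \<in> Pow (labels a n)"
    then have k: "z_edge ?k \<notin> t" "h_edge ?k \<notin> t" by auto
    have "?g t = ?ext t False False"
      by (rule ext) (use k in auto)
    moreover have "?g (insert (h_edge ?k) t) = ?ext t False True"
      by (rule ext) (use k in auto)
    moreover have "?g (insert (z_edge ?k) t) = ?ext t True False"
      by (rule ext) (use k in auto)
    moreover have "?g (insert (z_edge ?k) (insert (h_edge ?k) t)) = ?ext t True True"
      by (rule ext) (use k in auto)
    ultimately show "?g t + ?g (insert (h_edge ?k) t) + (?g (insert (z_edge ?k) t) + ?g (insert (z_edge ?k) (insert (h_edge ?k) t))) =
      (\<Sum>x\<in>UNIV. ?ok t n * transfer c (config t) a n s x *
       (\<Sum>z\<in>UNIV. \<Sum>h\<in>UNIV. of_bool (G ?k z h) * step_weight c z h x s'))"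
      by (simp only: UNIV_bool) (simp add: distrib_left)
  qed
  also have "\<dots> = (\<Sum>x\<in>UNIV. transfer c G a n s x *
       (\<Sum>z\<in>UNIV. \<Sum>h\<in>UNIV. of_bool (G ?k z h) * step_weight c z h x s'))"
    by (subst sum.swap) (simp only: Suc.IH[symmetric] sum_distrib_right)
  finally show ?case by simp
qed simp

lemma tree_weight_insert_z:
  "finite t \<Longrightarrow> z_edge k \<notin> t \<Longrightarrow> tree_weight c (insert (z_edge k) t) = c * tree_weight c t"
  by (simp add: tree_weight_def)

lemma tree_weight_insert_h:
  "finite t \<Longrightarrow> h_edge k \<notin> t \<Longrightarrow> tree_weight c (insert (h_edge k) t) = tree_weight c t"
  unfolding tree_weight_def by (subst prod.insert) auto

lemma box_edges_one: "box_edges a (a + 1) = {z_edge (a + 1)}"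
proof -
  have "{a<..a + 1} = {a + 1}" by auto
  then show ?thesis by (simp add: box_edges_eq)
qed

lemma trees_on_one: "trees_on a (a + 1) = {{z_edge (a + 1)}}"
proof -
  have V: "{a..a + 1} = insert (a + 1) {a}" by auto
  have z: "z_edge (a + 1) = {a + 1, a}" by (auto simp: z_edge_def)
  have "minimally_connects {a} {}" by (simp add: minimally_connects_def connects_def)
  then have "minimally_connects {a..a + 1} {z_edge (a + 1)}"
    using minimally_connects_leaf[of "{}" "{a}" "a + 1" a] unfolding V z by simp
  moreover have "\<not> minimally_connects {a..a + 1} {}"
    using connects_isolated[of "{}" "{a}" "a + 1" a] unfolding V minimally_connects_def by simp
  ultimately show ?thesis by (auto simp: trees_on_iff box_edges_one subset_singleton_iff)
qed

lemma sum_config: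
  "(\<Sum>z\<in>UNIV. \<Sum>h\<in>UNIV. of_bool (config t k z h) * step_weight c z h x s') =
    step_weight c (z_edge k \<in> t) (h_edge k \<in> t) x s'"
  by (cases "z_edge k \<in> t"; cases "h_edge k \<in> t") (auto simp: UNIV_bool config_def)

lemma box_edges_Suc:
  assumes "a < b"
  shows "box_edges a (b + 1) = insert (z_edge (b + 1)) (insert (h_edge (b + 1)) (box_edges a b))"
proof -
  have "{a<..b + 1} = insert (b + 1) {a<..b}" "{a + 1<..b + 1} = insert (b + 1) {a + 1<..b}"
    using assms by auto
  then show ?thesis by (auto simp: box_edges_eq)
qed

text \<open>The left end of the box is encoded by the start state \<open>False\<close>. The vertex \<open>a\<close> counts as
  separated from a phantom vertex \<open>a - 1\<close>, and the edge \<open>h_edge (a + 1)\<close>, which lies outside the box, is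
  required as the first h-edge so that the phantom component takes \<open>a + 1\<close> as its next vertex. State
  \<open>False\<close> at the right end means that \<open>z_edge\<close> at the end would complete a spanning tree.\<close>

lemma transfer_config_tree:
  assumes "t \<subseteq> box_edges a (a + int (Suc n))"
  shows "transfer c (config (insert (h_edge (a + 1)) t)) a (Suc n) False True =
      of_bool (t \<in> trees_on a (a + int (Suc n))) * tree_weight c t \<and>
    transfer c (config (insert (h_edge (a + 1)) t)) a (Suc n) False False =
      of_bool (z_edge (a + int (Suc n)) \<notin> t \<and>
        insert (z_edge (a + int (Suc n))) t \<in> trees_on a (a + int (Suc n))) * tree_weight c t"
  using assms
proof (induction n arbitrary: t)
  case 0
  then have "t = {} \<or> t = {z_edge (a + 1)}" by (auto simp: box_edges_one)
  then show ?case
    unfolding transfer.simps sum_config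
    by (auto simp: UNIV_bool step_weight_def trees_on_one tree_weight_def)
next
  case (Suc n)
  define b where "b = a + int (Suc n)"
  define t0 where "t0 = t \<inter> box_edges a b"
  let ?h = "h_edge (a + 1)"
  have ab: "a < b" "a + int (Suc (Suc n)) = b + 1" "a + int (Suc n) + 1 = b + 1" by (simp_all add: b_def)
  have t0: "t0 \<subseteq> box_edges a b" by (simp add: t0_def)
  then have new: "z_edge (b + 1) \<notin> t0" "h_edge (b + 1) \<notin> t0" by (auto simp: box_edges_eq)
  have fin: "finite t0" using t0 by (rule finite_subset) (simp add: box_edges_eq)
  have h: "h_edge (b + 1) \<noteq> ?h" using ab by simp
  have t: "t - {z_edge (b + 1), h_edge (b + 1)} = t0"
    using Suc.prems unfolding ab(2) box_edges_Suc[OF ab(1)] t0_def by (auto simp: box_edges_eq)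
  have loc: "transfer c (config (insert ?h t)) a (Suc n) False x = transfer c (config (insert ?h t0)) a (Suc n) False x" for x
  proof (rule transfer_cong)
    fix k z h assume "a < k" "k \<le> a + int (Suc n)"
    then have "z_edge k \<in> t \<longleftrightarrow> z_edge k \<in> t0" "h_edge k \<in> t \<longleftrightarrow> h_edge k \<in> t0"
      unfolding t[symmetric] by (auto simp: b_def)
    then show "config (insert ?h t) k z h = config (insert ?h t0) k z h"
      by (simp add: config_def)
  qed
  have IH: "transfer c (config (insert ?h t0)) a (Suc n) False True = of_bool (t0 \<in> trees_on a b) * tree_weight c t0"
    "transfer c (config (insert ?h t0)) a (Suc n) False False =
      of_bool (z_edge b \<notin> t0 \<and> insert (z_edge b) t0 \<in> trees_on a b) * tree_weight c t0"
    using Suc.IH[of t0] t0 unfolding b_def by blast+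
  have step: "transfer c (config (insert ?h t)) a (Suc (Suc n)) False s =
     transfer c (config (insert ?h t0)) a (Suc n) False True * step_weight c (z_edge (b + 1) \<in> t) (h_edge (b + 1) \<in> t) True s +
     transfer c (config (insert ?h t0)) a (Suc n) False False * step_weight c (z_edge (b + 1) \<in> t) (h_edge (b + 1) \<in> t) False s" for s
    unfolding transfer.simps(2)[of c _ a "Suc n"] loc sum_config ab(3) using h by (simp add: UNIV_bool)
  note tw = tree_weight_insert_z[OF fin new(1)] tree_weight_insert_h[OF fin new(2)]
    tree_weight_insert_z[of "insert (h_edge (b + 1)) t0" "b + 1"]
  have cases: "t = t0 \<or> t = insert (z_edge (b + 1)) t0 \<or> t = insert (h_edge (b + 1)) t0 \<or>
      t = insert (z_edge (b + 1)) (insert (h_edge (b + 1)) t0)"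
    using t by blast
  note trees = trees_on_step[OF ab(1) t0]
  show ?case unfolding step ab(2) IH using cases
    by (elim disjE; hypsubst_thin?) (use trees tw fin new in \<open>auto simp: step_weight_def insert_commute\<close>)
qed

text \<open>From \<open>False\<close> there is no step without an h-edge.\<close>

lemma transfer_config_no_start:
  assumes "h_edge (a + 1) \<notin> t"
  shows "transfer c (config t) a (Suc n) False s = 0"
proof (induction n arbitrary: s)
  case 0
  show ?case unfolding transfer.simps sum_config using assms by (simp add: UNIV_bool step_weight_def)
next
  case (Suc n)
  then show ?case by (simp only: transfer.simps(2)[of c _ a "Suc n"]) simp
qed

lemma labels_eq_box_edges:
  "labels a (Suc n) = insert (h_edge (a + 1)) (box_edges a (a + int (Suc n)))"
proof -
  have "{a<..a + int (Suc n)} = insert (a + 1) {a + 1<..a + int (Suc n)}" by auto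
  then show ?thesis by (auto simp: labels_def box_edges_eq)
qed

lemma finite_box_edges [simp]: "finite (box_edges a b)"
  by (simp add: box_edges_eq)

text \<open>The assumption on \<open>G\<close> says that the phantom edge \<open>h_edge (a + 1)\<close> is left unconstrained.\<close>

lemma sum_trees_on:
  assumes G: "\<And>z. G (a + 1) z True = G (a + 1) z False" and b: "b = a + int (Suc n)"
  shows "(\<Sum>t\<in>{t \<in> trees_on a b. \<forall>k\<in>{a<..b}. G k (z_edge k \<in> t) (h_edge k \<in> t)}. tree_weight c t) =
    transfer c G a (Suc n) False True"
proof -
  let ?h = "h_edge (a + 1)"
  let ?ok = "\<lambda>t. \<forall>k\<in>{a<..b}. G k (z_edge k \<in> t) (h_edge k \<in> t)"
  have h: "?h \<notin> box_edges a b" by (auto simp: box_edges_eq)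
  have "transfer c G a (Suc n) False True =
      (\<Sum>t\<in>Pow (insert ?h (box_edges a b)). of_bool (?ok t) * transfer c (config t) a (Suc n) False True)"
    unfolding b labels_eq_box_edges[symmetric] by (rule sum_transfer_config[symmetric])
  also have "\<dots> = (\<Sum>t\<in>Pow (box_edges a b). of_bool (?ok t) * transfer c (config t) a (Suc n) False True +
      of_bool (?ok (insert ?h t)) * transfer c (config (insert ?h t)) a (Suc n) False True)"
    by (rule sum_Pow_insert) (use h in auto)
  also have "\<dots> = (\<Sum>t\<in>Pow (box_edges a b). if t \<in> trees_on a b \<and> ?ok t then tree_weight c t else 0)"
  proof (rule sum.cong[OF refl])
    fix t assume t: "t \<in> Pow (box_edges a b)"
    with h have "?h \<notin> t" by auto
    from transfer_config_no_start[OF this, of c n True]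
    have "transfer c (config t) a (Suc n) False True = 0" .
    moreover have "?ok (insert ?h t) \<longleftrightarrow> ?ok t"
    proof (rule ball_cong[OF refl])
      fix k
      show "G k (z_edge k \<in> insert ?h t) (h_edge k \<in> insert ?h t) = G k (z_edge k \<in> t) (h_edge k \<in> t)"
        using G \<open>?h \<notin> t\<close> by (cases "k = a + 1") auto
    qed
    moreover have "transfer c (config (insert ?h t)) a (Suc n) False True = of_bool (t \<in> trees_on a b) * tree_weight c t"
      using transfer_config_tree[of t a n c] t unfolding b by blast
    ultimately show "of_bool (?ok t) * transfer c (config t) a (Suc n) False True +
      of_bool (?ok (insert ?h t)) * transfer c (config (insert ?h t)) a (Suc n) False True =
      (if t \<in> trees_on a b \<and> ?ok t then tree_weight c t else 0)" by simp
  qed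
  also have "\<dots> = (\<Sum>t\<in>{t \<in> Pow (box_edges a b). t \<in> trees_on a b \<and> ?ok t}. tree_weight c t)"
    by (rule sum.inter_filter[symmetric]) simp
  also have "{t \<in> Pow (box_edges a b). t \<in> trees_on a b \<and> ?ok t} = {t \<in> trees_on a b. ?ok t}"
    by (auto simp: trees_on_iff)
  finally show ?thesis ..
qed

section \<open>Perron asymptotics of the box probabilities\<close>

declare transfer.simps(2) [simp del]

text \<open>The spectral projection of the free transfer matrix for its eigenvalue \<open>1 / \<alpha>\<close>: the product of the right
  eigenvector \<open>(1, 1 - \<alpha>)\<close> and the left eigenvector \<open>(1 - \<alpha>, \<alpha>)\<close>, divided by their scalar product
  \<open>1 - \<alpha>^2\<close>.\<close>

definition perron :: "real \<Rightarrow> bool \<Rightarrow> bool \<Rightarrow> real" where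
  "perron \<alpha> s s' =
    (if s then if s' then 1 / (1 + \<alpha>) else \<alpha> / ((1 - \<alpha>) * (1 + \<alpha>))
     else if s' then (1 - \<alpha>) / (1 + \<alpha>) else \<alpha> / (1 + \<alpha>))"

lemma sum_free_step:
  "(\<Sum>z\<in>UNIV. \<Sum>h\<in>UNIV. of_bool True * step_weight c z h x s') =
    (if x then if s' then c + 1 else 1 else if s' then c else 1)"
  by (simp add: UNIV_bool step_weight_def)

text \<open>The eigenvalues are \<open>1 / \<alpha>\<close> and \<open>\<alpha>\<close>, and the projection for \<open>\<alpha>\<close> is complementary to \<open>perron\<close>. Scaling by
  \<open>\<alpha>^n\<close> turns their powers into 1 and \<open>\<alpha>^(2 n)\<close>.\<close>

lemma transfer_free:
  assumes \<alpha>: "0 < \<alpha>" "\<alpha> < 1"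
  shows "\<alpha> ^ n * transfer (conductance \<alpha>) free a n s s' =
    perron \<alpha> s s' + \<alpha> ^ (2 * n) * (of_bool (s = s') - perron \<alpha> s s')"
proof (induction n arbitrary: s')
  case (Suc n)
  let ?c = "conductance \<alpha>"
  define t where "t x = \<alpha> ^ n * transfer ?c free a n s x" for x
  define q where "q = \<alpha> ^ (2 * n)"
  have c: "\<alpha> * ?c = (1 - \<alpha>)\<^sup>2" using \<alpha> by (simp add: conductance_def)
  have "\<alpha> ^ Suc n * transfer ?c free a (Suc n) s s' =
      \<alpha> * (t True * (if s' then ?c + 1 else 1) + t False * (if s' then ?c else 1))"
    unfolding transfer.simps sum_free_step t_def by (simp add: UNIV_bool algebra_simps)
  also have "\<dots> = t True * (if s' then (1 - \<alpha>)\<^sup>2 + \<alpha> else \<alpha>) + t False * (if s' then (1 - \<alpha>)\<^sup>2 else \<alpha>)"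
    unfolding c[symmetric] by (simp add: algebra_simps)
  also have "\<dots> = perron \<alpha> s s' + \<alpha>\<^sup>2 * q * (of_bool (s = s') - perron \<alpha> s s')"
  proof -
    have nz: "1 + \<alpha> \<noteq> 0" "\<alpha> \<noteq> 1" "1 \<noteq> \<alpha>" using \<alpha> by auto
    have "t x = perron \<alpha> s x + q * (of_bool (s = x) - perron \<alpha> s x)" for x
      using Suc.IH by (simp add: t_def q_def)
    then have t: "t = (\<lambda>x. perron \<alpha> s x + q * (of_bool (s = x) - perron \<alpha> s x))" by blast
    show ?thesis
      unfolding t using nz by (cases s; cases s'; simp add: perron_def divide_simps) (simp_all add: algebra_simps power2_eq_square)
  qed
  also have "\<alpha>\<^sup>2 * q = \<alpha> ^ (2 * Suc n)" by (simp add: q_def power2_eq_square)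
  finally show ?case .
qed simp

lemma transfer_free_tendsto:
  assumes "0 < \<alpha>" "\<alpha> < 1"
  shows "(\<lambda>n. \<alpha> ^ n * transfer (conductance \<alpha>) free (a n) n s s') \<longlonglongrightarrow> perron \<alpha> s s'"
proof -
  have "(\<lambda>n. \<alpha> ^ (2 * n)) \<longlonglongrightarrow> 0"
    using assms LIMSEQ_realpow_zero[of "\<alpha>\<^sup>2"] by (simp add: power_mult power_less_one_iff abs_square_less_1)
  then have "(\<lambda>n. perron \<alpha> s s' + \<alpha> ^ (2 * n) * (of_bool (s = s') - perron \<alpha> s s'))
      \<longlonglongrightarrow> perron \<alpha> s s' + 0 * (of_bool (s = s') - perron \<alpha> s s')"
    by (intro tendsto_intros)
  then show ?thesis using assms by (simp add: transfer_free)
qed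

lemma perron_pos: "0 < \<alpha> \<Longrightarrow> \<alpha> < 1 \<Longrightarrow> 0 < perron \<alpha> s s'"
  by (auto simp: perron_def intro!: divide_pos_pos)

lemma conductance_pos: "0 < \<alpha> \<Longrightarrow> \<alpha> < 1 \<Longrightarrow> 0 < conductance \<alpha>"
  by (simp add: conductance_def)

lemma transfer_free_pos:
  assumes "0 < \<alpha>" "\<alpha> < 1" "n \<noteq> 0"
  shows "0 < transfer (conductance \<alpha>) free a n s s'"
proof -
  have "\<alpha> ^ (2 * n) < 1" using assms by (simp add: power_less_one_iff)
  then have "0 < (1 - \<alpha> ^ (2 * n)) * perron \<alpha> s s' + \<alpha> ^ (2 * n) * of_bool (s = s')"
    using perron_pos[OF assms(1,2), of s s'] assms(1) by (intro add_pos_nonneg mult_pos_pos) auto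
  then have "0 < \<alpha> ^ n * transfer (conductance \<alpha>) free a n s s'"
    unfolding transfer_free[OF assms(1,2)] by (simp add: algebra_simps)
  then show ?thesis using assms by (simp add: zero_less_mult_iff)
qed

definition box_prob :: "real \<Rightarrow> (int \<Rightarrow> bool \<Rightarrow> bool \<Rightarrow> bool) \<Rightarrow> nat \<Rightarrow> real" where
  "box_prob c G N = transfer c G (- int N) (2 * N) False True / transfer c free (- int N) (2 * N) False True"

lemma box_trees_eq: "box_trees N = trees_on (- int N) (int N)"
  by (simp add: box_trees_def trees_on_def box_edges_def)

lemma finite_box_trees [simp]: "finite (box_trees N)"
  unfolding box_trees_eq by (rule finite_subset[of _ "Pow (box_edges (- int N) (int N))"]) (auto simp: trees_on_iff)

lemma space_box_tree_measure [simp]: "space (box_tree_measure c N) = box_trees N"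
  and sets_box_tree_measure [simp]: "sets (box_tree_measure c N) = Pow (box_trees N)"
  by (simp_all add: box_tree_measure_def space_point_measure sets_point_measure)

lemma tree_weight_nonneg: "0 \<le> c \<Longrightarrow> 0 \<le> tree_weight c t"
  by (auto simp: tree_weight_def intro: prod_nonneg)

lemma measure_box_tree_measure:
  assumes "0 \<le> c" "S \<subseteq> box_trees N"
  shows "measure (box_tree_measure c N) S = (\<Sum>t\<in>S. tree_weight c t) / (\<Sum>t\<in>box_trees N. tree_weight c t)"
proof -
  let ?Z = "\<Sum>t\<in>box_trees N. tree_weight c t"
  have "emeasure (box_tree_measure c N) S = (\<Sum>t\<in>S. ennreal (tree_weight c t / ?Z))"
    unfolding box_tree_measure_def using assms by (intro emeasure_point_measure_finite) auto
  also have "\<dots> = ennreal (\<Sum>t\<in>S. tree_weight c t / ?Z)"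
    using assms by (intro sum_ennreal) (auto intro!: divide_nonneg_nonneg sum_nonneg tree_weight_nonneg)
  finally show ?thesis
    using assms by (simp add: measure_def sum_divide_distrib[symmetric] sum_nonneg tree_weight_nonneg)
qed

lemma measure_box_tree_measure_eq_box_prob:
  assumes "0 \<le> c" "N \<noteq> 0" "\<And>z. G (- int N + 1) z True = G (- int N + 1) z False"
  shows "measure (box_tree_measure c N) {t \<in> box_trees N. \<forall>k\<in>{- int N<..int N}. G k (z_edge k \<in> t) (h_edge k \<in> t)}
    = box_prob c G N"
proof -
  define n where "n = 2 * N - 1"
  have n: "2 * N = Suc n" using assms(2) by (simp add: n_def)
  then have b: "int N = - int N + int (Suc n)" by linarith
  have "(\<Sum>t\<in>box_trees N. tree_weight c t) = transfer c free (- int N) (2 * N) False True"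
    using sum_trees_on[of free "- int N", OF _ b] unfolding box_trees_eq n by simp
  moreover have "(\<Sum>t\<in>{t \<in> box_trees N. \<forall>k\<in>{- int N<..int N}. G k (z_edge k \<in> t) (h_edge k \<in> t)}. tree_weight c t)
      = transfer c G (- int N) (2 * N) False True"
    using sum_trees_on[of G "- int N", OF _ b] assms(3) unfolding box_trees_eq n by simp
  ultimately show ?thesis
    unfolding box_prob_def by (subst measure_box_tree_measure) (use assms(1) in auto)
qed

lemma prob_space_box_tree_measure:
  assumes "0 < \<alpha>" "\<alpha> < 1" "N \<noteq> 0"
  shows "prob_space (box_tree_measure (conductance \<alpha>) N)"
proof (rule prob_spaceI)
  have c: "0 \<le> conductance \<alpha>" using conductance_pos[OF assms(1,2)] by simp
  have "measure (box_tree_measure (conductance \<alpha>) N) (box_trees N) = box_prob (conductance \<alpha>) free N"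
    using measure_box_tree_measure_eq_box_prob[OF c assms(3), of free] by simp
  also have "\<dots> = 1" unfolding box_prob_def using transfer_free_pos[OF assms(1,2), of "2 * N"] assms(3)
    by (simp add: less_imp_neq[THEN not_sym])
  finally have "measure (box_tree_measure (conductance \<alpha>) N) (space (box_tree_measure (conductance \<alpha>) N)) = 1" by simp
  then show "emeasure (box_tree_measure (conductance \<alpha>) N) (space (box_tree_measure (conductance \<alpha>) N)) = 1"
    by (metis emeasure_eq_ennreal_measure ennreal_1 measure_zero_top zero_neq_one)
qed

text \<open>Outside the window the product is free, and the scaled free factors on its two sides converge to \<open>perron\<close>.\<close>

lemma box_prob_convergent:
  assumes \<alpha>: "0 < \<alpha>" "\<alpha> < 1"
    and G: "\<And>k z h. k \<le> - int m \<or> int m < k \<Longrightarrow> G k z h"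
  shows "convergent (box_prob (conductance \<alpha>) G)"
proof -
  let ?c = "conductance \<alpha>"
  define W where "W x y = \<alpha> ^ (2 * m) * transfer ?c G (- int m) (2 * m) x y" for x y
  let ?num = "\<lambda>j. \<alpha> ^ (2 * (j + m)) * transfer ?c G (- int (j + m)) (2 * (j + m)) False True"
  let ?den = "\<lambda>j. \<alpha> ^ (2 * (j + m)) * transfer ?c free (- int (j + m)) (2 * (j + m)) False True"
  let ?lim = "(\<Sum>y\<in>UNIV. (\<Sum>x\<in>UNIV. perron \<alpha> False x * W x y) * perron \<alpha> y True)"
  have split: "?num j =
     (\<Sum>y\<in>UNIV. (\<Sum>x\<in>UNIV. (\<alpha> ^ j * transfer ?c free (- int (j + m)) j False x) * W x y) *
       (\<alpha> ^ j * transfer ?c free (int m) j y True))" for j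
  proof -
    have left: "transfer ?c G (- int (j + m)) j False x = transfer ?c free (- int (j + m)) j False x" for x
      by (rule transfer_cong) (use G in auto)
    have right: "transfer ?c G (int m) j y True = transfer ?c free (int m) j y True" for y
      by (rule transfer_cong) (use G in auto)
    have eq: "2 * (j + m) = (j + 2 * m) + j" "- int (j + m) + int j = - int m"
      "- int (j + m) + int (j + 2 * m) = int m" by simp_all
    have "transfer ?c G (- int (j + m)) (2 * (j + m)) False True =
      (\<Sum>y\<in>UNIV. (\<Sum>x\<in>UNIV. transfer ?c free (- int (j + m)) j False x * transfer ?c G (- int m) (2 * m) x y)
         * transfer ?c free (int m) j y True)"
      unfolding eq(1) transfer_add eq(2,3) left right ..
    moreover have "\<alpha> ^ (2 * (j + m)) = \<alpha> ^ j * \<alpha> ^ (2 * m) * \<alpha> ^ j"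
      by (simp flip: power_add)
    ultimately show ?thesis by (simp add: W_def UNIV_bool algebra_simps)
  qed
  have "(\<lambda>j. ?num j) \<longlonglongrightarrow>
    ?lim"
    unfolding split by (intro tendsto_intros transfer_free_tendsto \<alpha>)
  moreover have "(\<lambda>j. ?den j) \<longlonglongrightarrow> perron \<alpha> False True"
    using LIMSEQ_subseq_LIMSEQ[OF transfer_free_tendsto[OF \<alpha>, of "\<lambda>n. - int n div 2" False True], of "\<lambda>j. 2 * (j + m)"]
    by (simp add: strict_mono_def o_def transfer_free[OF \<alpha>])
  moreover have "perron \<alpha> False True \<noteq> 0" using perron_pos[OF \<alpha>, of False True] by simp
  ultimately have "(\<lambda>j. ?num j /
     ?den j) \<longlonglongrightarrow>
     ?lim / perron \<alpha> False True"
    by (rule tendsto_divide)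
  then have "(\<lambda>j. box_prob ?c G (j + m)) \<longlonglongrightarrow>
     ?lim / perron \<alpha> False True"
    unfolding box_prob_def using \<alpha> by simp
  then show ?thesis unfolding convergent_def by (blast dest: LIMSEQ_offset)
qed

lemma finite_zigzag_edges_in_labels:
  assumes "finite F" "F \<subseteq> zigzag_edges"
  obtains m where "F \<subseteq> labels (- int m) (2 * m)"
proof -
  have "\<exists>m. F \<subseteq> labels (- int m) (2 * m)" using assms
  proof (induction F)
    case (insert e F)
    then obtain m where m: "F \<subseteq> labels (- int m) (2 * m)" by auto
    from insert.prems obtain k where k: "e = z_edge k \<or> e = h_edge k" by (auto simp: zigzag_edges_def)
    define m' where "m' = m + nat \<bar>k\<bar> + 1"
    have "F \<subseteq> labels (- int m') (2 * m')" using m unfolding labels_def m'_def by fastforce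
    moreover have "e \<in> labels (- int m') (2 * m')" using k by (auto simp: m'_def)
    ultimately show ?case by blast
  qed simp
  then show ?thesis using that by blast
qed

text \<open>Every finite edge set lies in a window, and the event is a disjoint union over the configurations of the
  window.\<close>

lemma convergent_box_tree_measure:
  assumes \<alpha>: "0 < \<alpha>" "\<alpha> < 1" and F: "finite F" "F \<subseteq> zigzag_edges"
  shows "convergent (\<lambda>n. measure (box_tree_measure (conductance \<alpha>) (Suc n)) {t \<in> box_trees (Suc n). t \<inter> F \<in> D})"
proof -
  let ?c = "conductance \<alpha>"
  have c: "0 \<le> ?c" using conductance_pos[OF \<alpha>] by simp
  obtain m where m: "F \<subseteq> labels (- int m) (2 * m)" using finite_zigzag_edges_in_labels[OF F] .
  define W where "W = labels (- int m) (2 * m)"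
  define G where "G s k z h \<longleftrightarrow> (- int m < k \<and> k \<le> int m \<longrightarrow> config s k z h)" for s k z h
  define \<D> where "\<D> = {s \<in> Pow W. s \<inter> F \<in> D}"
  have "finite \<D>" unfolding \<D>_def W_def by simp
  have eq: "measure (box_tree_measure ?c N) {t \<in> box_trees N. t \<inter> F \<in> D} = (\<Sum>s\<in>\<D>. box_prob ?c (G s) N)"
    if N: "Suc m \<le> N" for N
  proof -
    have "{t \<in> box_trees N. t \<inter> F \<in> D} = (\<Union>s\<in>\<D>. {t \<in> box_trees N. t \<inter> W = s})"
    proof -
      have "t \<inter> W \<inter> F = t \<inter> F" for t using m unfolding W_def by blast
      then show ?thesis unfolding \<D>_def by auto
    qed
    also have "measure (box_tree_measure ?c N) \<dots> = (\<Sum>s\<in>\<D>. measure (box_tree_measure ?c N) {t \<in> box_trees N. t \<inter> W = s})"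
    proof -
      interpret prob_space "box_tree_measure ?c N" by (rule prob_space_box_tree_measure[OF \<alpha>]) (use N in simp)
      show ?thesis
        by (rule finite_measure_finite_Union) (use \<open>finite \<D>\<close> in \<open>auto simp: disjoint_family_on_def\<close>)
    qed
    also have "\<dots> = (\<Sum>s\<in>\<D>. box_prob ?c (G s) N)"
    proof (rule sum.cong[OF refl])
      fix s assume "s \<in> \<D>"
      then have "s \<subseteq> W" by (simp add: \<D>_def)
      have W: "e \<in> W \<longleftrightarrow> (\<exists>k. - int m < k \<and> k \<le> int m \<and> (e = z_edge k \<or> e = h_edge k))" for e
        unfolding W_def labels_def by auto
      have "t \<inter> W = s \<longleftrightarrow> (\<forall>k\<in>{- int N<..int N}. G s k (z_edge k \<in> t) (h_edge k \<in> t))" for t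
      proof
        assume "t \<inter> W = s"
        then show "\<forall>k\<in>{- int N<..int N}. G s k (z_edge k \<in> t) (h_edge k \<in> t)"
          unfolding G_def config_def using W by blast
      next
        assume G: "\<forall>k\<in>{- int N<..int N}. G s k (z_edge k \<in> t) (h_edge k \<in> t)"
        have "e \<in> t \<longleftrightarrow> e \<in> s" if "e \<in> W" for e
        proof -
          from that obtain k where k: "- int m < k" "k \<le> int m" "e = z_edge k \<or> e = h_edge k" unfolding W by blast
          with N have "k \<in> {- int N<..int N}" by auto
          with G k(1,2) have "config s k (z_edge k \<in> t) (h_edge k \<in> t)" unfolding G_def by blast
          with k(3) show ?thesis unfolding config_def by blast
        qed
        with \<open>s \<subseteq> W\<close> show "t \<inter> W = s" by blast
      qed
      then have "{t \<in> box_trees N. t \<inter> W = s} =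
        {t \<in> box_trees N. \<forall>k\<in>{- int N<..int N}. G s k (z_edge k \<in> t) (h_edge k \<in> t)}" by auto
      then show "measure (box_tree_measure ?c N) {t \<in> box_trees N. t \<inter> W = s} = box_prob ?c (G s) N"
        using measure_box_tree_measure_eq_box_prob[OF c, of N "G s"] N by (simp add: G_def)
    qed
    finally show ?thesis .
  qed
  have conv: "convergent (\<lambda>N. \<Sum>s\<in>\<D>. box_prob ?c (G s) N)"
    by (intro convergent_sum box_prob_convergent[OF \<alpha>, of m]) (auto simp: G_def)
  have "\<forall>\<^sub>F N in sequentially. measure (box_tree_measure ?c N) {t \<in> box_trees N. t \<inter> F \<in> D} = (\<Sum>s\<in>\<D>. box_prob ?c (G s) N)"
    unfolding eventually_sequentially using eq by blast
  from tendsto_cong[OF this] conv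
  have "convergent (\<lambda>N. measure (box_tree_measure ?c N) {t \<in> box_trees N. t \<inter> F \<in> D})"
    unfolding convergent_def by simp
  then show ?thesis by (subst convergent_Suc_iff)
qed

definition z_present :: "int set \<Rightarrow> int \<Rightarrow> bool \<Rightarrow> bool \<Rightarrow> bool" where
  "z_present S k z h \<longleftrightarrow> (k \<in> S \<longrightarrow> z)"

text \<open>The mechanism behind the renewal property: a letter with a z-edge leads to \<open>True\<close> with weight \<open>c\<close>, from
  whichever state.\<close>

lemma transfer_z_step:
  assumes "a + int n + 1 \<in> S"
  shows "transfer c (z_present S) a (Suc n) s s' =
    (if s' then c * (\<Sum>x\<in>UNIV. transfer c (z_present S) a n s x) else 0)"
  using assms by (simp add: transfer.simps(2) z_present_def UNIV_bool step_weight_def algebra_simps)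

text \<open>Both states lead to \<open>False\<close> with total weight 1.\<close>

lemma sum_transfer_free:
  "(\<Sum>x\<in>UNIV. transfer c free a n s x) = transfer c free a (Suc n) s False"
  unfolding transfer.simps sum_free_step by (simp add: UNIV_bool)

lemma box_prob_z_singleton:
  assumes "\<bar>t\<bar> < int N"
  shows "box_prob c (z_present {t}) N =
    c * transfer c free (- int N) (nat (t + int N)) False False * transfer c free t (nat (int N - t)) True True /
      transfer c free (- int N) (2 * N) False True"
proof -
  define n where "n = nat (t + int N - 1)"
  have n: "int n = t + int N - 1" "nat (t + int N) = Suc n" using assms by (auto simp: n_def)
  have eq: "2 * N = Suc n + nat (int N - t)" "- int N + int n + 1 = t" "- int N + int (Suc n) = t" using assms n by linarith+
  have L: "transfer c (z_present {t}) (- int N) n False x = transfer c free (- int N) n False x" for x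
    by (rule transfer_cong) (use n in \<open>auto simp: z_present_def\<close>)
  have R: "transfer c (z_present {t}) t (nat (int N - t)) x True = transfer c free t (nat (int N - t)) x True" for x
    by (rule transfer_cong) (auto simp: z_present_def)
  have "transfer c (z_present {t}) (- int N) (2 * N) False True =
     transfer c (z_present {t}) (- int N) (Suc n) False True * transfer c free t (nat (int N - t)) True True"
    unfolding eq(1) transfer_add eq(3) R using transfer_z_step[of "- int N" n "{t}"] eq(2) by (simp add: UNIV_bool)
  also have "transfer c (z_present {t}) (- int N) (Suc n) False True = c * transfer c free (- int N) (Suc n) False False"
    using transfer_z_step[of "- int N" n "{t}" c False True] eq(2) sum_transfer_free[of c "- int N" n False] by (simp add: L)
  finally show ?thesis by (simp add: box_prob_def n)
qed

text \<open>Up to \<open>Max S\<close> the two products agree, and there the automaton is in state \<open>True\<close>; they differ only in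
  the factors to the right of \<open>Max S\<close>.\<close>

lemma box_prob_z_insert:
  assumes S: "finite S" "S \<noteq> {}" "S \<subseteq> {- int N<..<int N}" and t: "Max S < t" "t < int N"
  shows "box_prob c (z_present (insert t S)) N * transfer c free (Max S) (nat (int N - Max S)) True True =
    box_prob c (z_present S) N * (c * transfer c free (Max S) (nat (t - Max S)) True False * transfer c free t (nat (int N - t)) True True)"
proof -
  define r where "r = Max S"
  have r: "r \<in> S" "\<And>k. k \<in> S \<Longrightarrow> k \<le> r" "r < t" "- int N < r"
    using S t Max_in[OF S(1,2)] subsetD[OF S(3) Max_in[OF S(1,2)]] by (simp_all add: r_def)
  define n where "n = nat (r + int N - 1)"
  define g where "g = nat (t - r - 1)"
  have n: "int n = r + int N - 1" using r by (auto simp: n_def)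
  have g: "int g = t - r - 1" "nat (t - r) = Suc g" using r by (auto simp: g_def)
  define X where "X = transfer c (z_present S) (- int N) (Suc n) False True"
  have eq: "2 * N = Suc n + nat (int N - r)" "- int N + int n + 1 = r" "- int N + int (Suc n) = r"
     "nat (int N - r) = Suc g + nat (int N - t)" "r + int g + 1 = t" "r + int (Suc g) = t"
    using n g r t by linarith+
  have main: "transfer c (z_present S') (- int N) (2 * N) False True =
      X * transfer c (z_present S') r (nat (int N - r)) True True" if S': "S' = S \<or> S' = insert t S" for S'
  proof -
    have rS': "- int N + int n + 1 \<in> S'" using r S' eq(2) by auto
    have "transfer c (z_present S') (- int N) (Suc n) False True = X"
      unfolding X_def by (rule transfer_cong) (use n r S' in \<open>auto simp: z_present_def\<close>)
    then show ?thesis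
      unfolding eq(1) transfer_add eq(3) using transfer_z_step[OF rS', of c False False] by (simp add: UNIV_bool)
  qed
  have "transfer c (z_present S) r (nat (int N - r)) True True = transfer c free r (nat (int N - r)) True True"
    by (rule transfer_cong) (use r in \<open>force simp: z_present_def\<close>)
  moreover have "transfer c (z_present (insert t S)) r (nat (int N - r)) True True =
      c * transfer c free r (Suc g) True False * transfer c free t (nat (int N - t)) True True"
  proof -
    have L: "transfer c (z_present (insert t S)) r g True x = transfer c free r g True x" for x
      by (rule transfer_cong) (use r g in \<open>force simp: z_present_def\<close>)
    have R: "transfer c (z_present (insert t S)) t (nat (int N - t)) x True = transfer c free t (nat (int N - t)) x True" for x
      by (rule transfer_cong) (use r in \<open>force simp: z_present_def\<close>)
    have tS: "r + int g + 1 \<in> insert t S" using eq(5) by simp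
    have "transfer c (z_present (insert t S)) r (nat (int N - r)) True True =
       transfer c (z_present (insert t S)) r (Suc g) True True * transfer c free t (nat (int N - t)) True True"
      unfolding eq(4) transfer_add eq(6) R using transfer_z_step[OF tS, of c True False] by (simp add: UNIV_bool)
    also have "transfer c (z_present (insert t S)) r (Suc g) True True = c * transfer c free r (Suc g) True False"
      using transfer_z_step[OF tS, of c True True] sum_transfer_free[of c r g True] by (simp add: L)
    finally show ?thesis .
  qed
  ultimately show ?thesis
    unfolding r_def[symmetric] box_prob_def g(2) main[OF disjI1[OF refl]] main[OF disjI2[OF refl]] by simp
qed

lemma transfer_free_tendsto_shift:
  assumes \<alpha>: "0 < \<alpha>" "\<alpha> < 1" and f: "filterlim f sequentially sequentially"
  shows "(\<lambda>N. \<alpha> ^ f N * transfer (conductance \<alpha>) free (a N) (f N) s s') \<longlonglongrightarrow> perron \<alpha> s s'"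
proof -
  have "(\<lambda>n. \<alpha> ^ n * transfer (conductance \<alpha>) free 0 n s s') \<longlonglongrightarrow> perron \<alpha> s s'"
    by (rule transfer_free_tendsto[OF \<alpha>])
  from filterlim_compose[OF this f] show ?thesis by (simp add: transfer_free[OF \<alpha>])
qed

text \<open>The powers of \<open>\<alpha>\<close> that normalise the three free products cancel because
  \<open>(t + N) + (N - t) = 2 N\<close>.\<close>

lemma box_prob_z_singleton_tendsto:
  assumes \<alpha>: "0 < \<alpha>" "\<alpha> < 1"
  shows "box_prob (conductance \<alpha>) (z_present {t}) \<longlonglongrightarrow> zigzag_density \<alpha>"
proof -
  let ?c = "conductance \<alpha>"
  have f1: "filterlim (\<lambda>N. nat (t + int N)) sequentially sequentially" by real_asymp
  have f2: "filterlim (\<lambda>N. nat (int N - t)) sequentially sequentially" by real_asymp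
  have f3: "filterlim (\<lambda>N::nat. 2 * N) sequentially sequentially" by real_asymp
  have "(\<lambda>N. ?c * (\<alpha> ^ nat (t + int N) * transfer ?c free (- int N) (nat (t + int N)) False False) *
     (\<alpha> ^ nat (int N - t) * transfer ?c free t (nat (int N - t)) True True) /
     (\<alpha> ^ (2 * N) * transfer ?c free (- int N) (2 * N) False True)) \<longlonglongrightarrow>
     ?c * perron \<alpha> False False * perron \<alpha> True True / perron \<alpha> False True"
    using perron_pos[OF \<alpha>, of False True]
    by (intro tendsto_intros transfer_free_tendsto_shift \<alpha> f1 f2 f3) simp
  also have "?c * perron \<alpha> False False * perron \<alpha> True True / perron \<alpha> False True = zigzag_density \<alpha>"
    using \<alpha> by (simp add: perron_def conductance_def divide_simps) (simp add: algebra_simps power2_eq_square)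
  finally show ?thesis
  proof (rule Lim_transform_eventually)
    show "\<forall>\<^sub>F N in sequentially. ?c * (\<alpha> ^ nat (t + int N) * transfer ?c free (- int N) (nat (t + int N)) False False) *
     (\<alpha> ^ nat (int N - t) * transfer ?c free t (nat (int N - t)) True True) /
     (\<alpha> ^ (2 * N) * transfer ?c free (- int N) (2 * N) False True) = box_prob ?c (z_present {t}) N"
      using eventually_gt_at_top[of "nat \<bar>t\<bar>"]
    proof eventually_elim
      case (elim N)
      have "\<alpha> ^ (2 * N) = \<alpha> ^ nat (t + int N) * \<alpha> ^ nat (int N - t)"
        unfolding power_add[symmetric] using elim by (intro arg_cong[of _ _ "power \<alpha>"]) linarith
      moreover have "\<bar>t\<bar> < int N" using elim by linarith
      ultimately show ?case using box_prob_z_singleton[of t N ?c] \<alpha> by simp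
    qed
  qed
qed

text \<open>By \<open>box_prob_z_insert\<close> the quotient of the two probabilities is a fixed factor for the gap times a
  quotient of free products, which tends to \<open>\<alpha>\<close> to the power of the gap.\<close>

lemma box_prob_z_insert_tendsto:
  assumes \<alpha>: "0 < \<alpha>" "\<alpha> < 1" and S: "finite S" "S \<noteq> {}" and t: "Max S < t"
    and lim: "box_prob (conductance \<alpha>) (z_present S) \<longlonglongrightarrow> p"
  shows "box_prob (conductance \<alpha>) (z_present (insert t S)) \<longlonglongrightarrow>
    p * (zigzag_density \<alpha> * (1 - \<alpha> ^ (2 * nat (t - Max S))))"
proof -
  let ?c = "conductance \<alpha>"
  define r where "r = Max S"
  define g where "g = nat (t - r)"
  define U where "U = ?c * (\<alpha> ^ g * transfer ?c free r g True False)"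
  have f1: "filterlim (\<lambda>N. nat (int N - t)) sequentially sequentially" by real_asymp
  have f2: "filterlim (\<lambda>N. nat (int N - r)) sequentially sequentially" by real_asymp
  have "(\<lambda>N. box_prob ?c (z_present S) N * (U * (\<alpha> ^ nat (int N - t) * transfer ?c free t (nat (int N - t)) True True) /
     (\<alpha> ^ nat (int N - r) * transfer ?c free r (nat (int N - r)) True True))) \<longlonglongrightarrow>
     p * (U * perron \<alpha> True True / perron \<alpha> True True)"
    using perron_pos[OF \<alpha>, of True True]
    by (intro tendsto_intros transfer_free_tendsto_shift \<alpha> f1 f2 lim) simp
  also have "U * perron \<alpha> True True / perron \<alpha> True True = zigzag_density \<alpha> * (1 - \<alpha> ^ (2 * g))"
  proof -
    have "U = ?c * (perron \<alpha> True False * (1 - \<alpha> ^ (2 * g)))"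
      unfolding U_def transfer_free[OF \<alpha>] by (simp add: algebra_simps)
    also have "\<dots> = (?c * perron \<alpha> True False) * (1 - \<alpha> ^ (2 * g))" by simp
    also have "?c * perron \<alpha> True False = zigzag_density \<alpha>"
      using \<alpha> by (simp add: perron_def conductance_def divide_simps) (simp add: algebra_simps power2_eq_square)
    finally show ?thesis using perron_pos[OF \<alpha>, of True True] by simp
  qed
  finally show ?thesis unfolding g_def r_def
  proof (rule Lim_transform_eventually)
    define M where "M = Max (abs ` S)"
    have M: "\<bar>k\<bar> \<le> M" if "k \<in> S" for k using that S(1) by (simp add: M_def)
    show "\<forall>\<^sub>F N in sequentially. box_prob ?c (z_present S) N * (U * (\<alpha> ^ nat (int N - t) * transfer ?c free t (nat (int N - t)) True True) /
     (\<alpha> ^ nat (int N - Max S) * transfer ?c free (Max S) (nat (int N - Max S)) True True)) = box_prob ?c (z_present (insert t S)) N"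
      using eventually_gt_at_top[of "nat \<bar>t\<bar> + nat \<bar>M\<bar>"]
    proof eventually_elim
      case (elim N)
      have "S \<subseteq> {- int N<..<int N}"
      proof
        fix k assume "k \<in> S"
        from M[OF this] elim show "k \<in> {- int N<..<int N}" by auto
      qed
      moreover have tN: "t < int N" using elim by linarith
      ultimately have *: "box_prob ?c (z_present (insert t S)) N * transfer ?c free r (nat (int N - r)) True True =
        box_prob ?c (z_present S) N * (?c * transfer ?c free r g True False * transfer ?c free t (nat (int N - t)) True True)"
        unfolding g_def r_def by (intro box_prob_z_insert S t)
      have "0 < transfer ?c free r (nat (int N - r)) True True"
        by (rule transfer_free_pos[OF \<alpha>]) (use tN t in \<open>simp add: r_def\<close>)
      moreover have "\<alpha> ^ nat (int N - r) = \<alpha> ^ g * \<alpha> ^ nat (int N - t)"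
        unfolding power_add[symmetric] using tN t by (intro arg_cong[of _ _ "power \<alpha>"]) (simp add: g_def r_def)
      ultimately show ?case using * \<alpha> unfolding r_def[symmetric] U_def by (simp add: field_simps)
    qed
  qed
qed

section \<open>The limiting tree measure\<close>

lemma sets_Collect_finite_pattern:
  assumes "finite F" "\<And>e. e \<in> F \<Longrightarrow> {x \<in> space M. Q e x} \<in> sets M"
  shows "{x \<in> space M. {e \<in> F. Q e x} \<in> D} \<in> sets M"
proof -
  have "{x \<in> space M. {e \<in> F. Q e x} \<in> D} = (\<Union>s\<in>D \<inter> Pow F. {x \<in> space M. \<forall>e\<in>F. Q e x \<longleftrightarrow> e \<in> s})"
    (is "?L = ?R")
  proof
    show "?L \<subseteq> ?R"
    proof
      fix x assume "x \<in> ?L"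
      then show "x \<in> ?R" by (intro UN_I[of "{e \<in> F. Q e x}"]) auto
    qed
    show "?R \<subseteq> ?L"
    proof
      fix x assume "x \<in> ?R"
      then obtain s where s: "s \<in> D" "s \<subseteq> F" "x \<in> space M" "\<forall>e\<in>F. Q e x \<longleftrightarrow> e \<in> s" by blast
      then have "{e \<in> F. Q e x} = s" by blast
      with s show "x \<in> ?L" by simp
    qed
  qed
  also have "\<dots> \<in> sets M"
  proof (rule sets.finite_UN)
    fix s
    show "{x \<in> space M. \<forall>e\<in>F. Q e x \<longleftrightarrow> e \<in> s} \<in> sets M"
    proof (rule sets.sets_Collect_finite_All)
      fix e assume "e \<in> F"
      from assms(2)[OF this] show "{x \<in> space M. Q e x \<longleftrightarrow> e \<in> s} \<in> sets M"
        by (cases "e \<in> s") (auto intro: sets.sets_Collect_neg)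
    qed fact
  qed (use assms(1) in auto)
  finally show ?thesis .
qed

abbreviation trace_prob :: "'e set measure \<Rightarrow> 'e set \<Rightarrow> 'e set set \<Rightarrow> real" where
  "trace_prob \<mu> F D \<equiv> measure \<mu> {t \<in> space \<mu>. t \<inter> F \<in> D}"

text \<open>The limits of the finite-window probabilities are consistent, so they define a projective family, and
  Kolmogorov's extension theorem yields a measure. Since that theorem concerns functions with values in a
  Polish space, a subset of \<open>I\<close> is coded by its real-valued indicator function.\<close>

lemma exists_limit_of_random_sets:
  fixes \<mu> :: "nat \<Rightarrow> 'e set measure" and I :: "'e set"
  assumes prob: "\<And>n. prob_space (\<mu> n)" and sets: "\<And>n. sets (\<mu> n) = Pow (space (\<mu> n))"
    and conv: "\<And>F D. finite F \<Longrightarrow> F \<subseteq> I \<Longrightarrow>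
      convergent (\<lambda>n. trace_prob (\<mu> n) F D)"
  obtains \<nu> where "prob_space \<nu>"
    "sets \<nu> = sigma_sets (Pow I) ((\<lambda>e. {t. t \<subseteq> I \<and> e \<in> t}) ` I)"
    "\<And>F D. finite F \<Longrightarrow> F \<subseteq> I \<Longrightarrow> (\<lambda>n. trace_prob (\<mu> n) F D)
       \<longlonglongrightarrow> trace_prob \<nu> F D"
proof -
  interpret \<mu>: prob_space "\<mu> n" for n by (rule prob)
  define lim_prob where "lim_prob F D = lim (\<lambda>n. trace_prob (\<mu> n) F D)" for F D
  have lim_prob: "(\<lambda>n. trace_prob (\<mu> n) F D) \<longlonglongrightarrow> lim_prob F D" if "finite F" "F \<subseteq> I" for F D
    using conv[OF that] unfolding lim_prob_def convergent_LIMSEQ_iff .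
  have lim_prob_nonneg: "0 \<le> lim_prob F D" if "finite F" "F \<subseteq> I" for F D
    by (rule LIMSEQ_le_const[OF lim_prob[OF that]]) (simp add: exI[of _ 0])
  have lim_prob_sum: "lim_prob F D = (\<Sum>d\<in>D. lim_prob F {d})" if F: "finite F" "F \<subseteq> I" and D: "finite D" for F D
  proof (rule LIMSEQ_unique[OF lim_prob[OF F]])
    have "trace_prob (\<mu> n) F D = (\<Sum>d\<in>D. trace_prob (\<mu> n) F {d})" for n
    proof -
      have "{t \<in> space (\<mu> n). t \<inter> F \<in> D} = (\<Union>d\<in>D. {t \<in> space (\<mu> n). t \<inter> F \<in> {d}})" by auto
      moreover have "measure (\<mu> n) \<dots> = (\<Sum>d\<in>D. trace_prob (\<mu> n) F {d})"
        by (rule \<mu>.finite_measure_finite_Union) (use D sets in \<open>auto simp: disjoint_family_on_def\<close>)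
      ultimately show ?thesis by simp
    qed
    then show "(\<lambda>n. trace_prob (\<mu> n) F D) \<longlonglongrightarrow> (\<Sum>d\<in>D. lim_prob F {d})"
      by (simp only:) (intro tendsto_sum lim_prob F)
  qed
  have lim_prob_cong: "lim_prob F D = lim_prob F' D'" if "\<And>t. t \<inter> F \<in> D \<longleftrightarrow> t \<inter> F' \<in> D'" for F F' D D'
    unfolding lim_prob_def using that by simp
  \<comment> \<open>the limiting law of the trace on the finite window \<open>F\<close>\<close>
  define Q where "Q F = point_measure (Pow F) (\<lambda>d. ennreal (lim_prob F {d}))" for F
  have Q: "emeasure (Q F) D = ennreal (lim_prob F D)" if F: "finite F" "F \<subseteq> I" and D: "D \<subseteq> Pow F" for F D
  proof -
    have "emeasure (Q F) D = (\<Sum>d\<in>D. ennreal (lim_prob F {d}))"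
      unfolding Q_def using F D by (intro emeasure_point_measure_finite) auto
    also have "\<dots> = ennreal (\<Sum>d\<in>D. lim_prob F {d})"
      by (rule sum_ennreal) (use lim_prob_nonneg F in auto)
    also have "(\<Sum>d\<in>D. lim_prob F {d}) = lim_prob F D"
      by (rule lim_prob_sum[OF F, symmetric]) (use F D in \<open>auto intro: finite_subset\<close>)
    finally show ?thesis .
  qed
  have spQ [simp]: "space (Q F) = Pow F" "sets (Q F) = Pow (Pow F)" for F
    by (simp_all add: Q_def space_point_measure sets_point_measure)
  define ind where "ind J d = (\<lambda>e\<in>J. of_bool (e \<in> d) :: real)" for J and d :: "'e set"
  have ind: "ind J \<in> Q J \<rightarrow>\<^sub>M PiM J (\<lambda>_. borel)" for J
    unfolding Q_def by (auto simp: space_PiM ind_def)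
  define P where "P J = distr (Q J) (PiM J (\<lambda>_. borel)) (ind J)" for J
  have P: "emeasure (P J) A = ennreal (lim_prob J {d \<in> Pow J. ind J d \<in> A})"
    if "finite J" "J \<subseteq> I" "A \<in> sets (PiM J (\<lambda>_. borel))" for J A
  proof -
    have "emeasure (P J) A = emeasure (Q J) (ind J -` A \<inter> space (Q J))"
      unfolding P_def by (rule emeasure_distr[OF ind that(3)])
    also have "ind J -` A \<inter> space (Q J) = {d \<in> Pow J. ind J d \<in> A}" by auto
    also have "emeasure (Q J) \<dots> = ennreal (lim_prob J {d \<in> Pow J. ind J d \<in> A})"
      by (rule Q) (use that in auto)
    finally show ?thesis .
  qed
  interpret P: polish_projective I P
    unfolding polish_projective_def
  proof (rule projective_family.intro)
    fix J H assume JH: "J \<subseteq> H" "finite H" "H \<subseteq> I"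
    then have J: "finite J" "J \<subseteq> I" by (auto intro: finite_subset)
    have res: "(\<lambda>f. restrict f J) \<in> PiM H (\<lambda>_. borel) \<rightarrow>\<^sub>M (PiM J (\<lambda>_. borel) :: ('e \<Rightarrow> real) measure)"
      by (rule measurable_restrict_subset[OF JH(1)])
    show "P J = distr (P H) (PiM J (\<lambda>_. borel)) (\<lambda>f. restrict f J)"
    proof (rule measure_eqI)
      fix A assume "A \<in> sets (P J)"
      then have A: "A \<in> sets (PiM J (\<lambda>_. borel))" by (simp add: P_def)
      have "emeasure (distr (P H) (PiM J (\<lambda>_. borel)) (\<lambda>f. restrict f J)) A =
          emeasure (P H) ((\<lambda>f. restrict f J) -` A \<inter> space (P H))"
        by (rule emeasure_distr) (use res A in \<open>simp_all add: P_def\<close>)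
      also have "\<dots> = ennreal (lim_prob H {d \<in> Pow H. ind H d \<in> (\<lambda>f. restrict f J) -` A \<inter> space (P H)})"
        by (rule P) (use JH measurable_sets[OF res A] in \<open>simp_all add: P_def\<close>)
      also have "{d \<in> Pow H. ind H d \<in> (\<lambda>f. restrict f J) -` A \<inter> space (P H)} = {d \<in> Pow H. ind J (d \<inter> J) \<in> A}"
      proof -
        have "restrict (ind H d) J = ind J (d \<inter> J)" for d using JH(1) by (auto simp: ind_def fun_eq_iff)
        moreover have "ind H d \<in> space (P H)" for d by (auto simp: P_def ind_def space_PiM)
        ultimately show ?thesis by simp
      qed
      also have "lim_prob H {d \<in> Pow H. ind J (d \<inter> J) \<in> A} = lim_prob J {d \<in> Pow J. ind J d \<in> A}"
      proof (rule lim_prob_cong)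
        fix t
        have "t \<inter> H \<inter> J = t \<inter> J" using JH(1) by blast
        then show "t \<inter> H \<in> {d \<in> Pow H. ind J (d \<inter> J) \<in> A} \<longleftrightarrow> t \<inter> J \<in> {d \<in> Pow J. ind J d \<in> A}" by simp
      qed
      finally show "emeasure (P J) A = emeasure (distr (P H) (PiM J (\<lambda>_. borel)) (\<lambda>f. restrict f J)) A"
        by (rule trans[OF P[OF J A] sym])
    qed (simp add: P_def)
  next
    fix J assume J: "finite J" "J \<subseteq> I"
    have "(\<lambda>n. trace_prob (\<mu> n) J (Pow J)) = (\<lambda>n. 1)" by (simp add: \<mu>.prob_space)
    then have "lim_prob J (Pow J) = 1" using lim_prob[OF J, of "Pow J"] by (simp add: LIMSEQ_const_iff)
    then have "prob_space (Q J)" using J by (intro prob_spaceI) (simp add: Q)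
    then show "prob_space (P J)" unfolding P_def by (rule prob_space.prob_space_distr[OF _ ind])
  qed
  let ?\<Sigma> = "sigma (Pow I) ((\<lambda>e. {t. t \<subseteq> I \<and> e \<in> t}) ` I)"
  have sub: "(\<lambda>e. {t. t \<subseteq> I \<and> e \<in> t}) ` I \<subseteq> Pow (Pow I)" by auto
  \<comment> \<open>decoding of an indicator function; other functions have probability zero\<close>
  define supp where "supp f = {e \<in> I. f e = (1 :: real)}" for f
  have supp: "supp \<in> P.lim \<rightarrow>\<^sub>M ?\<Sigma>"
  proof (rule measurable_measure_of[OF sub])
    show "supp \<in> space P.lim \<rightarrow> Pow I" by (auto simp: supp_def)
    fix y assume "y \<in> (\<lambda>e. {t. t \<subseteq> I \<and> e \<in> t}) ` I"
    then obtain e where e: "e \<in> I" "y = {t. t \<subseteq> I \<and> e \<in> t}" by blast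
    then have "supp -` y \<inter> space P.lim = {f \<in> space (PiM I (\<lambda>_. borel)). f e = 1}" by (auto simp: supp_def)
    also have "\<dots> \<in> sets (PiM I (\<lambda>_. borel))" using e(1) by measurable
    finally show "supp -` y \<inter> space P.lim \<in> sets P.lim" by simp
  qed
  define \<nu> where "\<nu> = distr P.lim ?\<Sigma> supp"
  have sets_\<nu>: "sets \<nu> = sigma_sets (Pow I) ((\<lambda>e. {t. t \<subseteq> I \<and> e \<in> t}) ` I)"
    and space_\<nu>: "space \<nu> = Pow I"
    using sub by (simp_all add: \<nu>_def sets_measure_of space_measure_of_conv)
  show ?thesis
  proof (rule that)
    show "prob_space \<nu>" unfolding \<nu>_def by (rule P.P.prob_space_distr[OF supp])
    show "sets \<nu> = sigma_sets (Pow I) ((\<lambda>e. {t. t \<subseteq> I \<and> e \<in> t}) ` I)" by (rule sets_\<nu>)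
    fix F D assume F: "finite F" "F \<subseteq> I"
    let ?A = "{f \<in> space (PiM F (\<lambda>_. borel)). {e \<in> F. f e = (1::real)} \<in> D}"
    have A: "?A \<in> sets (PiM F (\<lambda>_. borel))"
    proof (rule sets_Collect_finite_pattern[OF F(1)])
      fix e assume "e \<in> F"
      then show "{x \<in> space (PiM F (\<lambda>_. borel)). x e = (1::real)} \<in> sets (PiM F (\<lambda>_. borel))"
        by measurable
    qed
    have int: "{t \<in> space \<nu>. t \<inter> F \<in> D} = {t \<in> space \<nu>. {e \<in> F. e \<in> t} \<in> D}"
      by (simp add: Int_def conj_commute)
    have "{t \<in> space \<nu>. t \<inter> F \<in> D} \<in> sets \<nu>"
      unfolding int
    proof (rule sets_Collect_finite_pattern[OF F(1)])
      fix e assume "e \<in> F"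
      with F have "{t \<in> space \<nu>. e \<in> t} \<in> (\<lambda>e. {t. t \<subseteq> I \<and> e \<in> t}) ` I" unfolding space_\<nu> by auto
      then show "{t \<in> space \<nu>. e \<in> t} \<in> sets \<nu>" unfolding sets_\<nu> by (rule sigma_sets.Basic)
    qed
    then have "trace_prob \<nu> F D = measure P.lim (supp -` {t \<in> space \<nu>. t \<inter> F \<in> D} \<inter> space P.lim)"
      unfolding \<nu>_def by (intro measure_distr[OF supp]) simp
    also have "supp -` {t \<in> space \<nu>. t \<inter> F \<in> D} \<inter> space P.lim = P.emb I F ?A"
    proof -
      have "supp f \<inter> F = {e \<in> F. f e = 1}" "restrict f F \<in> space (PiM F (\<lambda>_. borel))"
        "{e \<in> F. restrict f F e = 1} = {e \<in> F. f e = 1}" for f :: "'e \<Rightarrow> real"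
        using F(2) by (auto simp: supp_def space_PiM)
      then show ?thesis by (auto simp: prod_emb_def space_\<nu> space_PiM supp_def)
    qed
    also have "measure P.lim \<dots> = measure (P F) ?A"
      by (rule P.measure_lim_emb[OF F(2,1) A])
    also have "\<dots> = lim_prob F {d \<in> Pow F. ind F d \<in> ?A}"
      using P[OF F A] lim_prob_nonneg[OF F] by (simp add: measure_def)
    also have "\<dots> = lim_prob F D"
    proof (rule lim_prob_cong)
      fix t
      have "ind F (t \<inter> F) \<in> space (PiM F (\<lambda>_. borel))" by (auto simp: ind_def space_PiM)
      moreover have "{e \<in> F. ind F (t \<inter> F) e = 1} = t \<inter> F" by (auto simp: ind_def)
      ultimately show "t \<inter> F \<in> {d \<in> Pow F. ind F d \<in> ?A} \<longleftrightarrow> t \<inter> F \<in> D" by simp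
    qed
    finally show "(\<lambda>n. trace_prob (\<mu> n) F D) \<longlonglongrightarrow> trace_prob \<nu> F D"
      using lim_prob[OF F] by simp
  qed
qed

lemma edge_config_space_generators:
  "(\<lambda>e. {t. t \<subseteq> zigzag_edges \<and> e \<in> t}) ` zigzag_edges \<subseteq> Pow (Pow zigzag_edges)"
  by auto

lemma space_edge_config_space [simp]: "space edge_config_space = Pow zigzag_edges"
  by (simp add: edge_config_space_def space_measure_of[OF edge_config_space_generators])

lemma sets_edge_config_space:
  "sets edge_config_space = sigma_sets (Pow zigzag_edges) ((\<lambda>e. {t. t \<subseteq> zigzag_edges \<and> e \<in> t}) ` zigzag_edges)"
  by (simp add: edge_config_space_def sets_measure_of[OF edge_config_space_generators])

lemma is_tree_limit_unique:
  assumes \<mu>: "is_tree_limit c \<mu>" and \<nu>: "is_tree_limit c \<nu>"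
  shows "\<mu> = \<nu>"
proof (rule measure_eqI_cylinders[where I = zigzag_edges and \<Omega> = "Pow zigzag_edges"
      and S = "\<lambda>e. {t. t \<subseteq> zigzag_edges \<and> e \<in> t}"])
  show "prob_space \<mu>" "prob_space \<nu>" using \<mu> \<nu> by (simp_all add: is_tree_limit_def)
  let ?G = "sigma_sets (Pow zigzag_edges) ((\<lambda>e. {t. t \<subseteq> zigzag_edges \<and> e \<in> t}) ` zigzag_edges)"
  show "sets \<mu> = ?G" "sets \<nu> = ?G"
    using \<mu> \<nu> by (simp_all add: is_tree_limit_def sets_edge_config_space)
  fix F assume F: "finite F" "F \<subseteq> zigzag_edges"
  have "{t \<in> Pow zigzag_edges. \<forall>e\<in>F. t \<in> {t. t \<subseteq> zigzag_edges \<and> e \<in> t}} = {t \<in> Pow zigzag_edges. t \<inter> F \<in> {F}}"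
    by auto
  moreover have "measure \<mu> {t \<in> Pow zigzag_edges. t \<inter> F \<in> {F}} = measure \<nu> {t \<in> Pow zigzag_edges. t \<inter> F \<in> {F}}"
  proof (rule LIMSEQ_unique)
    have lim: "(\<lambda>n. trace_prob (box_tree_measure c n) F {F})
        \<longlonglongrightarrow> measure \<kappa> {t \<in> Pow zigzag_edges. t \<inter> F \<in> {F}}" if \<kappa>: "is_tree_limit c \<kappa>" for \<kappa>
    proof -
      have sp: "space \<kappa> = Pow zigzag_edges" using \<kappa> by (simp add: is_tree_limit_def)
      have "finite F \<and> F \<subseteq> zigzag_edges \<and> {F} \<subseteq> Pow F" using F by simp
      with \<kappa> show ?thesis unfolding is_tree_limit_def sp[symmetric] by blast
    qed
    show "(\<lambda>n. trace_prob (box_tree_measure c n) F {F})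
        \<longlonglongrightarrow> measure \<mu> {t \<in> Pow zigzag_edges. t \<inter> F \<in> {F}}" by (rule lim[OF \<mu>])
    show "(\<lambda>n. trace_prob (box_tree_measure c n) F {F})
        \<longlonglongrightarrow> measure \<nu> {t \<in> Pow zigzag_edges. t \<inter> F \<in> {F}}" by (rule lim[OF \<nu>])
  qed
  ultimately show "measure \<mu> {t \<in> Pow zigzag_edges. \<forall>e\<in>F. t \<in> {t. t \<subseteq> zigzag_edges \<and> e \<in> t}} =
      measure \<nu> {t \<in> Pow zigzag_edges. \<forall>e\<in>F. t \<in> {t. t \<subseteq> zigzag_edges \<and> e \<in> t}}" by simp
qed auto

text \<open>With \<open>is_tree_limit_unique\<close>, the definite description in \<open>tree_measure\<close> denotes the limit. The sequence
  of boxes starts at radius 1, since a box with a single vertex contains no edge for the automaton to read.\<close>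

lemma is_tree_limit_tree_measure:
  assumes \<alpha>: "0 < \<alpha>" "\<alpha> < 1"
  shows "is_tree_limit (conductance \<alpha>) (tree_measure (conductance \<alpha>))"
proof -
  let ?c = "conductance \<alpha>"
  obtain \<nu> where \<nu>: "prob_space \<nu>"
    "sets \<nu> = sigma_sets (Pow zigzag_edges) ((\<lambda>e. {t. t \<subseteq> zigzag_edges \<and> e \<in> t}) ` zigzag_edges)"
    "\<And>F D. finite F \<Longrightarrow> F \<subseteq> zigzag_edges \<Longrightarrow>
      (\<lambda>n. trace_prob (box_tree_measure ?c (Suc n)) F D)
       \<longlonglongrightarrow> trace_prob \<nu> F D"
  proof (rule exists_limit_of_random_sets[where \<mu> = "\<lambda>n. box_tree_measure ?c (Suc n)" and I = zigzag_edges])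
    show "prob_space (box_tree_measure ?c (Suc n))" for n by (rule prob_space_box_tree_measure[OF \<alpha>]) simp
    show "convergent (\<lambda>n. trace_prob (box_tree_measure ?c (Suc n)) F D)"
      if "finite F" "F \<subseteq> zigzag_edges" for F D
      using convergent_box_tree_measure[OF \<alpha> that] by simp
  qed auto
  have "is_tree_limit ?c \<nu>"
    unfolding is_tree_limit_def
  proof (intro conjI allI impI)
    show "sets \<nu> = sets edge_config_space" by (simp add: \<nu>(2) sets_edge_config_space)
    then show "space \<nu> = space edge_config_space" by (rule sets_eq_imp_space_eq)
    show "(\<lambda>n. trace_prob (box_tree_measure ?c n) F D)
        \<longlonglongrightarrow> trace_prob \<nu> F D"
      if "finite F \<and> F \<subseteq> zigzag_edges \<and> D \<subseteq> Pow F" for F D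
      by (rule LIMSEQ_imp_Suc) (use \<nu>(3)[of F D] that in simp)
  qed (rule \<nu>(1))
  then show ?thesis unfolding tree_measure_def by (rule theI) (rule is_tree_limit_unique[OF _ \<open>is_tree_limit ?c \<nu>\<close>])
qed

lemma z_edge_in_zigzag_edges [simp]: "z_edge k \<in> zigzag_edges"
  by (simp add: zigzag_edges_def)

abbreviation z_edges_prob :: "real \<Rightarrow> int set \<Rightarrow> real" where
  "z_edges_prob \<alpha> S \<equiv> measure (tree_measure (conductance \<alpha>)) {t \<in> Pow zigzag_edges. \<forall>s\<in>S. z_edge s \<in> t}"

lemma tree_measure_z_edges:
  assumes \<alpha>: "0 < \<alpha>" "\<alpha> < 1" and S: "finite S"
  shows "box_prob (conductance \<alpha>) (z_present S) \<longlonglongrightarrow>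
    z_edges_prob \<alpha> S"
proof -
  let ?c = "conductance \<alpha>" and ?F = "z_edge ` S"
  have c: "0 \<le> ?c" using conductance_pos[OF \<alpha>] by simp
  have F: "finite ?F" "?F \<subseteq> zigzag_edges" "{?F} \<subseteq> Pow ?F" using S by auto
  have "(\<lambda>n. trace_prob (box_tree_measure ?c n) ?F {?F})
      \<longlonglongrightarrow> trace_prob (tree_measure ?c) ?F {?F}"
    using is_tree_limit_tree_measure[OF \<alpha>] F unfolding is_tree_limit_def by blast
  moreover have "space (tree_measure ?c) = Pow zigzag_edges"
    using is_tree_limit_tree_measure[OF \<alpha>] unfolding is_tree_limit_def by simp
  moreover have "t \<inter> ?F \<in> {?F} \<longleftrightarrow> (\<forall>s\<in>S. z_edge s \<in> t)" for t by auto
  ultimately have lim: "(\<lambda>n. measure (box_tree_measure ?c n) {t \<in> box_trees n. \<forall>s\<in>S. z_edge s \<in> t})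
      \<longlonglongrightarrow> measure (tree_measure ?c) {t \<in> Pow zigzag_edges. \<forall>s\<in>S. z_edge s \<in> t}" by simp
  define m where "m = Max (insert 0 (abs ` S))"
  have m: "\<bar>s\<bar> \<le> m" if "s \<in> S" for s using that S by (simp add: m_def)
  have "0 \<le> m" using S by (simp add: m_def)
  show ?thesis
  proof (rule Lim_transform_eventually[OF lim])
    show "\<forall>\<^sub>F N in sequentially. measure (box_tree_measure ?c N) {t \<in> box_trees N. \<forall>s\<in>S. z_edge s \<in> t} =
        box_prob ?c (z_present S) N"
      using eventually_gt_at_top[of "nat m"]
    proof eventually_elim
      case (elim N)
      have "s \<in> {- int N<..int N}" if "s \<in> S" for s using m[OF that] elim by auto
      then have "{t \<in> box_trees N. \<forall>s\<in>S. z_edge s \<in> t} =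
        {t \<in> box_trees N. \<forall>k\<in>{- int N<..int N}. z_present S k (z_edge k \<in> t) (h_edge k \<in> t)}"
        unfolding z_present_def by blast
      then show ?case
        using measure_box_tree_measure_eq_box_prob[OF c, of N "z_present S"] elim by (simp add: z_present_def)
    qed
  qed
qed

lemma gap_product_tree_measure:
  assumes \<alpha>: "0 < \<alpha>" "\<alpha> < 1"
  shows "gap_product (z_edges_prob \<alpha>)
    (zigzag_density \<alpha>) (geometric_gaps (zigzag_density \<alpha>) \<alpha>)"
  unfolding gap_product_def
proof (intro conjI allI impI)
  fix t
  show "z_edges_prob \<alpha> {t} = zigzag_density \<alpha>"
    by (rule LIMSEQ_unique[OF tree_measure_z_edges[OF \<alpha>] box_prob_z_singleton_tendsto[OF \<alpha>]]) simp
  fix S :: "int set" assume S: "finite S" "S \<noteq> {}" "Max S < t"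
  show "z_edges_prob \<alpha> (insert t S) =
    z_edges_prob \<alpha> S *
      (zigzag_density \<alpha> * (1 - \<alpha> ^ (2 * nat (t - Max S))))"
    by (rule LIMSEQ_unique[OF tree_measure_z_edges[OF \<alpha>] box_prob_z_insert_tendsto[OF \<alpha> S tree_measure_z_edges[OF \<alpha> S(1)]]])
      (use S in simp)
qed

lemma bit_process_zigzag_process:
  assumes "prob_space M" "\<alpha> \<noteq> 0 \<Longrightarrow> T \<in> M \<rightarrow>\<^sub>M edge_config_space"
  shows "bit_process M (zigzag_process \<alpha> T)"
  unfolding bit_process_def
proof (intro conjI allI assms(1))
  fix m
  show "zigzag_process \<alpha> T m \<in> M \<rightarrow>\<^sub>M count_space UNIV"
  proof (cases "\<alpha> = 0")
    case False
    have "{t \<in> space edge_config_space. z_edge m \<in> t} \<in> sets edge_config_space"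
      unfolding sets_edge_config_space by (intro sigma_sets.Basic image_eqI[of _ _ "z_edge m"]) auto
    then have "Measurable.pred edge_config_space (\<lambda>t. z_edge m \<in> t)" by (simp add: pred_def)
    from measurable_compose[OF assms(2)[OF False] this] show ?thesis
      using False by (simp add: zigzag_process_def[abs_def])
  qed (simp add: zigzag_process_def[abs_def])
qed

lemma gap_product_zigzag_process:
  assumes \<alpha>: "0 \<le> \<alpha>" "\<alpha> < 1" and M: "prob_space M"
    and T: "\<alpha> \<noteq> 0 \<Longrightarrow> T \<in> M \<rightarrow>\<^sub>M edge_config_space"
      "\<alpha> \<noteq> 0 \<Longrightarrow> distr M edge_config_space T = tree_measure (conductance \<alpha>)"
  shows "gap_product (all_ones M (zigzag_process \<alpha> T))
    (zigzag_density \<alpha>) (geometric_gaps (zigzag_density \<alpha>) \<alpha>)"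
proof (cases "\<alpha> = 0")
  case True
  interpret prob_space M by (rule M)
  have "all_ones M (zigzag_process \<alpha> T) S = 1" for S
    using True by (simp add: all_ones_def zigzag_process_def prob_space)
  moreover have "(0::real) ^ (2 * nat (t - Max S)) = 0" if "Max S < t" for t and S :: "int set"
    using that by (simp add: power_0_left)
  ultimately show ?thesis using True by (simp add: gap_product_def)
next
  case False
  have "all_ones M (zigzag_process \<alpha> T) S =
      z_edges_prob \<alpha> S" if S: "finite S" for S
  proof -
    have "{t \<in> space edge_config_space. \<forall>s\<in>S. z_edge s \<in> t} \<in> sets edge_config_space"
    proof (rule sets.sets_Collect_finite_All[OF _ S])
      fix s
      show "{t \<in> space edge_config_space. z_edge s \<in> t} \<in> sets edge_config_space"
        unfolding sets_edge_config_space by (intro sigma_sets.Basic image_eqI[of _ _ "z_edge s"]) auto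
    qed
    then have "measure (distr M edge_config_space T) {t \<in> Pow zigzag_edges. \<forall>s\<in>S. z_edge s \<in> t} =
      measure M (T -` {t \<in> Pow zigzag_edges. \<forall>s\<in>S. z_edge s \<in> t} \<inter> space M)"
      by (intro measure_distr T(1)[OF False]) simp
    also have "T -` {t \<in> Pow zigzag_edges. \<forall>s\<in>S. z_edge s \<in> t} \<inter> space M = {\<omega> \<in> space M. \<forall>s\<in>S. zigzag_process \<alpha> T s \<omega>}"
      using measurable_space[OF T(1)[OF False]] False by (auto simp: zigzag_process_def)
    finally show ?thesis by (simp add: all_ones_def T(2)[OF False])
  qed
  then show ?thesis
    using gap_product_tree_measure[of \<alpha>] \<alpha> False unfolding gap_product_def by simp
qed

section \<open>The geometric kernel and the Poisson kernel\<close>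

lemma sorted_list_of_set_insert_max:
  fixes S :: "int set"
  assumes "finite S" "\<And>s. s \<in> S \<Longrightarrow> s < t"
  shows "sorted_list_of_set (insert t S) = sorted_list_of_set S @ [t]"
proof -
  have "sorted_list_of_set S @ [t] = sorted_list_of_set (set (sorted_list_of_set S @ [t]))"
    by (rule sorted_list_of_set.idem_if_sorted_distinct[symmetric])
      (use assms in \<open>auto simp: sorted_append intro: less_imp_le\<close>)
  then show ?thesis using assms(1) by simp
qed

definition geometric_kernel :: "real \<Rightarrow> real \<Rightarrow> int \<Rightarrow> int \<Rightarrow> complex" where
  "geometric_kernel \<kappa> \<alpha> k l = complex_of_real (\<kappa> * \<alpha> ^ nat \<bar>l - k\<bar>)"

text \<open>Subtracting \<open>\<alpha>^g\<close> times the column of \<open>Max S\<close>, where \<open>g = t - Max S\<close>, from the new last column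
  annihilates all its entries but the lowest one, as \<open>\<alpha>^(t - s) = \<alpha>^g \<alpha>^(Max S - s)\<close>.\<close>

lemma principal_minor_geometric_insert:
  assumes S: "finite S" "S \<noteq> {}" and t: "\<And>s. s \<in> S \<Longrightarrow> s < t"
  shows "principal_minor (geometric_kernel \<kappa> \<alpha>) (insert t S) =
    principal_minor (geometric_kernel \<kappa> \<alpha>) S * complex_of_real (\<kappa> * (1 - \<alpha> ^ (2 * nat (t - Max S))))"
proof -
  define s where "s = sorted_list_of_set S"
  define n where "n = card S"
  define r where "r = Max S"
  define g where "g = nat (t - r)"
  let ?K = "geometric_kernel \<kappa> \<alpha>"
  have len: "length s = n" by (simp add: s_def n_def)
  have n0: "0 < n" using S by (simp add: n_def card_gt_0_iff)
  have s': "sorted_list_of_set (insert t S) = s @ [t]"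
    unfolding s_def by (rule sorted_list_of_set_insert_max) (use S t in auto)
  have "t \<notin> S" using t by blast
  then have card': "card (insert t S) = Suc n" using S by (simp add: n_def)
  have sr: "s ! i \<in> S" "s ! i \<le> r" if "i < n" for i
  proof -
    show "s ! i \<in> S" using that len S(1) nth_mem[of i s] by (simp add: s_def)
    then show "s ! i \<le> r" using S(1) by (simp add: r_def)
  qed
  have last: "s ! (n - 1) = r"
  proof (rule antisym)
    have "r \<in> set s" using S Max_in[OF S] by (simp add: s_def r_def)
    then obtain i where i: "i < n" "s ! i = r" by (auto simp: in_set_conv_nth len)
    have "s ! i \<le> s ! (n - 1)"
      by (rule sorted_nth_mono) (use i len in \<open>auto simp: s_def\<close>)
    then show "r \<le> s ! (n - 1)" using i by simp
    show "s ! (n - 1) \<le> r" using sr(2)[of "n - 1"] n0 by simp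
  qed
  have rt: "r < t" using t Max_in[OF S] by (simp add: r_def)
  define M where "M = Matrix.mat (Suc n) (Suc n) (\<lambda>(i, j). ?K ((s @ [t]) ! i) ((s @ [t]) ! j))"
  define M' where "M' = addcol (- complex_of_real (\<alpha> ^ g)) n (n - 1) M"
  have M: "M \<in> carrier_mat (Suc n) (Suc n)" by (simp add: M_def)
  have M': "M' \<in> carrier_mat (Suc n) (Suc n)" by (intro carrier_matI) (simp_all add: M'_def M_def)
  have "principal_minor ?K (insert t S) = Determinant.det M"
    unfolding principal_minor_def s' card' Let_def M_def ..
  also have "\<dots> = Determinant.det M'"
    unfolding M'_def by (rule det_addcol[symmetric, OF _ _ M]) (use n0 in auto)
  also have "\<dots> = (\<Sum>i<Suc n. M' $$ (i, n) * cofactor M' i n)"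
    by (rule laplace_expansion_column[OF M']) simp
  also have "\<dots> = M' $$ (n, n) * cofactor M' n n"
  proof -
    have "M' $$ (i, n) = 0" if "i < n" for i
    proof -
      have "nat \<bar>t - s ! i\<bar> = g + nat \<bar>r - s ! i\<bar>" using sr[OF that] rt by (auto simp: g_def)
      then show ?thesis
        using that n0 by (simp add: M'_def M_def nth_append len last[unfolded One_nat_def] geometric_kernel_def power_add)
    qed
    then show ?thesis by simp
  qed
  also have "M' $$ (n, n) = complex_of_real (\<kappa> * (1 - \<alpha> ^ (2 * g)))"
  proof -
    have "nat \<bar>r - t\<bar> = g" using rt by (auto simp: g_def)
    moreover have "\<alpha> ^ (2 * g) = \<alpha> ^ g * \<alpha> ^ g" by (simp add: mult_2 power_add)
    ultimately show ?thesis
      using n0 by (simp add: M'_def M_def nth_append len last[unfolded One_nat_def] geometric_kernel_def algebra_simps)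
  qed
  also have "cofactor M' n n = principal_minor ?K S"
  proof -
    have "mat_delete M' n n = Matrix.mat n n (\<lambda>(i, j). ?K (s ! i) (s ! j))"
      using n0 by (intro eq_matI) (auto simp: mat_delete_def M'_def M_def nth_append len)
    then show ?thesis by (simp add: cofactor_def principal_minor_def Let_def s_def n_def)
  qed
  finally show ?thesis by (simp add: g_def r_def mult.commute)
qed

lemma principal_minor_empty: "principal_minor A {} = 1"
  by (simp add: principal_minor_def)

lemma principal_minor_singleton: "principal_minor A {t} = A t t"
  by (simp add: principal_minor_def det_single)

lemma determinantal_if_gap_product:
  assumes X: "bit_process M X"
    and P: "gap_product (all_ones M X) \<kappa> (geometric_gaps \<kappa> \<alpha>)"
  shows "determinantal M X (geometric_kernel \<kappa> \<alpha>)"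
  unfolding determinantal_def
proof (intro conjI allI impI X)
  show "geometric_kernel \<kappa> \<alpha> l k = cnj (geometric_kernel \<kappa> \<alpha> k l)" for k l
    by (simp add: geometric_kernel_def abs_minus_commute)
  interpret prob_space M using X by (simp add: bit_process_def)
  fix S :: "int set" assume "finite S"
  then have "complex_of_real (all_ones M X S) = principal_minor (geometric_kernel \<kappa> \<alpha>) S"
  proof (induction S rule: finite_linorder_max_induct)
    case empty
    show ?case by (simp add: all_ones_def principal_minor_empty prob_space)
  next
    case (insert t S)
    show ?case
    proof (cases "S = {}")
      case True
      then show ?thesis
        using P by (simp add: gap_product_def principal_minor_singleton geometric_kernel_def)
    next
      case False
      then show ?thesis
        using insert gap_product_insert[OF P, of S t] principal_minor_geometric_insert[of S t \<kappa> \<alpha>] by simp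
    qed
  qed
  then show "complex_of_real \<P>(\<omega> in M. \<forall>s\<in>S. X s \<omega>) = principal_minor (geometric_kernel \<kappa> \<alpha>) S"
    by (simp add: all_ones_def)
qed

text \<open>The solutions are spanned by \<open>\<alpha>^k\<close> and \<open>\<alpha>^(-k)\<close>, and only the first is bounded. The combination \<open>d\<close> below
  kills the first and grows by the factor \<open>1 / \<alpha>\<close> in each step, so boundedness forces it to vanish.\<close>

lemma bounded_recurrence_geometric:
  fixes a :: "nat \<Rightarrow> complex"
  assumes \<alpha>: "0 < \<alpha>" "\<alpha> < 1" and bound: "\<And>k. norm (a k) \<le> B"
    and rec: "\<And>k. complex_of_real (\<alpha> + 1 / \<alpha>) * a (Suc k) = a (Suc (Suc k)) + a k"
  shows "a k = complex_of_real (\<alpha> ^ k) * a 0"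
proof -
  define d where "d k = a (Suc k) - complex_of_real \<alpha> * a k" for k
  have d_Suc: "d k = complex_of_real \<alpha> * d (Suc k)" for k
  proof -
    have "complex_of_real \<alpha> * a (Suc (Suc k)) = complex_of_real \<alpha> * (complex_of_real (\<alpha> + 1 / \<alpha>) * a (Suc k) - a k)"
      unfolding rec by simp
    also have "\<dots> = complex_of_real (\<alpha> * \<alpha> + 1) * a (Suc k) - complex_of_real \<alpha> * a k"
      using \<alpha> by (simp add: field_simps)
    finally show ?thesis by (simp add: d_def algebra_simps)
  qed
  have d_pow: "d m = complex_of_real (\<alpha> ^ k) * d (m + k)" for k m
  proof (induction k)
    case (Suc k)
    then show ?case using d_Suc[of "m + k"] by (simp add: algebra_simps)
  qed simp
  have dB: "norm (d k) \<le> 2 * B" for k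
  proof -
    have "norm (d k) \<le> norm (a (Suc k)) + \<bar>\<alpha>\<bar> * norm (a k)"
      unfolding d_def using norm_triangle_ineq4[of "a (Suc k)" "complex_of_real \<alpha> * a k"] by (simp add: norm_mult)
    also have "\<bar>\<alpha>\<bar> * norm (a k) \<le> 1 * norm (a k)" using \<alpha> by (intro mult_right_mono) auto
    finally show ?thesis using bound[of k] bound[of "Suc k"] by simp
  qed
  have d0: "d m = 0" for m
  proof -
    have "(\<lambda>k. \<alpha> ^ k * (2 * B)) \<longlonglongrightarrow> 0 * (2 * B)"
      using \<alpha> by (intro tendsto_mult LIMSEQ_realpow_zero tendsto_const) auto
    moreover have "norm (d m) \<le> \<alpha> ^ k * (2 * B)" for k
    proof -
      have "norm (d m) = \<alpha> ^ k * norm (d (m + k))" using d_pow[of m k] \<alpha> by (simp add: norm_mult norm_power)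
      also have "\<dots> \<le> \<alpha> ^ k * (2 * B)" using \<alpha> dB by (intro mult_left_mono) auto
      finally show ?thesis .
    qed
    ultimately have "norm (d m) \<le> 0 * (2 * B)" by (intro LIMSEQ_le_const) auto
    then show ?thesis by simp
  qed
  show ?thesis
  proof (induction k)
    case (Suc k)
    then show ?case using d0[of k] by (simp add: d_def)
  qed simp
qed

lemma fourier_coeff_eq_integral:
  assumes "continuous_on {0..1} f"
  shows "fourier_coeff f k =
    integral {0..1} (\<lambda>x. complex_of_real (f x) * exp (- 2 * pi * \<i> * of_int k * x))"
  unfolding fourier_coeff_def
  by (rule set_lebesgue_integral_eq_integral(2)[OF absolutely_integrable_continuous_real])
    (intro continuous_intros assms)

lemma integral_character:
  "integral {0..1} (\<lambda>x. exp (- 2 * pi * \<i> * of_int k * complex_of_real x)) = of_bool (k = 0)"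
proof (cases "k = 0")
  case False
  define w where "w = - 2 * pi * \<i> * of_int k"
  have w: "w \<noteq> 0" using False by (simp add: w_def)
  have "exp w = 1" using exp_integer_2pi[of "of_int (- k)"] by (simp add: w_def mult_ac)
  moreover have "((\<lambda>x. exp (w * complex_of_real x)) has_integral (exp (w * of_real 1) / w - exp (w * of_real 0) / w)) {0..1}"
  proof (rule fundamental_theorem_of_calculus)
    fix x :: real
    have "((\<lambda>z. exp (w * z) / w) has_field_derivative exp (w * of_real x)) (at (of_real x))"
      using w by (auto intro!: derivative_eq_intros)
    then have "((\<lambda>x. exp (w * of_real x) / w) has_vector_derivative exp (w * of_real x)) (at x)"
      by (rule has_vector_derivative_real_field)
    then show "((\<lambda>x. exp (w * of_real x) / w) has_vector_derivative exp (w * of_real x)) (at x within {0..1})"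
      by (rule has_vector_derivative_at_within)
  qed simp
  ultimately show ?thesis using False by (simp add: w_def integral_unique)
qed simp

text \<open>For \<open>c = conductance \<alpha>\<close> this is \<open>zigzag_density \<alpha>\<close> times the Poisson kernel of radius \<open>\<alpha>\<close>.\<close>

definition poisson_kernel :: "real \<Rightarrow> real \<Rightarrow> real" where
  "poisson_kernel c x = c / (c + 2 - 2 * cos (2 * pi * x))"

lemma poisson_kernel_bounds:
  assumes "0 < c"
  shows "0 < c + 2 - 2 * cos (2 * pi * x)" "0 \<le> poisson_kernel c x" "poisson_kernel c x \<le> 1"
proof -
  have "c \<le> c + 2 - 2 * cos (2 * pi * x)" using cos_le_one[of "2 * pi * x"] by linarith
  moreover from this assms show "0 < c + 2 - 2 * cos (2 * pi * x)" by linarith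
  ultimately show "0 \<le> poisson_kernel c x" "poisson_kernel c x \<le> 1"
    unfolding poisson_kernel_def using assms by (simp_all del: diff_gt_0_iff_gt)
qed

lemma continuous_on_poisson_kernel: "0 < c \<Longrightarrow> continuous_on S (poisson_kernel c)"
  unfolding poisson_kernel_def
  by (intro continuous_intros ballI less_imp_neq[THEN not_sym] poisson_kernel_bounds)

text \<open>Multiplication by \<open>2 cos (2 \<pi> x)\<close> adds the two neighbouring modes, so clearing the denominator gives a
  recurrence for the coefficients.\<close>

lemma fourier_coeff_poisson_kernel_rec:
  assumes c: "0 < c"
  shows "complex_of_real (c + 2) * fourier_coeff (poisson_kernel c) k =
    fourier_coeff (poisson_kernel c) (k + 1) + fourier_coeff (poisson_kernel c) (k - 1) + complex_of_real c * of_bool (k = 0)"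
proof -
  define e where "e k x = exp (- 2 * pi * \<i> * of_int k * complex_of_real x)" for k :: int and x :: real
  let ?f = "\<lambda>x. complex_of_real (poisson_kernel c x)"
  have J: "fourier_coeff (poisson_kernel c) k = integral {0..1} (\<lambda>x. ?f x * e k x)" for k
    unfolding e_def by (rule fourier_coeff_eq_integral[OF continuous_on_poisson_kernel[OF c]])
  have int: "(\<lambda>x. ?f x * e k x) integrable_on {0..1}" "(\<lambda>x. complex_of_real c * e k x) integrable_on {0..1}" for k
    unfolding e_def by (intro integrable_continuous_interval continuous_intros continuous_on_poisson_kernel c)+
  have "complex_of_real (c + 2) * (?f x * e k x) = ?f x * e (k + 1) x + ?f x * e (k - 1) x + complex_of_real c * e k x" for x
  proof -
    define E where "E = exp (2 * pi * \<i> * complex_of_real x)"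
    have e1: "e (k - 1) x = e k x * E" "e (k + 1) x = e k x * exp (- (2 * pi * \<i> * complex_of_real x))"
      by (simp_all add: e_def E_def exp_add[symmetric] algebra_simps)
    have "E + exp (- (2 * pi * \<i> * complex_of_real x)) = 2 * cos (complex_of_real (2 * pi * x))"
      by (simp add: cos_exp_eq E_def mult_ac)
    also have "\<dots> = complex_of_real (2 * cos (2 * pi * x))" by (simp flip: cos_of_real)
    finally have E: "e (k + 1) x + e (k - 1) x = e k x * complex_of_real (2 * cos (2 * pi * x))"
      unfolding e1 distrib_left[symmetric] by (simp add: add.commute)
    have "poisson_kernel c x * (c + 2 - 2 * cos (2 * pi * x)) = c"
      using poisson_kernel_bounds(1)[OF c, of x] by (simp add: poisson_kernel_def)
    then have "?f x * complex_of_real (c + 2 - 2 * cos (2 * pi * x)) = complex_of_real c"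
      by (metis of_real_mult)
    then have "?f x * complex_of_real (c + 2 - 2 * cos (2 * pi * x)) * e k x = complex_of_real c * e k x" by simp
    moreover have "?f x * e (k + 1) x + ?f x * e (k - 1) x = ?f x * (e k x * complex_of_real (2 * cos (2 * pi * x)))"
      unfolding E[symmetric] by (simp add: distrib_left)
    ultimately show ?thesis by (simp add: algebra_simps)
  qed
  then have "integral {0..1} (\<lambda>x. complex_of_real (c + 2) * (?f x * e k x)) =
      integral {0..1} (\<lambda>x. ?f x * e (k + 1) x + ?f x * e (k - 1) x + complex_of_real c * e k x)" by simp
  also have "\<dots> = integral {0..1} (\<lambda>x. ?f x * e (k + 1) x) + integral {0..1} (\<lambda>x. ?f x * e (k - 1) x)
      + complex_of_real c * integral {0..1} (e k)"
    by (simp only: integral_add[OF integrable_add[OF int(1) int(1)] int(2)] integral_add[OF int(1) int(1)]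
        integral_mult_right)
  also have "integral {0..1} (e k) = of_bool (k = 0)"
    unfolding e_def[abs_def] by (rule integral_character)
  finally show ?thesis unfolding J by (simp only: integral_mult_right)
qed

text \<open>The coefficients are bounded and satisfy the recurrence on both half-lines, hence they are geometric; the
  equation at \<open>k = 0\<close> fixes the constant.\<close>

lemma fourier_coeff_poisson_kernel:
  assumes \<alpha>: "0 < \<alpha>" "\<alpha> < 1"
  shows "fourier_coeff (poisson_kernel (conductance \<alpha>)) k =
    complex_of_real (zigzag_density \<alpha> * \<alpha> ^ nat \<bar>k\<bar>)"
proof -
  let ?c = "conductance \<alpha>"
  define J where "J k = fourier_coeff (poisson_kernel ?c) k" for k
  have c: "0 < ?c" using \<alpha> by (simp add: conductance_def)
  have c2: "?c + 2 = \<alpha> + 1 / \<alpha>" using \<alpha> by (simp add: conductance_def power2_eq_square field_simps)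
  note rec = fourier_coeff_poisson_kernel_rec[OF c, folded J_def]
  have bound: "norm (J k) \<le> 1" for k
  proof -
    have "norm (integral {0..1} (\<lambda>x. complex_of_real (poisson_kernel ?c x) * exp (- 2 * pi * \<i> * of_int k * x))) \<le> 1 * (1 - 0)"
    proof (rule integral_bound)
      fix t :: real
      show "norm (complex_of_real (poisson_kernel ?c t) * exp (- 2 * pi * \<i> * of_int k * t)) \<le> 1"
        using poisson_kernel_bounds(2,3)[OF c, of t] by (simp add: norm_mult norm_exp_eq_Re)
    qed (auto intro!: continuous_intros continuous_on_poisson_kernel c)
    then show ?thesis unfolding J_def using fourier_coeff_eq_integral[OF continuous_on_poisson_kernel[OF c]] by simp
  qed
  have pos: "J (int n) = complex_of_real (\<alpha> ^ n) * J 0" for n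
  proof -
    have "complex_of_real (\<alpha> + 1 / \<alpha>) * J (int (Suc n)) = J (int (Suc (Suc n))) + J (int n)" for n
      using rec[of "int (Suc n)"] unfolding c2 by (simp add: add_ac)
    from bounded_recurrence_geometric[where a = "\<lambda>n. J (int n)", OF \<alpha> bound this] show ?thesis by simp
  qed
  have neg: "J (- int n) = complex_of_real (\<alpha> ^ n) * J 0" for n
  proof -
    have "complex_of_real (\<alpha> + 1 / \<alpha>) * J (- int (Suc n)) = J (- int (Suc (Suc n))) + J (- int n)" for n
      using rec[of "- int (Suc n)"] unfolding c2 by (simp add: algebra_simps)
    from bounded_recurrence_geometric[where a = "\<lambda>n. J (- int n)", OF \<alpha> bound this] show ?thesis by simp
  qed
  have "complex_of_real (\<alpha> + 1 / \<alpha>) * J 0 = 2 * complex_of_real \<alpha> * J 0 + complex_of_real ?c"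
    using rec[of 0] pos[of 1] neg[of 1] unfolding c2 by simp
  then have "complex_of_real (1 / \<alpha> - \<alpha>) * J 0 = complex_of_real ?c" by (simp add: algebra_simps)
  moreover have "1 / \<alpha> - \<alpha> \<noteq> 0" 
  proof -
    have "1 / \<alpha> - \<alpha> = (1 - \<alpha>) * (1 + \<alpha>) / \<alpha>" using \<alpha> by (simp add: field_simps)
    then show ?thesis using \<alpha> by simp
  qed
  moreover have "?c / (1 / \<alpha> - \<alpha>) = zigzag_density \<alpha>"
    using \<alpha> calculation(2) by (simp add: conductance_def divide_simps) (simp add: algebra_simps power2_eq_square)
  ultimately have J0: "J 0 = complex_of_real (zigzag_density \<alpha>)"
    by (metis nonzero_mult_div_cancel_left of_real_divide of_real_eq_0_iff)
  have "J k = complex_of_real (\<alpha> ^ nat \<bar>k\<bar>) * J 0"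
    using pos[of "nat \<bar>k\<bar>"] neg[of "nat \<bar>k\<bar>"] by (cases "0 \<le> k") auto
  then have "J k = complex_of_real (zigzag_density \<alpha> * \<alpha> ^ nat \<bar>k\<bar>)" by (simp add: J0 mult.commute)
  then show ?thesis by (simp only: J_def)
qed

lemma fourier_coeff_one: "fourier_coeff (\<lambda>_. 1) k = of_bool (k = 0)"
  using fourier_coeff_eq_integral[of "\<lambda>_. 1" k] integral_character[of k] by simp

lemma fourier_coeff_scale: "fourier_coeff (\<lambda>x. p * f x) k = complex_of_real p * fourier_coeff f k"
proof -
  have "fourier_coeff (\<lambda>x. p * f x) k =
     (LINT x:{0..1}|lebesgue. complex_of_real p * (complex_of_real (f x) * exp (- 2 * pi * \<i> * of_int k * x)))"
    by (simp add: fourier_coeff_def mult.assoc)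
  then show ?thesis unfolding fourier_coeff_def by (simp only: set_integral_mult_right)
qed

section \<open>The renewal recurrence\<close>

text \<open>The convolution \<open>w\<close> of \<open>g\<close> with \<open>\<gamma>^i\<close> satisfies a first order recurrence. Differences of the equation
  express \<open>w\<close> by \<open>g\<close>, and a three-term recurrence remains.\<close>

lemma renewal_recurrence:
  fixes g :: "nat \<Rightarrow> real"
  assumes eq: "\<And>n. g n + \<rho> * (\<Sum>i\<le>n. (1 - \<gamma> ^ i) * g (n - i)) = 1"
  shows "g 0 = 1" and "g (Suc 0) = 1 - \<rho> * (1 - \<gamma>)"
    and "g (Suc (Suc n)) = (1 + \<gamma> - \<rho> * (1 - \<gamma>)) * g (Suc n) - \<gamma> * g n"
proof -
  define s where "s n = (\<Sum>i\<le>n. g (n - i))" for n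
  define w where "w n = (\<Sum>i\<le>n. \<gamma> ^ i * g (n - i))" for n
  have s: "s (Suc n) = g (Suc n) + s n" for n
    unfolding s_def by (subst sum.atMost_Suc_shift) simp
  have w: "w (Suc n) = g (Suc n) + \<gamma> * w n" for n
    unfolding w_def by (subst sum.atMost_Suc_shift) (simp add: sum_distrib_left mult.assoc)
  have eq': "g n + \<rho> * (s n - w n) = 1" for n
    using eq[of n] by (simp add: s_def w_def left_diff_distrib sum_subtractf)
  have step: "g (Suc n) = g n - \<rho> * (1 - \<gamma>) * w n" for n
    using eq'[of n] eq'[of "Suc n"] unfolding s w by (simp add: algebra_simps)
  show g0: "g 0 = 1" using eq[of 0] by simp
  show "g (Suc 0) = 1 - \<rho> * (1 - \<gamma>)" using step[of 0] g0 by (simp add: w_def)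
  have "\<gamma> * (\<rho> * (1 - \<gamma>) * w n) = \<gamma> * (g n - g (Suc n))" using step[of n] by simp
  then show "g (Suc (Suc n)) = (1 + \<gamma> - \<rho> * (1 - \<gamma>)) * g (Suc n) - \<gamma> * g n"
    using step[of "Suc n"] unfolding w by (simp add: algebra_simps)
qed

lemma survival_renewal_equation:
  assumes X: "renewal_process M X" and \<rho>: "\<rho> = \<P>(\<omega> in M. X 0 \<omega>)" "0 < \<rho>"
    and pair: "\<And>i. 1 \<le> i \<Longrightarrow> joint_prob M X i = \<rho> * (\<rho> * (1 - \<gamma> ^ i))"
  shows "survival M X n / \<rho> + \<rho> * (\<Sum>i\<le>n. (1 - \<gamma> ^ i) * (survival M X (n - i) / \<rho>)) = 1"
proof -
  let ?G = "survival M X"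
  have P: "joint_prob M X i = of_bool (i = 0) * \<rho> + \<rho> * (\<rho> * (1 - \<gamma> ^ i))" for i
    using pair[of i] \<rho>(1) by (cases "i = 0") auto
  have "(\<Sum>i\<le>n. joint_prob M X i * ?G (n - i)) =
     (\<Sum>i\<le>n. of_bool (i = 0) * \<rho> * ?G (n - i)) + (\<Sum>i\<le>n. \<rho>\<^sup>2 * ((1 - \<gamma> ^ i) * ?G (n - i)))"
    unfolding P sum.distrib[symmetric] by (intro sum.cong refl) (simp add: power2_eq_square algebra_simps)
  also have "(\<Sum>i\<le>n. of_bool (i = 0) * \<rho> * ?G (n - i)) = \<rho> * ?G n"
    by (simp add: if_distrib[of "\<lambda>x. x * _"] of_bool_def cong: if_cong)
  finally have "\<rho> * ?G n + \<rho>\<^sup>2 * (\<Sum>i\<le>n. (1 - \<gamma> ^ i) * ?G (n - i)) = \<rho>\<^sup>2"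
    using renewal_equation[OF X, of n] \<rho>(1) by (simp add: sum_distrib_left)
  moreover have "(\<Sum>i\<le>n. (1 - \<gamma> ^ i) * (?G (n - i) / \<rho>)) = (\<Sum>i\<le>n. (1 - \<gamma> ^ i) * ?G (n - i)) / \<rho>"
    by (simp add: sum_divide_distrib)
  moreover have "x / \<rho> + \<rho> * (y / \<rho>) = 1" if "\<rho> * x + \<rho>\<^sup>2 * y = \<rho>\<^sup>2" for x y
  proof -
    have "\<rho> * (x + \<rho> * y) = \<rho> * \<rho>" using that by (simp add: power2_eq_square algebra_simps)
    then have "x + \<rho> * y = \<rho>" using \<rho>(2) by simp
    then show ?thesis using \<rho>(2) by (simp add: field_simps)
  qed
  ultimately show ?thesis by simp
qed

text \<open>With a negative discriminant the solutions oscillate. Elementary form of this: the quotient \<open>r\<close> of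
  consecutive terms is positive and bounded by \<open>b\<close>, while each step lowers it by at least \<open>\<delta> / b\<close>.\<close>

lemma nonneg_recurrence_discriminant:
  fixes g :: "nat \<Rightarrow> real"
  assumes nonneg: "\<And>n. 0 \<le> g n" and g0: "0 < g 0" and \<gamma>: "0 < \<gamma>"
    and rec: "\<And>n. g (Suc (Suc n)) = b * g (Suc n) - \<gamma> * g n"
  shows "4 * \<gamma> \<le> b\<^sup>2"
proof (rule ccontr)
  assume "\<not> 4 * \<gamma> \<le> b\<^sup>2"
  then have \<delta>: "0 < \<gamma> - b\<^sup>2 / 4" by simp
  define \<delta> where "\<delta> = \<gamma> - b\<^sup>2 / 4"
  have pos: "0 < g n" for n
  proof (induction n)
    case (Suc n)
    have "g (Suc n) \<noteq> 0"
    proof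
      assume "g (Suc n) = 0"
      then have "g (Suc (Suc n)) = - (\<gamma> * g n)" using rec[of n] by simp
      moreover have "0 < \<gamma> * g n" using Suc \<gamma> by simp
      ultimately show False using nonneg[of "Suc (Suc n)"] by simp
    qed
    then show ?case using nonneg[of "Suc n"] by simp
  qed (rule g0)
  define r where "r n = g (Suc n) / g n" for n
  have r_pos: "0 < r n" for n using pos by (simp add: r_def)
  have r_Suc: "r (Suc n) = b - \<gamma> / r n" for n
    using pos[of n] pos[of "Suc n"] rec[of n] by (simp add: r_def field_simps)
  have r_b: "r (Suc n) < b" for n using r_Suc[of n] r_pos[of n] \<gamma> by simp
  have b: "0 < b" using r_pos[of 1] r_b[of 0] by simp
  have dec: "r (Suc (Suc n)) \<le> r (Suc n) - \<delta> / b" for n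
  proof -
    let ?x = "r (Suc n)"
    have "\<delta> / b \<le> \<delta> / ?x" using r_pos[of "Suc n"] r_b[of n] \<delta> by (intro divide_left_mono) (auto simp: \<delta>_def)
    also have "\<dots> \<le> (?x\<^sup>2 - b * ?x + \<gamma>) / ?x"
    proof (rule divide_right_mono)
      have "?x\<^sup>2 - b * ?x + \<gamma> = (?x - b / 2)\<^sup>2 + \<delta>" by (simp add: \<delta>_def power2_eq_square algebra_simps)
      then show "\<delta> \<le> ?x\<^sup>2 - b * ?x + \<gamma>" by simp
    qed (use r_pos[of "Suc n"] in simp)
    also have "\<dots> = ?x - r (Suc (Suc n))"
      unfolding r_Suc[of "Suc n"] using r_pos[of "Suc n"] by (simp add: field_simps power2_eq_square)
    finally show ?thesis by simp
  qed
  have lin: "r (Suc n) \<le> b - real n * (\<delta> / b)" for n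
  proof (induction n)
    case (Suc n)
    then show ?case using dec[of n] by (simp add: algebra_simps add_divide_distrib)
  qed (use r_b[of 0] in simp)
  have "0 < \<delta> / b" using \<delta> b by (simp add: \<delta>_def)
  then obtain n where "b < real n * (\<delta> / b)" using reals_Archimedean3 by blast
  with lin[of n] r_pos[of "Suc n"] show False by simp
qed

section \<open>Determinantal renewal processes\<close>

lemma det_mat_2: "Determinant.det (Matrix.mat 2 2 f) = f (0, 0) * f (1, 1) - f (0, 1) * f (1, 0)"
  for f :: "nat \<times> nat \<Rightarrow> 'a :: comm_ring_1"
proof -
  have "Determinant.det (Matrix.mat 2 2 f) = (\<Sum>i<2. Matrix.mat 2 2 f $$ (i, 0) * cofactor (Matrix.mat 2 2 f) i 0)"
    by (rule laplace_expansion_column) auto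
  then show ?thesis by (simp add: numeral_2_eq_2 cofactor_def mat_delete_def det_single mult.commute)
qed

lemma det_mat_3: "Determinant.det (Matrix.mat 3 3 f) =
    f (0, 0) * (f (1, 1) * f (2, 2) - f (1, 2) * f (2, 1))
    - f (1, 0) * (f (0, 1) * f (2, 2) - f (0, 2) * f (2, 1))
    + f (2, 0) * (f (0, 1) * f (1, 2) - f (0, 2) * f (1, 1))"
  for f :: "nat \<times> nat \<Rightarrow> 'a :: comm_ring_1"
proof -
  have "Determinant.det (Matrix.mat 3 3 f) = (\<Sum>i<3. Matrix.mat 3 3 f $$ (i, 0) * cofactor (Matrix.mat 3 3 f) i 0)"
    by (rule laplace_expansion_column) auto
  also have "\<dots> = (\<Sum>i\<in>{0, 1, 2}. Matrix.mat 3 3 f $$ (i, 0) * cofactor (Matrix.mat 3 3 f) i 0)"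
    by (rule sum.cong) auto
  finally show ?thesis
    by (simp add: cofactor_def mat_delete_def det_mat_2 numeral_2_eq_2[symmetric] algebra_simps)
qed

lemma principal_minor_pair:
  assumes "i < j"
  shows "principal_minor A {i, j} = A i i * A j j - A i j * A j i"
proof -
  have "sorted_list_of_set {i, j} = [i, j]" "card {i, j} = 2" using assms by auto
  then show ?thesis by (simp add: principal_minor_def Let_def det_mat_2)
qed

lemma principal_minor_triple:
  assumes "i < j" "j < k"
  shows "principal_minor A {i, j, k} =
    A i i * (A j j * A k k - A j k * A k j) - A j i * (A i j * A k k - A i k * A k j)
    + A k i * (A i j * A j k - A i k * A j j)"
proof -
  have "sorted_list_of_set {i, j, k} = [i, j, k]" "card {i, j, k} = 3" using assms by auto
  then show ?thesis by (simp add: principal_minor_def Let_def det_mat_3 numeral_2_eq_2)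
qed

text \<open>For three points, the renewal property and the determinant together say that \<open>\<rho> a(m + n) - a(m) a(n)\<close> has
  a square that is a nonnegative multiple of \<open>Re z - |z|\<close>, where \<open>z\<close> is the cyclic product of the entries of \<open>K\<close>.
  Phases of \<open>K\<close> enter only through \<open>z\<close>, so \<open>K\<close> itself may be far from a function of \<open>l - k\<close>.\<close>

lemma determinantal_renewal_modulus:
  assumes det: "determinantal M X K" and X: "renewal_process M X"
    and \<rho>: "\<rho> = \<P>(\<omega> in M. X 0 \<omega>)" "0 < \<rho>"
  obtains \<beta> where "0 \<le> \<beta>" "\<beta> \<le> 1"
    "\<And>n. 1 \<le> n \<Longrightarrow> joint_prob M X n = \<rho> * (\<rho> * (1 - \<beta> ^ (2 * n)))"
proof -
  from X have st: "stationary M X" by (simp add: renewal_process_def)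
  have herm: "K l k = cnj (K k l)" for k l using det unfolding determinantal_def by blast
  have minor: "complex_of_real (all_ones M X S) = principal_minor K S" if "finite S" for S
    using det that unfolding determinantal_def all_ones_def by blast
  define u where "u n = joint_prob M X n / \<rho>" for n
  have gap: "gap_product (all_ones M X) \<rho> u"
    using renewal_process_gap_product[OF X] \<rho> unfolding u_def by simp
  define a where "a n = cmod (K 0 (int n))" for n
  have diag: "K k k = complex_of_real \<rho>" for k
    using minor[of "{k}"] gap by (simp add: principal_minor_singleton gap_product_def)
  have norm2: "K k l * K l k = complex_of_real ((cmod (K k l))\<^sup>2)" for k l
    unfolding herm[of l k] by (rule complex_norm_square[symmetric])
  have pair: "all_ones M X {k, k + int n} = \<rho> * u n" if "1 \<le> n" for k n
    using gap_product_insert[OF gap, of "{k}" "k + int n"] gap that by (simp add: gap_product_def insert_commute)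
  have pair': "\<rho> * u n = \<rho>\<^sup>2 - (cmod (K k (k + int n)))\<^sup>2" if n: "1 \<le> n" for k n
  proof -
    have "complex_of_real (\<rho> * u n) = principal_minor K {k, k + int n}"
      using minor[of "{k, k + int n}"] pair[OF n, of k] by simp
    also have "\<dots> = complex_of_real (\<rho>\<^sup>2 - (cmod (K k (k + int n)))\<^sup>2)"
      using n norm2[of k "k + int n"] by (simp add: principal_minor_pair diag power2_eq_square)
    finally show ?thesis by (simp only: of_real_eq_iff)
  qed
  have a: "cmod (K k (k + int n)) = a n" if n: "1 \<le> n" for k n
  proof -
    have "(cmod (K k (k + int n)))\<^sup>2 = (a n)\<^sup>2" using pair'[OF n, of k] pair'[OF n, of 0] by (simp add: a_def)
    then show ?thesis by (simp add: a_def power2_eq_iff_nonneg)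
  qed
  have u: "\<rho> * u n = \<rho>\<^sup>2 - (a n)\<^sup>2" if "1 \<le> n" for n using pair'[OF that, of 0] by (simp add: a_def)
  have mult: "\<rho> * a (m + n) = a m * a n" if mn: "1 \<le> m" "1 \<le> n" for m n
  proof -
    let ?i = "int m" and ?j = "int m + int n"
    define z where "z = K 0 ?i * K ?i ?j * K ?j 0"
    have aij: "cmod (K 0 ?i) = a m" "cmod (K ?i ?j) = a n" "cmod (K 0 ?j) = a (m + n)"
      using a[OF mn(1), of 0] a[OF mn(2), of ?i] a[of "m + n" 0] mn by simp_all
    have "all_ones M X (insert ?j {0, ?i}) = all_ones M X {0, ?i} * u (nat (?j - Max {0, ?i}))"
      by (rule gap_product_insert[OF gap]) (use mn in auto)
    then have "all_ones M X {0, ?i, ?j} = all_ones M X {0, ?i} * u n" by (simp add: insert_commute)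
    then have "all_ones M X {0, ?i, ?j} = \<rho> * u m * u n" using pair[OF mn(1), of 0] by simp
    then have "complex_of_real (\<rho> * u m * u n) = principal_minor K {0, ?i, ?j}"
      using minor[of "{0, ?i, ?j}"] by simp
    also have "\<dots> = complex_of_real (\<rho> ^ 3) - complex_of_real \<rho> * (K ?i ?j * K ?j ?i + K 0 ?i * K ?i 0 + K 0 ?j * K ?j 0)
        + (z + cnj z)"
    proof -
      have "cnj z = K ?i 0 * K ?j ?i * K 0 ?j"
        unfolding z_def by (simp add: herm[symmetric])
      then show ?thesis
        using mn by (simp add: principal_minor_triple diag z_def power3_eq_cube algebra_simps)
    qed
    also have "\<dots> = complex_of_real (\<rho> ^ 3 - \<rho> * ((a n)\<^sup>2 + (a m)\<^sup>2 + (a (m + n))\<^sup>2) + 2 * Re z)"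
      unfolding norm2 aij complex_add_cnj by simp
    finally have eq: "\<rho> * u m * u n = \<rho> ^ 3 - \<rho> * ((a n)\<^sup>2 + (a m)\<^sup>2 + (a (m + n))\<^sup>2) + 2 * Re z"
      by (simp only: of_real_eq_iff)
    have "\<rho> * (\<rho> * u m * u n) = (\<rho> * u m) * (\<rho> * u n)" by simp
    also have "\<dots> = (\<rho>\<^sup>2 - (a m)\<^sup>2) * (\<rho>\<^sup>2 - (a n)\<^sup>2)" using u mn by simp
    \<comment> \<open>the equality case of the inequality between arithmetic and geometric mean\<close>
    finally have sq: "(\<rho> * a (m + n) - a m * a n)\<^sup>2 = 2 * \<rho> * (Re z - a m * a n * a (m + n))"
      unfolding eq by (simp add: algebra_simps power2_eq_square power3_eq_cube)
    have "Re z \<le> cmod z" by (rule complex_Re_le_cmod)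
    also have "cmod z = a m * a n * a (m + n)"
      unfolding z_def norm_mult herm[of ?j 0] complex_mod_cnj aij by simp
    finally have "2 * \<rho> * (Re z - a m * a n * a (m + n)) \<le> 0"
      using \<rho>(2) by (simp add: mult_nonneg_nonpos)
    then have "(\<rho> * a (m + n) - a m * a n)\<^sup>2 \<le> 0" unfolding sq .
    then show ?thesis by simp
  qed
  define \<beta> where "\<beta> = a 1 / \<rho>"
  have a_pow: "a n = \<rho> * \<beta> ^ n" if "1 \<le> n" for n
    using that
  proof (induction n rule: nat_induct_at_least)
    case base
    show ?case using \<rho>(2) by (simp add: \<beta>_def)
  next
    case (Suc n)
    have "a 1 = \<rho> * \<beta>" using \<rho>(2) by (simp add: \<beta>_def)
    then have "\<rho> * a (Suc n) = \<rho> * (\<rho> * \<beta> ^ Suc n)" using mult[of n 1] Suc by (simp add: mult_ac)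
    then show ?case using \<rho>(2) by simp
  qed
  have u_eq: "u n = \<rho> * (1 - \<beta> ^ (2 * n))" if "1 \<le> n" for n
  proof -
    have "\<rho> * u n = \<rho> * (\<rho> * (1 - \<beta> ^ (2 * n)))"
      unfolding u[OF that] a_pow[OF that] by (simp add: power2_eq_square algebra_simps power_mult)
    then show ?thesis using \<rho>(2) by simp
  qed
  show ?thesis
  proof (rule that)
    show "0 \<le> \<beta>" using \<rho>(2) by (simp add: \<beta>_def a_def)
    have "0 \<le> u 1" using \<rho>(2) by (simp add: u_def)
    then have "\<beta>\<^sup>2 \<le> 1" using u_eq[of 1] \<rho>(2) by (simp add: zero_le_mult_iff)
    then show "\<beta> \<le> 1" by (simp add: abs_square_le_1 abs_le_iff)
    show "joint_prob M X n = \<rho> * (\<rho> * (1 - \<beta> ^ (2 * n)))" if "1 \<le> n" for n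
      using u_eq[OF that] \<rho>(2) by (simp add: u_def field_simps)
  qed
qed

lemma survival_nonneg: "0 \<le> survival M X n"
  by (simp add: survival_def)

text \<open>If \<open>\<beta> = 1\<close>, no two ones could ever occur together, so every survival probability would equal \<open>\<rho>\<close>,
  against \<open>stationary_survival_sum_le\<close>. For \<open>\<beta> < 1\<close> the recurrence of the survival probabilities has
  discriminant \<open>d^2 - 4 \<beta>^2\<close>, which must not be negative; as \<open>d\<close> is nonnegative this means
  \<open>2 \<beta> \<le> d\<close>, and that is the claim up to the factor \<open>1 - \<beta>\<close>.\<close>

lemma renewal_geometric_bound:
  assumes X: "renewal_process M X" and \<rho>: "\<rho> = \<P>(\<omega> in M. X 0 \<omega>)" "0 < \<rho>"
    and \<beta>: "0 \<le> \<beta>" "\<beta> \<le> 1"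
    and pair: "\<And>n. 1 \<le> n \<Longrightarrow> joint_prob M X n = \<rho> * (\<rho> * (1 - \<beta> ^ (2 * n)))"
  shows "\<beta> < 1" and "\<rho> * (1 + \<beta>) \<le> 1 - \<beta>"
proof -
  from X have st: "stationary M X" and b: "bit_process M X" by (simp_all add: renewal_process_def stationary_def)
  interpret prob_space M using b by (simp add: bit_process_def)
  define g where "g n = survival M X n / \<rho>" for n
  have "joint_prob M X i = \<rho> * (\<rho> * (1 - (\<beta>\<^sup>2) ^ i))" if "1 \<le> i" for i
    using pair[OF that] by (simp add: power_mult)
  note eq = survival_renewal_equation[OF X \<rho> this, folded g_def]
  note rec = renewal_recurrence[where g = g, OF eq]
  show "\<beta> < 1"
  proof (rule ccontr)
    assume "\<not> \<beta> < 1"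
    with \<beta> have [simp]: "\<beta> = 1" by simp
    have "survival M X n = \<rho>" for n using eq[of n] \<rho>(2) by (simp add: g_def)
    then have "real (Suc n) * \<rho> \<le> 1" for n using stationary_survival_sum_le[OF st, of n] by simp
    moreover obtain n where "1 < real n * \<rho>" using reals_Archimedean3[OF \<rho>(2)] by blast
    ultimately show False using \<rho>(2) by (metis not_le mult_right_mono of_nat_le_iff le_SucI order_refl less_imp_le order_less_le_trans)
  qed
  show "\<rho> * (1 + \<beta>) \<le> 1 - \<beta>"
  proof (cases "\<beta> = 0")
    case True
    then show ?thesis using \<rho>(1) by simp
  next
    case False
    define d where "d = 1 + \<beta>\<^sup>2 - \<rho> * (1 - \<beta>\<^sup>2)"
    have "4 * \<beta>\<^sup>2 \<le> d\<^sup>2"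
    proof (rule nonneg_recurrence_discriminant)
      show "0 \<le> g n" for n using \<rho>(2) by (simp add: g_def survival_nonneg)
      show "0 < g 0" using rec(1) by simp
      show "g (Suc (Suc n)) = d * g (Suc n) - \<beta>\<^sup>2 * g n" for n unfolding d_def by (rule rec(3))
    qed (use False in simp)
    then have "(2 * \<beta>)\<^sup>2 \<le> d\<^sup>2" by (simp add: power2_eq_square)
    moreover have "0 \<le> d"
    proof -
      have "\<rho> * (1 - \<beta>\<^sup>2) \<le> 1 * (1 - \<beta>\<^sup>2)"
        using \<rho>(1) \<beta> by (intro mult_right_mono) (auto simp: power_le_one)
      then have "2 * \<beta>\<^sup>2 \<le> d" by (simp add: d_def)
      moreover have "0 \<le> 2 * \<beta>\<^sup>2" by simp
      ultimately show ?thesis by (rule order_trans[rotated])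
    qed
    ultimately have "2 * \<beta> \<le> d" by (rule power2_le_imp_le)
    then have "(1 - \<beta>) * (\<rho> * (1 + \<beta>)) \<le> (1 - \<beta>) * (1 - \<beta>)"
      by (simp add: d_def power2_eq_square algebra_simps)
    then show ?thesis using \<open>\<beta> < 1\<close> by simp
  qed
qed

section \<open>First return times of the zigzag process\<close>

lemma gap_product_pair:
  assumes "gap_product (all_ones M X) \<rho> u"
  shows "\<P>(\<omega> in M. X 0 \<omega>) = \<rho>"
    and "1 \<le> n \<Longrightarrow> joint_prob M X n = \<rho> * u n"
proof -
  show \<rho>: "\<P>(\<omega> in M. X 0 \<omega>) = \<rho>" using assms by (simp add: gap_product_def all_ones_def)
  show "joint_prob M X n = \<rho> * u n" if "1 \<le> n"
    using gap_product_insert[OF assms, of "{0}" "int n"] that \<rho> by (simp add: all_ones_def conj_commute)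
qed

lemma first_return_iff:
  assumes "1 \<le> m"
  shows "(INF k\<in>{k::nat. 1 \<le> k \<and> Q (int k)}. enat k) = enat m \<longleftrightarrow>
    Q (int m) \<and> (\<forall>j\<in>{0<..int (m - 1)}. \<not> Q j)"
proof
  let ?K = "{k::nat. 1 \<le> k \<and> Q (int k)}"
  assume inf: "(INF k\<in>?K. enat k) = enat m"
  have "?K \<noteq> {}"
  proof
    assume "?K = {}"
    with inf show False by (simp only: image_empty) (simp add: Inf_enat_def)
  qed
  then obtain k where "enat k \<in> enat ` ?K" by blast
  from wellorder_InfI[OF this] inf have "m \<in> ?K" by auto
  moreover have "\<not> Q j" if j: "j \<in> {0<..int (m - 1)}" for j
  proof
    assume "Q j"
    moreover have "0 < j" using j by simp
    moreover from this have "1 \<le> nat j" by linarith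
    ultimately have "nat j \<in> ?K" by simp
    then have "(INF k\<in>?K. enat k) \<le> enat (nat j)" by (rule INF_lower)
    with inf j show False by simp linarith
  qed
  ultimately show "Q (int m) \<and> (\<forall>j\<in>{0<..int (m - 1)}. \<not> Q j)" by simp
next
  let ?K = "{k::nat. 1 \<le> k \<and> Q (int k)}"
  assume Q: "Q (int m) \<and> (\<forall>j\<in>{0<..int (m - 1)}. \<not> Q j)"
  show "(INF k\<in>?K. enat k) = enat m"
  proof (rule antisym)
    show "(INF k\<in>?K. enat k) \<le> enat m" by (rule INF_lower) (use Q assms in simp)
    show "enat m \<le> (INF k\<in>?K. enat k)"
    proof (rule INF_greatest)
      fix k assume k: "k \<in> ?K"
      have "\<not> k < m"
      proof
        assume "k < m"
        with k have "int k \<in> {0<..int (m - 1)}" by auto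
        with Q k show False by blast
      qed
      then show "enat m \<le> enat k" by simp
    qed
  qed
qed

lemma first_return_prob:
  assumes X: "bit_process M X" and m: "1 \<le> m"
  shows "\<P>(\<omega> in M. (INF k\<in>{k::nat. 1 \<le> k \<and> X (int k) \<omega>}. enat k) = enat m \<and> X 0 \<omega>) =
    survival M X (m - 1) - survival M X m"
proof -
  interpret prob_space M using X by (simp add: bit_process_def)
  note [measurable] = bit_process_measurable[OF X]
  let ?S = "\<lambda>n. {\<omega> \<in> space M. X 0 \<omega> \<and> (\<forall>j\<in>{0<..int n}. \<not> X j \<omega>)}"
  have "{0<..int m} = insert (int m) {0<..int (m - 1)}" using m by auto
  then have "{\<omega> \<in> space M. (INF k\<in>{k::nat. 1 \<le> k \<and> X (int k) \<omega>}. enat k) = enat m \<and> X 0 \<omega>} = ?S (m - 1) - ?S m"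
    unfolding first_return_iff[OF m, of "\<lambda>j. X j _"] by auto
  moreover have "prob (?S (m - 1) - ?S m) = prob (?S (m - 1)) - prob (?S m)"
  proof (rule finite_measure_Diff)
    show "?S m \<subseteq> ?S (m - 1)" using \<open>{0<..int m} = _\<close> by auto
  qed measurable
  ultimately show ?thesis by (simp add: survival_def)
qed

text \<open>Here \<open>\<rho> (1 - \<alpha>^2) = (1 - \<alpha>)^2\<close>, so the recurrence has the double root \<open>\<alpha>\<close> and its solution is a linear
  function times \<open>\<alpha>^n\<close>.\<close>

lemma zigzag_survival:
  assumes \<alpha>: "0 \<le> \<alpha>" "\<alpha> < 1" and X: "renewal_process M X"
    and gap: "gap_product (all_ones M X) (zigzag_density \<alpha>) (geometric_gaps (zigzag_density \<alpha>) \<alpha>)"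
  shows "survival M X n = zigzag_density \<alpha> * ((1 + real n * (1 - \<alpha>)) * \<alpha> ^ n)"
proof -
  define \<rho> where "\<rho> = zigzag_density \<alpha>"
  define g where "g n = survival M X n / \<rho>" for n
  have pos: "0 < \<rho>" using \<alpha> by (simp add: \<rho>_def)
  have \<rho>: "\<rho> = \<P>(\<omega> in M. X 0 \<omega>)" using gap_product_pair(1)[OF gap] by (simp add: \<rho>_def)
  have "joint_prob M X i = \<rho> * (\<rho> * (1 - (\<alpha>\<^sup>2) ^ i))" if "1 \<le> i" for i
    using gap_product_pair(2)[OF gap that] by (simp add: \<rho>_def power_mult)
  note rec = renewal_recurrence[where g = g, OF survival_renewal_equation[OF X \<rho> pos this, folded g_def]]
  have \<rho>\<alpha>: "\<rho> * (1 - \<alpha>\<^sup>2) = (1 - \<alpha>)\<^sup>2" using \<alpha> by (simp add: \<rho>_def field_simps power2_eq_square)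
  have "g n = (1 + real n * (1 - \<alpha>)) * \<alpha> ^ n \<and> g (Suc n) = (1 + real (Suc n) * (1 - \<alpha>)) * \<alpha> ^ Suc n"
  proof (induction n)
    case 0
    show ?case using rec(1,2) unfolding \<rho>\<alpha> by (simp add: power2_eq_square algebra_simps)
  next
    case (Suc n)
    then have g: "g n = (1 + real n * (1 - \<alpha>)) * \<alpha> ^ n"
      "g (Suc n) = (1 + real (Suc n) * (1 - \<alpha>)) * \<alpha> ^ Suc n" by auto
    show ?case using g(2) rec(3)[of n] unfolding g \<rho>\<alpha> by (simp add: power2_eq_square algebra_simps)
  qed
  moreover have "survival M X n = \<rho> * g n" using pos by (simp add: g_def)
  ultimately show ?thesis by (simp add: \<rho>_def)
qed

lemma zigzag_first_return:
  assumes \<alpha>: "0 \<le> \<alpha>" "\<alpha> < 1" and X: "renewal_process M X"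
    and gap: "gap_product (all_ones M X) (zigzag_density \<alpha>) (geometric_gaps (zigzag_density \<alpha>) \<alpha>)"
    and m: "1 \<le> m"
  shows "\<P>(\<omega> in M. (INF k\<in>{k::nat. 1 \<le> k \<and> X (int k) \<omega>}. enat k) = enat m \<bar> X 0 \<omega>)
    = (1 - \<alpha>)\<^sup>2 * real m * \<alpha> ^ (m - 1)"
proof -
  define \<rho> where "\<rho> = zigzag_density \<alpha>"
  have pos: "0 < \<rho>" using \<alpha> by (simp add: \<rho>_def)
  obtain n where n: "m = Suc n" using m by (cases m) auto
  have b: "bit_process M X" using X by (simp add: renewal_process_def stationary_def)
  note surv = zigzag_survival[OF \<alpha> X gap, folded \<rho>_def]
  have "survival M X (m - 1) - survival M X m = \<rho> * ((1 - \<alpha>)\<^sup>2 * real m * \<alpha> ^ (m - 1))"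
    unfolding surv n by (simp add: power2_eq_square algebra_simps)
  then show ?thesis
    using pos gap_product_pair(1)[OF gap, folded \<rho>_def] first_return_prob[OF b m] by (simp add: cond_prob_def)
qed

section \<open>Thinning and existence of the model\<close>

lemma zigzag_modelD:
  assumes "zigzag_model \<alpha> p M T Y"
  shows "prob_space M" "\<alpha> \<noteq> 0 \<Longrightarrow> T \<in> M \<rightarrow>\<^sub>M edge_config_space"
    "\<alpha> \<noteq> 0 \<Longrightarrow> distr M edge_config_space T = tree_measure (conductance \<alpha>)"
    "bit_process M (zigzag_process \<alpha> T)" "bit_process M Y"
  using assms bit_process_zigzag_process[of M \<alpha> T] unfolding zigzag_model_def
  by (auto simp: bit_process_def prob_space.indep_vars_def)

lemma bit_process_thinned:
  assumes "bit_process M X" "bit_process M Y"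
  shows "bit_process M (thinned X Y)"
proof -
  note [measurable] = bit_process_measurable[OF assms(1)] bit_process_measurable[OF assms(2)]
  have "Measurable.pred M (\<lambda>\<omega>. X m \<omega> \<and> Y m \<omega>)" for m by measurable
  then show ?thesis using assms(1) by (simp add: bit_process_def thinned_def[abs_def])
qed

lemma all_ones_thinned:
  assumes model: "zigzag_model \<alpha> p M T Y" and S: "finite S"
  shows "all_ones M (thinned (zigzag_process \<alpha> T) Y) S = all_ones M (zigzag_process \<alpha> T) S * p ^ card S"
proof (cases "S = {}")
  case True
  interpret prob_space M using zigzag_modelD(1)[OF model] .
  show ?thesis by (simp add: True all_ones_def prob_space)
next
  case False
  interpret prob_space M using zigzag_modelD(1)[OF model] .
  let ?X = "zigzag_process \<alpha> T"
  have ind: "indep_var (bit_space UNIV) (\<lambda>\<omega> m. ?X m \<omega>) (bit_space UNIV) (\<lambda>\<omega> m. Y m \<omega>)"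
    and indY: "indep_vars (\<lambda>_. count_space UNIV) Y UNIV" and Y: "\<And>m. \<P>(\<omega> in M. Y m \<omega>) = p"
    using model unfolding zigzag_model_def by auto
  have E: "{f. \<forall>s\<in>S. f s} \<in> sets (bit_space UNIV)"
    by (intro bit_space_Collect pred_intros_finite S) auto
  have vim: "(\<lambda>\<omega> m. Z m \<omega>) -` {f. \<forall>s\<in>S. f s} \<inter> space M = {\<omega> \<in> space M. \<forall>s\<in>S. Z s \<omega>}" for Z
    by auto
  have "all_ones M (thinned ?X Y) S = prob ((\<lambda>\<omega>. (\<lambda>m. ?X m \<omega>, \<lambda>m. Y m \<omega>)) -` ({f. \<forall>s\<in>S. f s} \<times> {f. \<forall>s\<in>S. f s}) \<inter> space M)"
    unfolding all_ones_def thinned_def by (intro arg_cong[of _ _ prob]) auto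
  also have "\<dots> = prob ((\<lambda>\<omega> m. ?X m \<omega>) -` {f. \<forall>s\<in>S. f s} \<inter> space M) * prob ((\<lambda>\<omega> m. Y m \<omega>) -` {f. \<forall>s\<in>S. f s} \<inter> space M)"
    by (rule indep_varD[OF ind E E])
  also have "\<dots> = all_ones M ?X S * all_ones M Y S" unfolding vim all_ones_def ..
  also have "all_ones M Y S = (\<Prod>s\<in>S. prob (Y s -` {True} \<inter> space M))"
  proof -
    have "{\<omega> \<in> space M. \<forall>s\<in>S. Y s \<omega>} = (\<Inter>s\<in>S. Y s -` {True} \<inter> space M)" using False by auto
    then show ?thesis unfolding all_ones_def using indep_varsD[OF indY False S, of "\<lambda>_. {True}"] by simp
  qed
  also have "\<dots> = p ^ card S"
  proof -
    have "Y s -` {True} \<inter> space M = {\<omega> \<in> space M. Y s \<omega>}" for s by auto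
    then show ?thesis using Y by simp
  qed
  finally show ?thesis .
qed

lemma gap_product_zigzag_model:
  assumes \<alpha>: "0 \<le> \<alpha>" "\<alpha> < 1" and model: "zigzag_model \<alpha> p M T Y"
  shows "gap_product (all_ones M (zigzag_process \<alpha> T))
      (zigzag_density \<alpha>) (geometric_gaps (zigzag_density \<alpha>) \<alpha>)"
    and "gap_product (all_ones M (thinned (zigzag_process \<alpha> T) Y))
      (p * zigzag_density \<alpha>) (geometric_gaps (p * zigzag_density \<alpha>) \<alpha>)"
proof -
  show X: "gap_product (all_ones M (zigzag_process \<alpha> T))
      (zigzag_density \<alpha>) (geometric_gaps (zigzag_density \<alpha>) \<alpha>)"
    using zigzag_modelD[OF model] by (intro gap_product_zigzag_process \<alpha>) auto
  show "gap_product (all_ones M (thinned (zigzag_process \<alpha> T) Y))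
      (p * zigzag_density \<alpha>) (geometric_gaps (p * zigzag_density \<alpha>) \<alpha>)"
    unfolding gap_product_def
  proof (intro conjI allI impI)
    fix S :: "int set" and t
    assume S: "finite S" "S \<noteq> {}" "Max S < t"
    then have t: "\<And>s. s \<in> S \<Longrightarrow> s < t" "t \<notin> S" by auto
    show "all_ones M (thinned (zigzag_process \<alpha> T) Y) (insert t S) =
      all_ones M (thinned (zigzag_process \<alpha> T) Y) S * (p * zigzag_density \<alpha> * (1 - \<alpha> ^ (2 * nat (t - Max S))))"
      using gap_product_insert[OF X S(1,2) t(1)] S t(2) by (simp add: all_ones_thinned[OF model])
  qed (use X in \<open>simp add: all_ones_thinned[OF model] gap_product_def\<close>)
qed

lemma distr_pair_snd:
  assumes "prob_space M" "sigma_finite_measure N"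
  shows "distr (M \<Otimes>\<^sub>M N) N snd = N"
proof (rule measure_eqI)
  interpret M: prob_space M by fact
  interpret N: sigma_finite_measure N by fact
  fix A assume "A \<in> sets (distr (M \<Otimes>\<^sub>M N) N snd)"
  then have A: "A \<in> sets N" by simp
  then have "snd -` A \<inter> space (M \<Otimes>\<^sub>M N) = space M \<times> A"
    using sets.sets_into_space by (auto simp: space_pair_measure)
  then show "emeasure (distr (M \<Otimes>\<^sub>M N) N snd) A = emeasure N A"
    using A by (simp add: emeasure_distr N.emeasure_pair_measure_Times M.emeasure_space_1)
qed simp

lemma indep_var_pair_measure:
  assumes M: "prob_space M" and N: "prob_space N" and X: "X \<in> M \<rightarrow>\<^sub>M S" and Y: "Y \<in> N \<rightarrow>\<^sub>M S'"
  shows "prob_space.indep_var (M \<Otimes>\<^sub>M N) S (X \<circ> fst) S' (Y \<circ> snd)"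
proof -
  interpret N: prob_space N by fact
  interpret P: prob_space "M \<Otimes>\<^sub>M N" by (rule prob_space_pair[OF M N])
  interpret Y: prob_space "distr N S' Y" by (rule N.prob_space_distr[OF Y])
  have "distr (M \<Otimes>\<^sub>M N) S (X \<circ> fst) = distr M S X"
    using distr_distr[OF X measurable_fst, of N] N.distr_pair_fst[of M] by simp
  moreover have "distr (M \<Otimes>\<^sub>M N) S' (Y \<circ> snd) = distr N S' Y"
    using distr_distr[OF Y measurable_snd, of M] distr_pair_snd[OF M N.sigma_finite_measure_axioms] by simp
  moreover have "distr M S X \<Otimes>\<^sub>M distr N S' Y = distr (M \<Otimes>\<^sub>M N) (S \<Otimes>\<^sub>M S') (\<lambda>(x, y). (X x, Y y))"
    by (rule pair_measure_distr[OF X Y Y.sigma_finite_measure_axioms])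
  ultimately show ?thesis
    unfolding P.indep_var_distribution_eq
    using measurable_comp[OF measurable_fst X, of N] measurable_comp[OF measurable_snd Y, of M]
    by (simp add: split_beta')
qed

text \<open>The product of the tree measure with a sequence of independent Bernoulli bits. For \<open>\<alpha> = 0\<close> the tree is
  arbitrary, and a point mass is taken.\<close>

lemma exists_zigzag_model:
  assumes \<alpha>: "0 \<le> \<alpha>" "\<alpha> < 1" and p: "0 \<le> p" "p \<le> 1"
  obtains M :: "(int set set \<times> (int \<Rightarrow> bool)) measure" and T Y where "zigzag_model \<alpha> p M T Y"
proof -
  define \<mu> where "\<mu> = (if \<alpha> = 0 then return edge_config_space {} else tree_measure (conductance \<alpha>))"
  have \<mu>: "prob_space \<mu>" "sets \<mu> = sets edge_config_space"
    using is_tree_limit_tree_measure[of \<alpha>] \<alpha>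
    by (auto simp: \<mu>_def is_tree_limit_def intro: prob_space_return)
  define b where "b = measure_pmf (bernoulli_pmf p)"
  define B where "B = PiM UNIV (\<lambda>_::int. b)"
  interpret b: prob_space b unfolding b_def by (rule measure_pmf.prob_space_axioms)
  interpret PB: product_prob_space "\<lambda>_::int. b" UNIV ..
  have B: "prob_space B" "sets B = sets (bit_space UNIV)"
    unfolding B_def bit_space_def
    by (auto intro!: prob_space_PiM b.prob_space_axioms sets_PiM_cong) (simp add: b_def)
  interpret B: prob_space B by (rule B(1))
  define M where "M = \<mu> \<Otimes>\<^sub>M B"
  interpret M: prob_space M unfolding M_def by (rule prob_space_pair[OF \<mu>(1) B(1)])
  have snd_distr: "distr M B snd = B"
    unfolding M_def by (rule distr_pair_snd[OF \<mu>(1) B.sigma_finite_measure_axioms])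
  have fst: "fst \<in> M \<rightarrow>\<^sub>M \<mu>" and snd: "snd \<in> M \<rightarrow>\<^sub>M B" unfolding M_def by simp_all
  define Y where "Y = (\<lambda>m (\<omega> :: int set set \<times> (int \<Rightarrow> bool)). snd \<omega> m)"
  have comp: "(\<lambda>f. f m) \<in> B \<rightarrow>\<^sub>M b" for m unfolding B_def by measurable
  have Yb: "Y m \<in> M \<rightarrow>\<^sub>M b" for m
    unfolding Y_def using measurable_compose[OF snd comp] by simp
  have Y_distr: "distr M b (Y m) = b" for m
  proof -
    have "distr M b (Y m) = distr (distr M B snd) b (\<lambda>f. f m)"
      by (subst distr_distr[OF comp snd]) (simp add: Y_def comp_def)
    also have "\<dots> = b" unfolding snd_distr unfolding B_def by (rule PB.PiM_component) simp
    finally show ?thesis .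
  qed
  have "M.indep_vars (\<lambda>_. b) Y UNIV"
  proof (subst M.indep_vars_iff_distr_eq_PiM)
    show "distr M (PiM UNIV (\<lambda>_. b)) (\<lambda>x. \<lambda>i\<in>UNIV. Y i x) = PiM UNIV (\<lambda>i. distr M b (Y i))"
      unfolding Y_distr using snd_distr by (simp add: Y_def B_def restrict_UNIV)
  qed (use Yb in simp_all)
  then have indY: "M.indep_vars (\<lambda>_. count_space UNIV) Y UNIV"
    unfolding M.indep_vars_def2 by (simp add: b_def)
  have Yp: "\<P>(\<omega> in M. Y m \<omega>) = p" for m
  proof -
    have "measure (distr M b (Y m)) {True} = measure M (Y m -` {True} \<inter> space M)"
      by (rule measure_distr[OF Yb]) (simp add: b_def)
    moreover have "Y m -` {True} \<inter> space M = {\<omega> \<in> space M. Y m \<omega>}" by auto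
    moreover have "measure b {True} = p" using p by (simp add: b_def measure_pmf_single)
    ultimately show ?thesis unfolding Y_distr by simp
  qed
  have path: "bit_process \<mu> (zigzag_process \<alpha> (\<lambda>t. t))"
    using \<mu> by (intro bit_process_zigzag_process) (auto intro: measurable_ident_sets)
  have "(\<lambda>f. f) \<in> B \<rightarrow>\<^sub>M bit_space UNIV" using B(2) by (intro measurable_ident_sets)
  then have "M.indep_var (bit_space UNIV) ((\<lambda>t m. zigzag_process \<alpha> (\<lambda>t. t) m t) \<circ> fst) (bit_space UNIV) ((\<lambda>f. f) \<circ> snd)"
    unfolding M_def by (rule indep_var_pair_measure[OF \<mu>(1) B(1) bit_process_path_measurable[OF path]])
  moreover have "(\<lambda>t m. zigzag_process \<alpha> (\<lambda>t. t) m t) \<circ> fst =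
      (\<lambda>(\<omega> :: int set set \<times> (int \<Rightarrow> bool)) m. zigzag_process \<alpha> fst m \<omega>)"
    "(\<lambda>f. f) \<circ> snd = (\<lambda>\<omega> m. Y m \<omega>)"
    by (auto simp: fun_eq_iff zigzag_process_def Y_def)
  ultimately have ind: "M.indep_var (bit_space UNIV) (\<lambda>\<omega> m. zigzag_process \<alpha> fst m \<omega>) (bit_space UNIV) (\<lambda>\<omega> m. Y m \<omega>)"
    by (simp only:)
  have T: "fst \<in> M \<rightarrow>\<^sub>M edge_config_space" using fst measurable_cong_sets[OF refl \<mu>(2)] by blast
  have "distr M edge_config_space fst = distr M \<mu> fst" by (rule distr_cong) (use \<mu>(2) in simp_all)
  also have "\<dots> = \<mu>" unfolding M_def by (rule B.distr_pair_fst)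
  finally have T': "\<alpha> \<noteq> 0 \<longrightarrow> distr M edge_config_space fst = tree_measure (conductance \<alpha>)"
    by (simp add: \<mu>_def)
  have "zigzag_model \<alpha> p M fst Y"
    unfolding zigzag_model_def using M.prob_space_axioms T T' indY Yp ind by blast
  then show ?thesis by (rule that)
qed

text \<open>The law is determined by \<open>\<rho>\<close> and \<open>\<beta>\<close>, and \<open>q\<close> is chosen so that \<open>q * zigzag_density \<beta> = \<rho>\<close>. If
  \<open>\<rho> = 0\<close> there are almost surely no ones, and \<open>q = 0\<close> will do.\<close>

lemma determinantal_renewal_is_thinned_zigzag:
  assumes det: "determinantal N Z K" and Z: "renewal_process N Z"
  obtains \<beta> q and M :: "(int set set \<times> (int \<Rightarrow> bool)) measure" and T Y
    where "0 \<le> \<beta>" "\<beta> < 1" "0 \<le> q" "q \<le> 1" "zigzag_model \<beta> q M T Y"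
      "process_law N Z = process_law M (thinned (zigzag_process \<beta> T) Y)"
proof -
  have b: "bit_process N Z" using det by (simp add: determinantal_def)
  interpret N: prob_space N using b by (simp add: bit_process_def)
  define \<rho> where "\<rho> = \<P>(\<omega> in N. Z 0 \<omega>)"
  have "\<exists>\<beta> q. 0 \<le> \<beta> \<and> \<beta> < 1 \<and> 0 \<le> q \<and> q \<le> 1 \<and>
    gap_product (all_ones N Z) (q * zigzag_density \<beta>) (geometric_gaps (q * zigzag_density \<beta>) \<beta>)"
  proof (cases "\<rho> = 0")
    case True
    note [measurable] = bit_process_measurable[OF b]
    have one: "all_ones N Z {t} = 0" for t
      using stationary_shift_prob[of N Z "\<lambda>f. f 0" t] Z True by (simp add: renewal_process_def all_ones_def \<rho>_def)
    have "all_ones N Z S = 0" if S: "finite S" "S \<noteq> {}" for S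
    proof -
      obtain s where s: "s \<in> S" using S by blast
      have "all_ones N Z S \<le> all_ones N Z {s}"
        unfolding all_ones_def by (rule N.finite_measure_mono) (use s in auto)
      then show ?thesis using one[of s] measure_nonneg[of N] by (simp add: all_ones_def order.antisym)
    qed
    then have "gap_product (all_ones N Z) 0 (\<lambda>_. 0)" by (simp add: gap_product_def)
    then show ?thesis by (intro exI[of _ 0]) simp
  next
    case False
    then have pos: "0 < \<rho>" by (simp add: \<rho>_def zero_less_measure_iff)
    obtain \<beta> where \<beta>: "0 \<le> \<beta>" "\<beta> \<le> 1"
      and pair: "\<And>n. 1 \<le> n \<Longrightarrow> joint_prob N Z n = \<rho> * (\<rho> * (1 - \<beta> ^ (2 * n)))"
      using determinantal_renewal_modulus[OF det Z \<rho>_def pos] by blast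
    note bound = renewal_geometric_bound[OF Z \<rho>_def pos \<beta> pair]
    define q where "q = \<rho> * (1 + \<beta>) / (1 - \<beta>)"
    have "1 - \<beta> \<noteq> 0" "1 + \<beta> \<noteq> 0" using bound(1) \<beta> by auto
    then have q: "q * zigzag_density \<beta> = \<rho>" by (simp add: q_def)
    have q01: "0 \<le> q" "q \<le> 1"
      using bound \<beta> pos by (simp_all add: q_def divide_le_eq_1)
    have gap: "gap_product (all_ones N Z) \<rho> (\<lambda>n. joint_prob N Z n / \<rho>)"
      using renewal_process_gap_product[OF Z] pos unfolding \<rho>_def by simp
    have "gap_product (all_ones N Z) \<rho> (geometric_gaps \<rho> \<beta>)"
      unfolding gap_product_def
    proof (intro conjI allI impI)
      show "all_ones N Z {t} = \<rho>" for t using gap by (simp add: gap_product_def)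
      fix S :: "int set" and t assume S: "finite S" "S \<noteq> {}" "Max S < t"
      then have "1 \<le> nat (t - Max S)" by linarith
      from pair[OF this] show "all_ones N Z (insert t S) = all_ones N Z S * (\<rho> * (1 - \<beta> ^ (2 * nat (t - Max S))))"
        using gap S pos unfolding gap_product_def by simp
    qed
    then show ?thesis using \<beta> bound(1) q q01 by (intro exI[of _ \<beta>] exI[of _ q]) simp
  qed
  then obtain \<beta> q where q: "0 \<le> \<beta>" "\<beta> < 1" "0 \<le> q" "q \<le> 1"
    and gap: "gap_product (all_ones N Z) (q * zigzag_density \<beta>) (geometric_gaps (q * zigzag_density \<beta>) \<beta>)"
    by blast
  obtain M :: "(int set set \<times> (int \<Rightarrow> bool)) measure" and T Y where model: "zigzag_model \<beta> q M T Y"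
    using exists_zigzag_model[OF q] .
  note D = zigzag_modelD[OF model]
  interpret M: prob_space M by (rule D(1))
  have "process_law N Z = process_law M (thinned (zigzag_process \<beta> T) Y)"
  proof (rule process_law_eqI[OF b bit_process_thinned[OF D(4,5)]])
    fix S :: "int set" assume S: "finite S"
    show "all_ones N Z S = all_ones M (thinned (zigzag_process \<beta> T) Y) S"
    proof (cases "S = {}")
      case True
      then show ?thesis by (simp add: all_ones_def M.prob_space N.prob_space)
    next
      case False
      show ?thesis
        by (rule gap_product_unique[OF gap gap_product_zigzag_model(2)[OF q(1,2) model] refl S False])
    qed
  qed
  with q model show ?thesis by (rule that)
qed

text \<open>\<open>\<alpha>\<close> is the smaller root of \<open>\<alpha> + 1 / \<alpha> = c + 2\<close>, and the two roots differ by the square root of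
  \<open>(c + 2)^2 - 4\<close>.\<close>

lemma conductance_iff:
  assumes \<alpha>: "0 < \<alpha>" "\<alpha> < 1" and c: "0 < c"
  shows "c = conductance \<alpha> \<longleftrightarrow> \<alpha> = 1 + c / 2 - sqrt (4 * c + c\<^sup>2) / 2"
proof
  assume "c = conductance \<alpha>"
  then have c2: "c + 2 = 1 / \<alpha> + \<alpha>" using \<alpha> by (simp add: conductance_def field_simps power2_eq_square)
  have "4 * c + c\<^sup>2 = (c + 2)\<^sup>2 - 4" by (simp add: power2_eq_square algebra_simps)
  also have "\<dots> = (1 / \<alpha> - \<alpha>)\<^sup>2" unfolding c2 using \<alpha> by (simp add: power2_eq_square field_simps)
  finally have "sqrt (4 * c + c\<^sup>2) = \<bar>1 / \<alpha> - \<alpha>\<bar>" by simp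
  also have "\<dots> = 1 / \<alpha> - \<alpha>"
  proof -
    have "1 / \<alpha> - \<alpha> = (1 - \<alpha>) * (1 + \<alpha>) / \<alpha>" using \<alpha> by (simp add: field_simps)
    then show ?thesis using \<alpha> by simp
  qed
  finally show "\<alpha> = 1 + c / 2 - sqrt (4 * c + c\<^sup>2) / 2" using c2 by linarith
next
  assume "\<alpha> = 1 + c / 2 - sqrt (4 * c + c\<^sup>2) / 2"
  then have "sqrt (4 * c + c\<^sup>2) = c + 2 - 2 * \<alpha>" by simp
  then have "(c + 2 - 2 * \<alpha>)\<^sup>2 = 4 * c + c\<^sup>2" using c by (metis add_nonneg_nonneg less_imp_le mult_nonneg_nonneg real_sqrt_pow2 zero_le_numeral zero_le_power2)
  then have "\<alpha> * c = (1 - \<alpha>)\<^sup>2" by (simp add: power2_eq_square algebra_simps)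
  then show "c = conductance \<alpha>" using \<alpha> by (simp add: conductance_def field_simps)
qed

theorem theorem1p6:
  fixes \<alpha> p c :: real and f f\<^sub>p :: "real \<Rightarrow> real" and A :: "int \<Rightarrow> int \<Rightarrow> complex"
  assumes "0 \<le> \<alpha>" "\<alpha> < 1" "0 \<le> p" "p \<le> 1"
    and c: "c = conductance \<alpha>"
    and f: "f = (\<lambda>x. if \<alpha> = 0 then 1 else c / (c + 2 - 2 * cos (2 * pi * x)))"
    and f\<^sub>p: "f\<^sub>p = (\<lambda>x. if \<alpha> = 0 then p else p * c / (c + 2 - 2 * cos (2 * pi * x)))"
    and A: "A = (\<lambda>k l. fourier_coeff f (l - k))"
  shows
    "(\<alpha> \<noteq> 0 \<longrightarrow> (\<forall>c'>0. c' = conductance \<alpha> \<longleftrightarrow> \<alpha> = 1 + c' / 2 - sqrt (4 * c' + c'\<^sup>2) / 2)) \<and>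
     (\<forall>(M :: 'a measure) T Y X. zigzag_model \<alpha> p M T Y \<and> X = zigzag_process \<alpha> T \<longrightarrow>
       \<comment> \<open>(i)\<close>
       (determinantal M X A \<and> has_fourier_transform A f \<and>
        (\<forall>k. fourier_coeff f k = complex_of_real ((1 - \<alpha>) / (1 + \<alpha>) * \<alpha> ^ nat \<bar>k\<bar>)) \<and>
        renewal_process M X \<and>
        (\<forall>m\<ge>1. \<P>(\<omega> in M. (INF k\<in>{k::nat. 1 \<le> k \<and> X (int k) \<omega>}. enat k) = enat m \<bar> X 0 \<omega>)
           = (1 - \<alpha>)\<^sup>2 * real m * \<alpha> ^ (m - 1))) \<and>
       \<comment> \<open>(ii)\<close>
       (determinantal M (thinned X Y) (\<lambda>k l. complex_of_real p * A k l) \<and>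
        has_fourier_transform (\<lambda>k l. complex_of_real p * A k l) f\<^sub>p)) \<and>
     \<comment> \<open>(iii)\<close>
     (\<forall>(N :: 'b measure) Z. stationary N Z \<and> (\<exists>K. determinantal N Z K) \<and> renewal_process N Z \<longrightarrow>
       (\<exists>\<beta> q (M :: (int set set \<times> (int \<Rightarrow> bool)) measure) T Y.
          0 \<le> \<beta> \<and> \<beta> < 1 \<and> 0 \<le> q \<and> q \<le> 1 \<and> zigzag_model \<beta> q M T Y \<and>
          process_law N Z = process_law M (thinned (zigzag_process \<beta> T) Y)))"
proof (intro conjI allI impI)
  note \<alpha> = assms(1,2) and p = assms(3,4)
  define \<kappa> where "\<kappa> = (1 - \<alpha>) / (1 + \<alpha>)"
  show "c' = conductance \<alpha> \<longleftrightarrow> \<alpha> = 1 + c' / 2 - sqrt (4 * c' + c'\<^sup>2) / 2" if "\<alpha> \<noteq> 0" "0 < c'" for c'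
    using conductance_iff[of \<alpha> c'] \<alpha> that by simp
  have f_eq: "f = (if \<alpha> = 0 then (\<lambda>_. 1) else poisson_kernel c)"
    unfolding f poisson_kernel_def[abs_def] by auto
  have cpos: "0 < c" if "\<alpha> \<noteq> 0" using that \<alpha> conductance_pos[of \<alpha>] c by simp
  have fp_eq: "f\<^sub>p = (\<lambda>x. p * f x)" unfolding f\<^sub>p f by auto
  have coeff: "fourier_coeff f k = complex_of_real (\<kappa> * \<alpha> ^ nat \<bar>k\<bar>)" for k
  proof (cases "\<alpha> = 0")
    case True
    then show ?thesis by (simp add: f_eq fourier_coeff_one \<kappa>_def power_0_left)
  next
    case False
    then show ?thesis using fourier_coeff_poisson_kernel[of \<alpha> k] \<alpha> by (simp add: f_eq c \<kappa>_def)
  qed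
  have f01: "0 \<le> f x" "f x \<le> 1" for x
    using poisson_kernel_bounds(2,3)[OF cpos, of x] by (auto simp: f_eq)
  have "continuous_on {0..1} f" using continuous_on_poisson_kernel[OF cpos] by (auto simp: f_eq)
  then have f_meas: "f \<in> borel_measurable (lebesgue_on {0..1})"
    by (intro continuous_imp_measurable_on_sets_lebesgue) auto
  have A_kernel: "A = geometric_kernel \<kappa> \<alpha>"
    unfolding A coeff geometric_kernel_def[abs_def] ..
  have pA_kernel: "(\<lambda>k l. complex_of_real p * A k l) = geometric_kernel (p * \<kappa>) \<alpha>"
    unfolding A_kernel geometric_kernel_def[abs_def] by (simp add: mult.assoc)
  show FA: "has_fourier_transform A f"
    unfolding has_fourier_transform_def using f01 f_meas by (auto simp: A)
  have "p * f x \<le> 1" for x using mult_mono[OF p(2) f01(2)[of x]] f01(1)[of x] by simp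
  then have fp01: "f\<^sub>p \<in> {0..1} \<rightarrow> {0..1}" using f01(1) p unfolding fp_eq by auto
  show "has_fourier_transform (\<lambda>k l. complex_of_real p * A k l) f\<^sub>p"
    unfolding has_fourier_transform_def
  proof (intro conjI allI fp01)
    show "f\<^sub>p \<in> borel_measurable (lebesgue_on {0..1})" unfolding fp_eq using f_meas by measurable
    show "complex_of_real p * A k l = complex_of_real p * A 0 (l - k)" for k l by (simp add: A)
    show "complex_of_real p * A 0 k = fourier_coeff f\<^sub>p k" for k
      unfolding fp_eq fourier_coeff_scale by (simp add: A)
  qed
  show "fourier_coeff f k = complex_of_real ((1 - \<alpha>) / (1 + \<alpha>) * \<alpha> ^ nat \<bar>k\<bar>)" for k
    using coeff[of k] by (simp add: \<kappa>_def)
  fix M :: "'a measure" and T Y X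
  assume "zigzag_model \<alpha> p M T Y \<and> X = zigzag_process \<alpha> T"
  then have model: "zigzag_model \<alpha> p M T Y" and X: "X = zigzag_process \<alpha> T" by auto
  note D = zigzag_modelD[OF model, folded X]
  note gap = gap_product_zigzag_model[OF \<alpha> model, folded X \<kappa>_def]
  show "determinantal M X A"
    unfolding A_kernel by (rule determinantal_if_gap_product[OF D(4) gap(1)])
  show "determinantal M (thinned X Y) (\<lambda>k l. complex_of_real p * A k l)"
    unfolding pA_kernel by (rule determinantal_if_gap_product[OF bit_process_thinned[OF D(4,5)] gap(2)])
  show ren: "renewal_process M X" by (rule renewal_process_if_gap_product[OF D(4) gap(1)])
  show "\<P>(\<omega> in M. (INF k\<in>{k::nat. 1 \<le> k \<and> X (int k) \<omega>}. enat k) = enat m \<bar> X 0 \<omega>) =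
      (1 - \<alpha>)\<^sup>2 * real m * \<alpha> ^ (m - 1)" if "1 \<le> m" for m
    by (rule zigzag_first_return[OF \<alpha> ren gap(1)[unfolded \<kappa>_def] that])
next
  fix N :: "'b measure" and Z
  assume "stationary N Z \<and> (\<exists>K. determinantal N Z K) \<and> renewal_process N Z"
  then obtain K where "determinantal N Z K" "renewal_process N Z" by blast
  from determinantal_renewal_is_thinned_zigzag[OF this]
  show "\<exists>\<beta> q (M :: (int set set \<times> (int \<Rightarrow> bool)) measure) T Y.
          0 \<le> \<beta> \<and> \<beta> < 1 \<and> 0 \<le> q \<and> q \<le> 1 \<and> zigzag_model \<beta> q M T Y \<and>
          process_law N Z = process_law M (thinned (zigzag_process \<beta> T) Y)" by metis
qed

end
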